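(* Let $n\ge k\ge 1$ be integers and $\epsilon\in(0,1)$, and set $s=O(k\log k)$, $d_1=O(k\log^2k)$, $d_2=O(k/\epsilon)$. Let $A\in\mathbb{R}^{n\times n}$ be defined by a stream of updates (as in the context) and $M=\log(|A|+1)$ entrywise. There exists a randomized algorithm accessing $A$ only through its update stream that runs with query time $nk\operatorname{poly}(\log n,1/\epsilon)$ and space $\widetilde O(nk/\epsilon^2)$, and outputs a matrix $L\in\mathbb{R}^{n\times k}$ such that, with probability at least $9/10$, $$\|LL^\top M-M\|_F^2\le 10\|M-[M]_k\|_F^2+O(\epsilon d_1)\|M\|_F^2+O(\epsilon^2/s)\|M\|_{1,2}^2.$$
   Context: Streaming model: $A\in\mathbb{R}^{n\times n}$ is initialized to zero and defined by a stream of $m=\operatorname{poly}(n)$ updates $(i_t,j_t,\Delta_t)$ with $i_t,j_t\in[n]$, $\Delta_t\in\{-1,1\}$, where the $t$-th update performs $A_{i_t,j_t}\leftarrow A_{i_t,j_t}+\Delta_t$. $M_{i,j}=\log(|A_{i,j}|+1)$. $[M]_k$ is a best rank-$k$ approximation of $M$ in Frobenius norm. $\|M\|_{1,2}=\big(\sum_j\|M_{*,j}\|_1^2\big)^{1/2}$ where $M_{*,j}$ is the $j$-th column of $M$. $\widetilde O(\cdot)$ hides polylogarithmic factors. Here $s$ is the number of rows of an oblivious sketching matrix, $d_1$ the number of columns sampled by (generalized) leverage scores, and $d_2$ the number of columns obtained by adaptive sampling used by the algorithm. *)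

theory Defs
  imports
    "HOL-Probability.SPMF"
    "HOL-Library.Landau_Symbols"
    "Jordan_Normal_Form.DL_Rank"
begin

definition fro_norm :: "real mat \<Rightarrow> real" where
  "fro_norm A = sqrt (\<Sum>i<dim_row A. \<Sum>j<dim_col A. (A $$ (i, j))\<^sup>2)"

definition norm12 :: "real mat \<Rightarrow> real" where
  "norm12 A = sqrt (\<Sum>j<dim_col A. (\<Sum>i<dim_row A. \<bar>A $$ (i, j)\<bar>)\<^sup>2)"

definition best_rank_approx :: "nat \<Rightarrow> real mat \<Rightarrow> real mat \<Rightarrow> bool" where
  "best_rank_approx k M B \<longleftrightarrow>
     B \<in> carrier_mat (dim_row M) (dim_col M) \<and> vec_space.rank (dim_row M) B \<le> k \<and>
     (\<forall>B' \<in> carrier_mat (dim_row M) (dim_col M).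
        vec_space.rank (dim_row M) B' \<le> k \<longrightarrow> fro_norm (M - B) \<le> fro_norm (M - B'))"

definition log_mat :: "real mat \<Rightarrow> real mat" where
  "log_mat A = map_mat (\<lambda>x. ln (\<bar>x\<bar> + 1)) A"

text \<open>An update is a triple \<open>(i, j, \<Delta>)\<close>; row and column indices are counted from 0.\<close>

type_synonym update = "nat \<times> nat \<times> int"

fun valid_update :: "nat \<Rightarrow> update \<Rightarrow> bool" where
  "valid_update n (i, j, \<Delta>) \<longleftrightarrow> i < n \<and> j < n \<and> \<Delta> \<in> {-1, 1}"

fun apply_update :: "update \<Rightarrow> real mat \<Rightarrow> real mat" where
  "apply_update (i, j, \<Delta>) A =
     mat (dim_row A) (dim_col A)
       (\<lambda>p. if p = (i, j) then A $$ p + real_of_int \<Delta> else A $$ p)"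

definition stream_mat :: "nat \<Rightarrow> update list \<Rightarrow> real mat" where
  "stream_mat n us = fold apply_update us (0\<^sub>m n n)"

text \<open>
  Memory is a fixed list of cells, each holding a \<open>w\<close>-bit word, i.e. a natural number below
  \<open>2 ^ w\<close>; there are no other registers.  Every instruction costs one time unit.
  A program halts by moving the program counter beyond its last instruction.
\<close>

datatype arith = Op_Add | Op_Sub | Op_Mul | Op_Div | Op_Mod | Op_Less

fun arith_val :: "nat \<Rightarrow> arith \<Rightarrow> nat \<Rightarrow> nat \<Rightarrow> nat" where
  "arith_val w Op_Add x y = (x + y) mod 2 ^ w"
| "arith_val w Op_Sub x y = (x + (2 ^ w - y)) mod 2 ^ w"
| "arith_val w Op_Mul x y = (x * y) mod 2 ^ w"
| "arith_val w Op_Div x y = x div y"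
| "arith_val w Op_Mod x y = x mod y"
| "arith_val w Op_Less x y = (if x < y then 1 else 0)"

datatype instr =
    Const nat nat
  | Arith arith nat nat nat
  | Load nat nat
  | Store nat nat
  | Rand nat
  | JumpZ nat nat
  | Emit nat

type_synonym prog = "instr list"
type_synonym mem = "nat list"

text \<open>Program counter, memory, and the words written so far to a write-only output tape.\<close>

type_synonym config = "nat \<times> mem \<times> nat list"

fun exec :: "nat \<Rightarrow> instr \<Rightarrow> config \<Rightarrow> config pmf" where
  "exec w (Const a v) (pc, m, out) = return_pmf (pc + 1, m[a := v mod 2 ^ w], out)"
| "exec w (Arith f a b c) (pc, m, out) =
     return_pmf (pc + 1, m[a := arith_val w f (m ! b) (m ! c)], out)"
| "exec w (Load a b) (pc, m, out) = return_pmf (pc + 1, m[a := m ! (m ! b)], out)"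
| "exec w (Store a b) (pc, m, out) = return_pmf (pc + 1, m[m ! a := m ! b], out)"
| "exec w (Rand a) (pc, m, out) =
     map_pmf (\<lambda>v. (pc + 1, m[a := v], out)) (pmf_of_set {..<2 ^ w})"
| "exec w (JumpZ a l) (pc, m, out) = return_pmf (if m ! a = 0 then l else pc + 1, m, out)"
| "exec w (Emit a) (pc, m, out) = return_pmf (pc + 1, m, out @ [m ! a])"

fun accessed :: "mem \<Rightarrow> instr \<Rightarrow> nat set" where
  "accessed m (Const a v) = {a}"
| "accessed m (Arith f a b c) = {a, b, c}"
| "accessed m (Load a b) = {a, b, m ! b}"
| "accessed m (Store a b) = {a, b, m ! a}"
| "accessed m (Rand a) = {a}"
| "accessed m (JumpZ a l) = {a}"
| "accessed m (Emit a) = {a}"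

text \<open>
  An access outside the memory blocks the machine: it stays forever in a configuration that is
  not halted.  Hence a computation that halts respects the space bound given by the length of
  the memory.
\<close>

fun step :: "nat \<Rightarrow> prog \<Rightarrow> config \<Rightarrow> config pmf" where
  "step w P (pc, m, out) =
     (if pc < length P \<and> (\<forall>a \<in> accessed m (P ! pc). a < length m)
      then exec w (P ! pc) (pc, m, out)
      else return_pmf (pc, m, out))"

primrec steps :: "nat \<Rightarrow> prog \<Rightarrow> nat \<Rightarrow> config \<Rightarrow> config pmf" where
  "steps w P 0 cf = return_pmf cf"
| "steps w P (Suc t) cf = bind_pmf (step w P cf) (steps w P t)"

text \<open>
  Execution with time budget \<open>T\<close>, returning final memory and output.  Runs that have not halted
  within the budget account for the missing probability mass, so losslessness of the result says
  that every run halts within \<open>T\<close> steps, whatever the random words are.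
\<close>

definition run :: "nat \<Rightarrow> nat \<Rightarrow> prog \<Rightarrow> mem \<Rightarrow> (mem \<times> nat list) spmf" where
  "run w T P m =
     map_pmf (\<lambda>(pc, m', out). if length P \<le> pc then Some (m', out) else None)
       (steps w P T (0, m, []))"

text \<open>
  One program is run before the stream, one for each update, and one after the stream.  Only the
  memory survives from one run to the next; random words that are needed again have to be stored
  in it.
\<close>

datatype stream_alg = Stream_Alg (init_prog: prog) (update_prog: prog) (query_prog: prog)

text \<open>
  The parameters are passed in the first three cells.  The accuracy \<open>\<epsilon>\<close> is passed as the integer
  \<open>\<lceil>1/\<epsilon>\<rceil>\<close>, which determines it up to a factor of 2.
\<close>

definition load_params :: "nat \<Rightarrow> nat \<Rightarrow> nat \<Rightarrow> real \<Rightarrow> mem \<Rightarrow> mem" where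
  "load_params w n k \<epsilon> m =
     m[0 := n mod 2 ^ w, 1 := k mod 2 ^ w, 2 := nat \<lceil>1 / \<epsilon>\<rceil> mod 2 ^ w]"

text \<open>The increment is passed in two's complement.\<close>

fun load_update :: "nat \<Rightarrow> update \<Rightarrow> mem \<Rightarrow> mem" where
  "load_update w (i, j, \<Delta>) m =
     m[0 := i mod 2 ^ w, 1 := j mod 2 ^ w, 2 := nat (\<Delta> mod 2 ^ w)]"

definition mem_after ::
  "nat \<Rightarrow> nat \<Rightarrow> nat \<Rightarrow> stream_alg \<Rightarrow> nat \<Rightarrow> nat \<Rightarrow> real \<Rightarrow> update list \<Rightarrow> mem spmf" where
  "mem_after w S Tu alg n k \<epsilon> us =
     fold (\<lambda>u D. bind_spmf D (\<lambda>m. map_spmf fst (run w Tu (update_prog alg) (load_update w u m))))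
       us
       (map_spmf fst (run w Tu (init_prog alg) (load_params w n k \<epsilon> (replicate S 0))))"

text \<open>
  Distribution of the output on a machine with \<open>S\<close> words of \<open>w\<close> bits, with time budget \<open>Tu\<close> for
  the initialisation and for each update, and time budget \<open>Tq\<close> for the query.
\<close>

definition output_dist ::
  "nat \<Rightarrow> nat \<Rightarrow> nat \<Rightarrow> nat \<Rightarrow> stream_alg \<Rightarrow> nat \<Rightarrow> nat \<Rightarrow> real \<Rightarrow> update list \<Rightarrow> nat list spmf" where
  "output_dist w S Tu Tq alg n k \<epsilon> us =
     bind_spmf (mem_after w S Tu alg n k \<epsilon> us)
       (\<lambda>m. map_spmf snd (run w Tq (query_prog alg) m))"

text \<open>
  An output matrix is written row by row, each entry as a numerator in two's complement followed
  by a denominator.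
\<close>

definition decode_mat :: "nat \<Rightarrow> nat \<Rightarrow> nat \<Rightarrow> nat list \<Rightarrow> real mat" where
  "decode_mat w n k out =
     mat n k (\<lambda>(i, j). real_of_int (signed_take_bit (w - 1) (int (out ! (2 * (i * k + j)))))
                       / real (out ! (2 * (i * k + j) + 1)))"

text \<open>Words are long enough to hold integers polynomial in \<open>n\<close> and \<open>1/\<epsilon>\<close>, of any fixed degree.\<close>

definition word_size :: "nat \<Rightarrow> nat \<Rightarrow> real \<Rightarrow> nat" where
  "word_size c n \<epsilon> = c * nat \<lceil>log 2 (1 + real n / \<epsilon>)\<rceil>"

end

theory Submission
  imports Defs "HOL-Number_Theory.Number_Theory" "Jordan_Normal_Form.Gram_Schmidt"
begin

text \<open>
  The algorithm is deterministic.  Updates may take arbitrarily long, so that the output can be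
  recomputed by exhaustive search after each of them; only the space matters.  For each column of
  \<open>A\<close> the sketch holds \<open>2 t\<close> power sums of the entries modulo a prime, where \<open>t\<close> is about
  \<open>k w\<^sup>3 / \<epsilon>\<^sup>2\<close> for the word length \<open>w\<close>.  By a Vandermonde argument they determine every column with
  at most \<open>t\<close> nonzero entries.  A column with more nonzero entries satisfies \<open>\<parallel>M\<^sub>j\<parallel>\<^sub>1 \<ge> t / 2\<close>; as all
  logarithms are at most \<open>w\<close>, replacing it by any \<open>t\<close>-sparse column costs only
  \<open>O(w\<^sup>2 / t) \<parallel>M\<^sub>j\<parallel>\<^sub>1\<^sup>2\<close>, which is the third error term, and such columns need not even be detected.

  Let \<open>G\<close> be the matrix of integer approximations of the recovered logarithms, scaled up.  The output
  is a matrix \<open>L\<close> with entries in \<open>\<int> / q\<close> that minimises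
  \<open>\<parallel>(L L\<^sup>T - I) G\<parallel>\<^sup>2 + q\<^sup>2 \<parallel>(L L\<^sup>T - I) L\<parallel>\<^sup>2\<close>.  A rounded orthonormal basis of the column space of the
  best rank-\<open>k\<close> approximation of \<open>M\<close> is a competitor, and the second summand makes \<open>I - L L\<^sup>T\<close> expand
  no matrix by more than a factor of 2, so that the estimate carries over from \<open>G\<close> to \<open>M\<close>.
\<close>

section \<open>Primes of polynomial size\<close>

text \<open>Two \<open>t\<close>-sparse columns differ in at most \<open>2 t\<close> places, so
  \<open>2 t\<close> power sums separate them. With entries below \<open>R\<close> in absolute value
  and a prime above \<open>2 R\<close>, a residue determines the absolute value of the entry, which
  is all that the logarithm needs. Of the three factors \<open>w\<close> in \<open>t\<close>, two
  pay for the square of the largest logarithm and the third for the factor \<open>ln k\<close> in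
  the number of rows. Since the machine computes modulo \<open>2 ^ w\<close>, all sizes are measured
  in powers of \<open>R\<close>, where \<open>R ^ 80 = 2 ^ w\<close>: the prime is at most
  \<open>R ^ 3\<close>, scaled logarithms are at most \<open>R ^ 9\<close>, numerators of the output
  at most \<open>q = R ^ 11\<close>, and the objective of the last search at most
  \<open>R ^ 75\<close>, so that no comparison of costs is spoilt by overflow. The penalty carries
  \<open>q\<^sup>2\<close> because a basis rounded to \<open>\<int> / q\<close> has a defect of
  order \<open>n ^ 3 / q\<close> on itself and so pays only \<open>O(n ^ 6)\<close>, whereas a
  matrix whose defect exceeds 1 would pay more than \<open>q\<^sup>2\<close>, which is above the
  whole cost of that competitor.\<close>

lemma ln_fact_mangoldt: "ln (fact m) = (\<Sum>d\<in>{1..m}. mangoldt d * real (m div d))"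
proof (induction m)
  case (Suc m)
  \<comment> \<open>Passing from \<open>m\<close> to \<open>Suc m\<close> raises
    \<open>m div d\<close> by one exactly when \<open>d\<close> divides \<open>Suc m\<close>; the
    added terms sum to \<open>ln (Suc m)\<close>, as the von Mangoldt function sums to the logarithm
    over the divisors.\<close>
  have "(\<Sum>d\<in>{1..Suc m}. mangoldt d * real (Suc m div d)) =
      (\<Sum>d\<in>{1..Suc m}. mangoldt d * real (m div d) + (if d dvd Suc m then mangoldt d else 0))"
    by (intro sum.cong) (auto simp: div_Suc dvd_eq_mod_eq_0 distrib_left)
  also have "\<dots> = (\<Sum>d\<in>{1..Suc m}. mangoldt d * real (m div d)) + (\<Sum>d\<in>{1..Suc m} \<inter> {d. d dvd Suc m}. mangoldt d)"
    by (simp add: sum.distrib sum.inter_restrict)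
  also have "{1..Suc m} \<inter> {d. d dvd Suc m} = {d. d dvd Suc m}"
  proof -
    have "1 \<le> x \<and> x \<le> Suc m" if "x dvd Suc m" for x
      using that dvd_imp_le[OF that] dvd_pos_nat[OF _ that] by (simp add: Suc_le_eq)
    then show ?thesis by auto
  qed
  also have "(\<Sum>d | d dvd Suc m. mangoldt d) = ln (real (Suc m))"
    using mangoldt_sum[of "Suc m", where ?'a = real] by simp
  also have "(\<Sum>d\<in>{1..Suc m}. mangoldt d * real (m div d)) = (\<Sum>d\<in>{1..m}. mangoldt d * real (m div d))"
    by (simp add: atLeastAtMostSuc_conv)
  also have "\<dots> = ln (fact m)" using Suc by simp
  also have "ln (fact m) + ln (real (Suc m)) = ln (fact (Suc m))"
    using ln_mult_pos[of "fact m" "real (Suc m)"] by (simp only: fact_Suc mult.commute[of "fact m"]) simp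
  finally show ?case by simp
qed simp

text \<open>Chebyshev's argument: in the logarithm of \<open>(2 n)! / (n!)\<^sup>2\<close> the term
  \<open>mangoldt d\<close> has the weight \<open>2 n div d - 2 (n div d)\<close>, which is at most
  1.\<close>

lemma ln_central_binomial_le: "ln (real ((2 * n) choose n)) \<le> (\<Sum>d\<in>{1..2*n}. mangoldt d)"
proof -
  have "real ((2 * n) choose n) = fact (2 * n) / (fact n * fact n)"
    by (simp add: binomial_fact)
  then have "ln (real ((2 * n) choose n)) = ln (fact (2 * n)) - 2 * ln (fact n)"
    by (simp add: ln_div ln_mult)
  also have "\<dots> = (\<Sum>d\<in>{1..2*n}. mangoldt d * real (2 * n div d)) - 2 * (\<Sum>d\<in>{1..n}. mangoldt d * real (n div d))"
    by (simp only: ln_fact_mangoldt)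
  also have "(\<Sum>d\<in>{1..n}. mangoldt d * real (n div d)) = (\<Sum>d\<in>{1..2*n}. mangoldt d * real (n div d))"
    by (intro sum.mono_neutral_left) auto
  also have "(\<Sum>d\<in>{1..2*n}. mangoldt d * real (2 * n div d)) - 2 * (\<Sum>d\<in>{1..2*n}. mangoldt d * real (n div d)) =
      (\<Sum>d\<in>{1..2*n}. mangoldt d * (real (2 * n div d) - 2 * real (n div d)))"
    by (simp add: sum_distrib_left sum_subtractf algebra_simps)
  also have "\<dots> \<le> (\<Sum>d\<in>{1..2*n}. mangoldt d * 1)"
  proof (intro sum_mono mult_left_mono mangoldt_nonneg)
    fix d assume "d \<in> {1..2*n}"
    then have d: "d > 0" by simp
    have "n mod d < d" using d by simp
    have "n = d * (n div d) + n mod d" by simp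
    moreover have "d * (2 * (n div d) + 2) = 2 * (d * (n div d)) + 2 * d" by (simp add: algebra_simps)
    ultimately have "2 * n < d * (2 * (n div d) + 2)" using \<open>n mod d < d\<close> by linarith
    then have "2 * n div d < 2 * (n div d) + 2" using d by (simp add: div_less_iff_less_mult mult.commute)
    then show "real (2 * n div d) - 2 * real (n div d) \<le> 1" by linarith
  qed
  finally show ?thesis by simp
qed

text \<open>Only prime powers contribute. If all primes up to \<open>m\<close> are at most
  \<open>N\<close>, such a power has a base in \<open>{1..N}\<close> and an exponent in
  \<open>{1..K}\<close>, because \<open>2 ^ e \<le> p ^ e < 2 ^ K\<close>, and it contributes at
  most \<open>ln N\<close>.\<close>

lemma sum_mangoldt_le:
  assumes "\<And>p. prime p \<Longrightarrow> p \<le> m \<Longrightarrow> p \<le> N" "m < 2 ^ K" "1 \<le> N"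
  shows "(\<Sum>d\<in>{1..m}. mangoldt d) \<le> real N * real K * ln (real N)"
proof -
  let ?S = "{d \<in> {1..m}. primepow d}"
  have sub: "?S \<subseteq> (\<lambda>(p, e). p ^ e) ` ({1..N} \<times> {1..K})"
  proof
    fix d assume d: "d \<in> ?S"
    then obtain p e where pe: "prime p" "e > 0" "d = p ^ e" by (auto simp: primepow_def)
    have "p ^ 1 \<le> p ^ e" using pe prime_gt_0_nat by (intro power_increasing) (auto simp: Suc_le_eq)
    then have "p \<le> N" using assms(1)[OF pe(1)] d pe by auto
    have "(2::nat) ^ e \<le> p ^ e" using prime_ge_2_nat[OF pe(1)] by (intro power_mono) auto
    moreover have "p ^ e \<le> m" using d pe(3) by simp
    ultimately have "(2::nat) ^ e < 2 ^ K" using assms(2) by linarith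
    then have "e < K" by (rule power_less_imp_less_exp[rotated]) simp
    with \<open>p \<le> N\<close> pe prime_gt_0_nat[OF pe(1)] show "d \<in> (\<lambda>(p, e). p ^ e) ` ({1..N} \<times> {1..K})"
      by (intro image_eqI[of _ _ "(p, e)"]) (auto simp: Suc_le_eq)
  qed
  have "card ?S \<le> card ((\<lambda>(p, e). p ^ e) ` ({1..N} \<times> {1..K}))" by (intro card_mono sub) auto
  also have "\<dots> \<le> N * K" by (rule order.trans[OF card_image_le]) auto
  finally have card: "card ?S \<le> N * K" .
  have "(\<Sum>d\<in>{1..m}. mangoldt d) = (\<Sum>d\<in>?S. mangoldt d :: real)"
    by (intro sum.mono_neutral_right) (auto simp: mangoldt_def)
  also have "\<dots> \<le> (\<Sum>d\<in>?S. ln (real N))"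
  proof (rule sum_mono)
    fix d assume "d \<in> ?S"
    then obtain p e where pe: "prime p" "e > 0" "d = p ^ e" "d \<le> m" by (auto simp: primepow_def)
    have "p ^ 1 \<le> p ^ e" using pe prime_gt_0_nat by (intro power_increasing) (auto simp: Suc_le_eq)
    then have "p \<le> N" using assms(1)[OF pe(1)] pe by auto
    then show "mangoldt d \<le> ln (real N)" using pe prime_gt_0_nat[OF pe(1)] by simp
  qed
  also have "\<dots> = real (card ?S) * ln (real N)" by simp
  also have "\<dots> \<le> real (N * K) * ln (real N)" using card assms(3) by (intro mult_right_mono) (simp_all only: of_nat_le_iff, simp)
  finally show ?thesis by simp
qed

lemma two_power_gt: "x \<ge> 10 \<Longrightarrow> 8 * (x + 1) ^ 2 < (2::nat) ^ x"
proof (induction x rule: dec_induct)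
  case (step x)
  have "8 * (Suc x + 1) ^ 2 \<le> 2 * (8 * (x + 1) ^ 2)"
  proof -
    have "2 \<le> x * x" using step mult_le_mono[of 10 x 10 x] by simp
    then show ?thesis unfolding power2_eq_square by (simp add: algebra_simps)
  qed
  with step show ?case by simp
qed simp

text \<open>Without such a prime, put \<open>N = 2 ^ y\<close>: the lower bound
  \<open>4 ^ (N ^ 2) / (2 N ^ 2)\<close> for the central binomial coefficient and the upper bound
  \<open>N (2 y + 2) ln N\<close> for the Mangoldt sum would make \<open>N ^ 2\<close> at most of
  order \<open>N y ^ 2\<close>. The interval is much longer than in Bertrand's postulate, but a
  prime polynomial in \<open>R\<close> is enough here.\<close>

lemma exists_prime_between:
  assumes "y \<ge> 10"
  shows "\<exists>p::nat. prime p \<and> 2 ^ y < p \<and> p \<le> 2 ^ (2 * y + 1)"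
proof (rule ccontr)
  assume no: "\<not> ?thesis"
  let ?N = "(2::nat) ^ y" let ?n = "?N ^ 2"
  have m: "2 * ?n = 2 ^ (2 * y + 1)" by (simp add: power_mult power_mult_distrib mult.commute flip: power_mult)
  have "(4::real) ^ ?n / (2 * ?n) \<le> ((2 * ?n) choose ?n)"
    using central_binomial_lower_bound[of ?n] by simp
  then have "ln ((4::real) ^ ?n / (2 * ?n)) \<le> ln (real ((2 * ?n) choose ?n))"
    by (intro iffD2[OF ln_le_cancel_iff]) auto
  also have "\<dots> \<le> (\<Sum>d\<in>{1..2 * ?n}. mangoldt d)" by (rule ln_central_binomial_le)
  also have "\<dots> \<le> real ?N * real (2 * y + 2) * ln (real ?N)"
  proof (rule sum_mangoldt_le)
    show "p \<le> ?N" if "prime p" "p \<le> 2 * ?n" for p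
      using no that unfolding m by (meson not_le)
    show "2 * ?n < 2 ^ (2 * y + 2)" unfolding m by (rule power_strict_increasing) simp_all
  qed simp
  also have "ln (real ?N) \<le> y" using ln_2_less_1 by (simp add: ln_realpow mult_left_le)
  also have "ln ((4::real) ^ ?n / (2 * ?n)) = ?n * ln 4 - (2 * y + 1) * ln 2"
    by (subst ln_div) (simp_all add: ln_realpow ln_mult algebra_simps flip: power_mult)
  also have "ln (4::real) = 2 * ln 2" using ln_realpow[of 2 2] by simp
  finally have A: "real ?n * (2 * ln 2) - (2 * y + 1) * ln 2 \<le> real ?N * real (2 * y + 2) * y"
    by (simp add: mult_left_mono)
  have l2: "1/2 \<le> ln (2::real)" "ln (2::real) \<le> 1" using ln2_ge_two_thirds ln_2_less_1 by simp_all
  have "real ?n * 1 \<le> real ?n * (2 * ln 2)" using l2 by (intro mult_left_mono) auto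
  moreover have "real (2 * y + 1) * ln 2 \<le> real (2 * y + 1) * 1" using l2 by (intro mult_left_mono) auto
  moreover have "a \<le> z + e" if "a * 1 \<le> b" "c \<le> e * 1" "b - c \<le> z" for a b c e z :: real
    using that by simp
  ultimately have "real ?n \<le> real ?N * real (2 * y + 2) * y + real (2 * y + 1)" using A by blast
  then have "real ?n \<le> real (?N * (2 * y + 2) * y + (2 * y + 1))" by (simp only: of_nat_add of_nat_mult)
  then have B: "?n \<le> ?N * (2 * y + 2) * y + (2 * y + 1)" by (simp only: of_nat_le_iff)
  also have "\<dots> \<le> ?N * (2 * y + 2) * y + ?N * (2 * y + 1)"
    by (intro add_left_mono) (metis mult_le_mono1 mult_1 one_le_numeral one_le_power)
  also have "\<dots> = ?N * ((2 * y + 2) * y + (2 * y + 1))" by (simp only: algebra_simps)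
  also have "(2 * y + 2) * y + (2 * y + 1) \<le> 8 * (y + 1) ^ 2" by (simp add: power2_eq_square algebra_simps)
  also have "8 * (y + 1) ^ 2 < ?N" by (rule two_power_gt[OF assms])
  finally show False by (simp add: power2_eq_square)
qed

section \<open>Sparse recovery from power sums\<close>

text \<open>The polynomial \<open>f\<close> with roots \<open>I - {i0}\<close> has degree below
  \<open>T\<close>, so combining the power sums with its coefficients gives 0 modulo
  \<open>p\<close>, while only \<open>v i0 * f i0\<close> survives in that combination. The factor
  \<open>f i0\<close> is a product of differences of distinct numbers below \<open>p\<close>, hence
  not divisible by \<open>p\<close>.\<close>

lemma power_sums_sparse_zero:
  fixes v :: "nat \<Rightarrow> int"
  assumes "finite I" "card I \<le> T" "prime p" "\<And>i. i \<in> I \<Longrightarrow> i < p"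
    and "\<And>r. r < T \<Longrightarrow> [(\<Sum>i\<in>I. v i * int i ^ r) = 0] (mod int p)"
    and "i0 \<in> I"
  shows "[v i0 = 0] (mod int p)"
proof -
  define f where "f = (\<Prod>i\<in>I - {i0}. [:- int i, 1:])"
  have "Polynomial.degree f = (\<Sum>i\<in>I - {i0}. Polynomial.degree [:- int i, 1:])"
    unfolding f_def by (rule degree_prod_eq_sum_degree) auto
  also have "\<dots> = card I - 1" using assms by simp
  finally have "Polynomial.degree f = card I - 1" .
  moreover have "0 < card I" using assms(1,6) card_gt_0_iff by blast
  ultimately have deg: "Polynomial.degree f < T" using assms(2) by linarith
  have "poly f (int i) = (\<Sum>r<T. Polynomial.coeff f r * int i ^ r)" for i
  proof -
    have "(\<Sum>r<T. Polynomial.coeff f r * int i ^ r) = (\<Sum>r\<le>Polynomial.degree f. Polynomial.coeff f r * int i ^ r)"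
      using deg by (intro sum.mono_neutral_right) (auto simp: coeff_eq_0 not_le)
    then show ?thesis by (simp add: poly_altdef)
  qed
  then have "(\<Sum>i\<in>I. v i * poly f (int i)) = (\<Sum>i\<in>I. \<Sum>r<T. Polynomial.coeff f r * (v i * int i ^ r))"
    by (simp add: sum_distrib_left algebra_simps)
  also have "\<dots> = (\<Sum>r<T. Polynomial.coeff f r * (\<Sum>i\<in>I. v i * int i ^ r))"
    by (subst sum.swap) (simp add: sum_distrib_left)
  also have "[\<dots> = (\<Sum>r<T. Polynomial.coeff f r * 0)] (mod int p)"
    by (intro cong_sum cong_mult cong_refl assms(5)) auto
  also have "(\<Sum>i\<in>I. v i * poly f (int i)) = v i0 * poly f (int i0)"
  proof -
    have "(\<Sum>i\<in>I. v i * poly f (int i)) = (\<Sum>i\<in>{i0}. v i * poly f (int i))"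
    proof (rule sum.mono_neutral_right)
      show "\<forall>i\<in>I - {i0}. v i * poly f (int i) = 0"
        using assms(1) by (auto simp: f_def poly_prod prod_zero_iff)
    qed (use assms in auto)
    then show ?thesis by simp
  qed
  finally have "int p dvd v i0 * poly f (int i0)" by (simp add: cong_0_iff)
  moreover have "\<not> int p dvd poly f (int i0)"
  proof
    assume "int p dvd poly f (int i0)"
    then have "int p dvd (\<Prod>i\<in>I - {i0}. int i0 - int i)" by (simp add: f_def poly_prod)
    then obtain i where i: "i \<in> I" "i \<noteq> i0" "int p dvd int i0 - int i"
      using assms(1,3) by (auto simp: prime_dvd_prod_iff)
    have "\<bar>int i0 - int i\<bar> < int p" using assms(4)[OF i(1)] assms(4)[OF assms(6)] by auto
    moreover have "int p \<le> \<bar>int i0 - int i\<bar>" using i by (intro zdvd_imp_le) auto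
    ultimately show False by simp
  qed
  ultimately show ?thesis using assms(3) by (simp add: cong_0_iff prime_dvd_mult_iff)
qed

section \<open>Integer approximation of the logarithm\<close>

text \<open>\<open>Q\<close> times the Riemann sum of \<open>1 / x\<close> over
  \<open>[1, 1 + y]\<close> with mesh \<open>1 / R\<close>, each term rounded down: a logarithm that
  needs only integer division.\<close>

definition log_int :: "nat \<Rightarrow> nat \<Rightarrow> nat \<Rightarrow> nat" where
  "log_int R Q y = (\<Sum>u<R * y. Q div (R + u))"

text \<open>A left Riemann sum of a decreasing function exceeds the integral by at most the
  telescoping sum of the drops. The term \<open>1 / (R + real m)\<close> is kept because the
  induction needs it.\<close>

lemma harmonic_segment_bounds:
  assumes "R > 0"
  shows "ln ((R + real m) / R) \<le> (\<Sum>u<m. 1 / (R + real u)) \<and>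
    (\<Sum>u<m. 1 / (R + real u)) \<le> ln ((R + real m) / R) + 1 / R - 1 / (R + real m)"
proof (induction m)
  case (Suc m)
  let ?x = "R + real m"
  have x: "?x > 0" using assms by simp
  have "ln ((R + real (Suc m)) / R) = ln (?x / R) + ln (1 + 1 / ?x)"
  proof -
    have "1 + 1 / ?x > 0" "?x / R > 0" "(R + real (Suc m)) / R = ?x / R * (1 + 1 / ?x)"
    proof -
      have "?x / R * (1 / ?x) = 1 / R" using x by simp
      then show "(R + real (Suc m)) / R = ?x / R * (1 + 1 / ?x)"
        by (simp only: distrib_left) (simp add: add_divide_distrib)
    qed (use assms x in \<open>simp_all add: add_pos_pos\<close>)
    then show ?thesis by (metis ln_mult_pos)
  qed
  moreover have "ln (1 + 1 / ?x) \<le> 1 / ?x" using x by (intro ln_add_one_self_le_self) auto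
  moreover have "1 / (?x + 1) \<le> ln (1 + 1 / ?x)"
  proof -
    have "- ln (1 + 1 / ?x) = ln (?x / (?x + 1))" using x by (simp add: ln_div field_simps)
    also have "\<dots> \<le> ?x / (?x + 1) - 1" using x by (intro ln_le_minus_one) auto
    also have "\<dots> = - (1 / (?x + 1))" using x by (simp add: field_simps)
    finally show ?thesis by simp
  qed
  ultimately show ?case using Suc by (simp add: algebra_simps)
qed (use assms in simp)

text \<open>The two terms have different origins: the Riemann sum overshoots by at most
  \<open>Q / R\<close>, and rounding down loses at most 1 in each of \<open>R * y\<close>
  terms.\<close>

lemma log_int_error:
  assumes "R > 0"
  shows "\<bar>real (log_int R Q y) - real Q * ln (1 + real y)\<bar> \<le> real Q / real R + real R * real y"
proof -
  let ?H = "\<Sum>u<R * y. 1 / (real R + real u)"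
  have q: "(real R + real (R * y)) / real R = 1 + real y" using assms by (simp add: field_simps)
  have H: "ln (1 + real y) \<le> ?H" "?H \<le> ln (1 + real y) + 1 / R"
    using harmonic_segment_bounds[of "real R" "R * y"] assms unfolding q
    by (auto intro: order_trans)
  have d: "real (Q div (R + u)) \<le> real Q * (1 / (real R + real u)) \<and>
     real Q * (1 / (real R + real u)) - 1 \<le> real (Q div (R + u))" for u
  proof -
    have "Q < (Q div (R + u) + 1) * (R + u)" using assms
      by (metis add.commute add_gr_0 dividend_less_div_times plus_1_eq_Suc mult_Suc)
    then have "real Q < real ((Q div (R + u) + 1) * (R + u))" by (simp only: of_nat_less_iff)
    then have "real Q / (real R + real u) < real (Q div (R + u)) + 1" using assms
      by (subst pos_divide_less_eq) (auto simp: algebra_simps)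
    then show ?thesis using of_nat_div_le_of_nat[of Q "R + u", where ?'a = real] by simp
  qed
  have up: "real (log_int R Q y) \<le> real Q * ?H"
    unfolding log_int_def of_nat_sum sum_distrib_left by (intro sum_mono) (use d in blast)
  have "real Q * ?H - real (R * y) = (\<Sum>u<R * y. real Q * (1 / (real R + real u)) - 1)"
    by (simp add: sum_distrib_left sum_subtractf)
  also have "\<dots> \<le> real (log_int R Q y)"
    unfolding log_int_def of_nat_sum by (intro sum_mono) (use d in blast)
  finally have lo: "real Q * ?H - real R * real y \<le> real (log_int R Q y)" by simp
  have "real Q * ln (1 + real y) \<le> real Q * ?H" "real Q * ?H \<le> real Q * (ln (1 + real y) + 1 / R)"
    using H by (intro mult_left_mono; simp)+
  moreover have "0 \<le> real Q / real R" "0 \<le> real R * real y" by simp_all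
  ultimately show ?thesis using up lo by (simp add: distrib_left abs_le_iff)
qed

lemma log_int_0 [simp]: "log_int R Q 0 = 0" by (simp add: log_int_def)

lemma ln_nat_ge_half: "(y::nat) \<ge> 1 \<Longrightarrow> 1 / 2 \<le> ln (1 + real y)"
proof -
  assume "y \<ge> 1"
  then have "ln 2 \<le> ln (1 + real y)" by (subst ln_le_cancel_iff) auto
  then show ?thesis using ln2_ge_two_thirds by linarith
qed

text \<open>The condition on \<open>Q\<close> makes both errors at most \<open>Q / R\<close>, and
  \<open>ln (1 + y) \<ge> 1 / 2\<close> for nonzero \<open>y\<close> turns \<open>2 Q / R\<close>
  into a relative error of \<open>4 / R\<close>. A relative error is wanted because it is charged to
  the norm of \<open>M\<close>.\<close>

lemma log_int_rel_error:
  assumes "R > 0" "R ^ 2 * y \<le> Q"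
  shows "\<bar>real (log_int R Q y) - real Q * ln (1 + real y)\<bar> \<le> 4 / R * (real Q * ln (1 + real y))"
proof (cases "y = 0")
  case False
  then have y: "1 / 2 \<le> ln (1 + real y)" by (intro ln_nat_ge_half) simp
  have "real (R ^ 2 * y) \<le> real Q" using assms(2) by (simp only: of_nat_le_iff)
  then have "real R * real y \<le> real Q / real R" using assms(1) by (simp add: field_simps power2_eq_square)
  with log_int_error[OF assms(1), of Q y]
  have "\<bar>real (log_int R Q y) - real Q * ln (1 + real y)\<bar> \<le> 4 / R * (real Q * (1 / 2))" by simp
  also have "\<dots> \<le> 4 / R * (real Q * ln (1 + real y))" using y assms by (intro mult_left_mono) auto
  finally show ?thesis .
qed simp

section \<open>The error of the recovered columns\<close>

text \<open>A column with at most \<open>t\<close> nonzero entries is recovered exactly, and only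
  the relative error \<theta> of the logarithm remains. Otherwise nothing is known of
  \<open>y\<close> beyond its support and size; but then the sum \<open>S\<close> of the logarithms
  is at least \<open>t / 2\<close>, so the factor \<open>2 S / t\<close> is at least 1 and may be
  multiplied in until each term has the form \<open>S\<^sup>2 / t\<close>.\<close>

lemma column_error:
  fixes x :: "nat \<Rightarrow> int" and y :: "nat \<Rightarrow> nat" and g :: "nat \<Rightarrow> real"
  defines "M \<equiv> \<lambda>i. ln (1 + \<bar>real_of_int (x i)\<bar>)"
  assumes t: "t \<ge> 1" and B: "1 \<le> B" and \<theta>: "0 \<le> \<theta>" "\<theta> \<le> 1"
    and sparse: "card {i. i < n \<and> x i \<noteq> 0} \<le> t \<Longrightarrow> \<forall>i<n. int (y i) = \<bar>x i\<bar>"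
    and supp: "card {i. i < n \<and> y i \<noteq> 0} \<le> t"
    and Bx: "\<And>i. i < n \<Longrightarrow> M i \<le> B" and By: "\<And>i. i < n \<Longrightarrow> ln (1 + real (y i)) \<le> B"
    and g: "\<And>i. i < n \<Longrightarrow> \<bar>g i - ln (1 + real (y i))\<bar> \<le> \<theta> * ln (1 + real (y i))"
  shows "(\<Sum>i<n. (g i - M i)\<^sup>2) \<le> \<theta>\<^sup>2 * (\<Sum>i<n. (M i)\<^sup>2) + 36 * B\<^sup>2 / real t * (\<Sum>i<n. \<bar>M i\<bar>)\<^sup>2"
proof (cases "card {i. i < n \<and> x i \<noteq> 0} \<le> t")
  case True
  have "(g i - M i)\<^sup>2 \<le> \<theta>\<^sup>2 * (M i)\<^sup>2" if "i < n" for i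
  proof -
    have "int (y i) = \<bar>x i\<bar>" using sparse[OF True] that by simp
    then have "real_of_int (int (y i)) = real_of_int \<bar>x i\<bar>" by (rule arg_cong)
    then have "\<bar>g i - M i\<bar> \<le> \<theta> * M i" using g[OF that] by (simp add: M_def)
    then have "\<bar>g i - M i\<bar>\<^sup>2 \<le> (\<theta> * M i)\<^sup>2" by (intro power_mono) auto
    then show ?thesis by (simp add: power_mult_distrib)
  qed
  then have "(\<Sum>i<n. (g i - M i)\<^sup>2) \<le> \<theta>\<^sup>2 * (\<Sum>i<n. (M i)\<^sup>2)"
    unfolding sum_distrib_left by (intro sum_mono) auto
  moreover have "0 \<le> 36 * B\<^sup>2 / real t * (\<Sum>i<n. \<bar>M i\<bar>)\<^sup>2" by simp
  ultimately show ?thesis by linarith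
next
  case False
  let ?S = "\<Sum>i<n. M i" let ?m = "\<lambda>i. ln (1 + real (y i))"
  have M0: "0 \<le> M i" for i by (simp add: M_def)
  have S0: "0 \<le> ?S" using M0 by (simp add: sum_nonneg)
  have "real t / 2 \<le> ?S"
  proof -
    have "real t / 2 \<le> (\<Sum>i\<in>{i. i < n \<and> x i \<noteq> 0}. 1 / 2)" using False by simp
    also have "\<dots> \<le> (\<Sum>i\<in>{i. i < n \<and> x i \<noteq> 0}. M i)"
    proof (rule sum_mono)
      fix i assume "i \<in> {i. i < n \<and> x i \<noteq> 0}"
      then have "nat \<bar>x i\<bar> \<ge> 1" by auto
      from ln_nat_ge_half[OF this] show "1 / 2 \<le> M i" by (simp add: M_def)
    qed
    also have "\<dots> \<le> ?S" using M0 by (intro sum_mono2) auto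
    finally show ?thesis .
  qed
  then have T: "1 \<le> 2 * ?S / real t" using t by (simp add: field_simps)
  have "(g i - M i)\<^sup>2 \<le> (if y i \<noteq> 0 then 8 * B\<^sup>2 else 0) + 2 * B * M i" if "i < n" for i
  proof -
    have m: "0 \<le> ?m i" "?m i \<le> B" using By[OF that] by auto
    have "\<theta> * ?m i \<le> 1 * ?m i" by (rule mult_right_mono) (use \<theta> m in auto)
    then have "\<bar>g i\<bar> \<le> 2 * ?m i" using g[OF that] by linarith
    then have "\<bar>g i\<bar> \<le> (if y i \<noteq> 0 then 2 * B else 0)" using m by auto
    then have "\<bar>g i\<bar>\<^sup>2 \<le> (if y i \<noteq> 0 then 2 * B else 0)\<^sup>2" by (rule power_mono) auto
    then have "(g i)\<^sup>2 \<le> (if y i \<noteq> 0 then 4 * B\<^sup>2 else 0)" by (simp add: power_mult_distrib split: if_splits)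
    moreover have "(M i)\<^sup>2 \<le> B * M i" using Bx[OF that] M0 by (simp add: power2_eq_square mult_right_mono)
    moreover have "(g i - M i)\<^sup>2 \<le> 2 * (g i)\<^sup>2 + 2 * (M i)\<^sup>2"
      using zero_le_power2[of "g i + M i"] by (simp add: power2_eq_square algebra_simps)
    moreover have "0 \<le> B * M i" using M0 B by simp
    ultimately show ?thesis by (auto split: if_splits)
  qed
  then have "(\<Sum>i<n. (g i - M i)\<^sup>2) \<le> (\<Sum>i<n. (if y i \<noteq> 0 then 8 * B\<^sup>2 else 0) + 2 * B * M i)"
    by (intro sum_mono) auto
  also have "\<dots> = 8 * B\<^sup>2 * real (card {i. i < n \<and> y i \<noteq> 0}) + 2 * B * ?S"
  proof -
    have "{..<n} \<inter> {i. y i \<noteq> 0} = {i. i < n \<and> y i \<noteq> 0}" by auto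
    then show ?thesis by (simp add: sum.distrib sum_distrib_left sum.If_cases)
  qed
  also have "\<dots> \<le> 8 * B\<^sup>2 * real t + 2 * B * ?S" using supp by (simp add: mult_left_mono)
  \<comment> \<open>Origin of 36: \<open>8 B\<^sup>2 t\<close> times
    \<open>(2 S / t)\<^sup>2\<close> contributes 32, and \<open>2 B\<^sup>2 S\<close> times
    \<open>2 S / t\<close> contributes 4.\<close>
  also have "8 * B\<^sup>2 * real t \<le> 8 * B\<^sup>2 * real t * (2 * ?S / real t)\<^sup>2"
    using mult_left_mono[OF one_le_power[OF T, of 2], of "8 * B\<^sup>2 * real t"] by simp
  also have "2 * B * ?S \<le> 2 * B * ?S * (2 * ?S / real t)"
    using mult_left_mono[OF T, of "2 * B * ?S"] S0 B by simp
  also have "2 * B * ?S * (2 * ?S / real t) \<le> 2 * B\<^sup>2 * ?S * (2 * ?S / real t)"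
    using B S0 t by (intro mult_right_mono) (auto simp: power2_eq_square)
  also have "8 * B\<^sup>2 * real t * (2 * ?S / real t)\<^sup>2 + 2 * B\<^sup>2 * ?S * (2 * ?S / real t) = 36 * B\<^sup>2 / real t * ?S\<^sup>2"
    using t by (simp add: power2_eq_square field_simps)
  also have "?S = (\<Sum>i<n. \<bar>M i\<bar>)" using M0 by simp
  also have "36 * B\<^sup>2 / real t * (\<Sum>i<n. \<bar>M i\<bar>)\<^sup>2 \<le>
    \<theta>\<^sup>2 * (\<Sum>i<n. (M i)\<^sup>2) + 36 * B\<^sup>2 / real t * (\<Sum>i<n. \<bar>M i\<bar>)\<^sup>2" by (simp add: sum_nonneg)
  finally show ?thesis by simp
qed

section \<open>Approximate projections\<close>

text \<open>Functions on index pairs in place of carrier matrices spare the dimension conditions;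
  the norms of the theorem are translated only after the error bound is proved.\<close>

definition frob :: "nat \<Rightarrow> nat \<Rightarrow> (nat \<Rightarrow> nat \<Rightarrow> real) \<Rightarrow> real" where
  "frob n m F = L2_set (\<lambda>p. F (fst p) (snd p)) ({..<n} \<times> {..<m})"

definition defect :: "nat \<Rightarrow> nat \<Rightarrow> (nat \<Rightarrow> nat \<Rightarrow> real) \<Rightarrow> (nat \<Rightarrow> nat \<Rightarrow> real) \<Rightarrow> nat \<Rightarrow> nat \<Rightarrow> real" where
  "defect n k L Y i j = (\<Sum>a<k. L i a * (\<Sum>b<n. L b a * Y b j)) - Y i j"

lemma frob_sq: "(frob n m F)\<^sup>2 = (\<Sum>j<m. \<Sum>i<n. (F i j)\<^sup>2)"
proof -
  have "(frob n m F)\<^sup>2 = (\<Sum>(i, j)\<in>{..<n} \<times> {..<m}. (F i j)\<^sup>2)"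
    unfolding frob_def L2_set_def by (simp add: sum_nonneg case_prod_beta)
  also have "\<dots> = (\<Sum>i<n. \<Sum>j<m. (F i j)\<^sup>2)" by (simp add: sum.cartesian_product)
  finally show ?thesis by (subst sum.swap) simp
qed

lemma frob_nonneg [simp]: "0 \<le> frob n m F" by (simp add: frob_def)

lemma frob_cong: "(\<And>i j. i < n \<Longrightarrow> j < m \<Longrightarrow> F i j = G i j) \<Longrightarrow> frob n m F = frob n m G"
  unfolding frob_def by (rule L2_set_cong) auto

lemma frob_add: "frob n m (\<lambda>i j. F i j + G i j) \<le> frob n m F + frob n m G"
  unfolding frob_def by (rule L2_set_triangle_ineq)

lemma frob_mult: "frob n m (\<lambda>i j. c * F i j) = \<bar>c\<bar> * frob n m F"
  by (rule power2_eq_imp_eq) (auto simp: frob_sq power_mult_distrib sum_distrib_left)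

lemma frob_le_const:
  assumes "\<And>i j. i < n \<Longrightarrow> j < m \<Longrightarrow> \<bar>F i j\<bar> \<le> c" "0 \<le> c" "m \<le> n"
  shows "frob n m F \<le> real n * c"
proof (rule power2_le_imp_le)
  have "(\<Sum>j<m. \<Sum>i<n. (F i j)\<^sup>2) \<le> (\<Sum>j<m. \<Sum>i<n. c\<^sup>2)"
    using assms by (intro sum_mono) (auto intro!: abs_le_square_iff[THEN iffD1])
  also have "\<dots> = real m * real n * c\<^sup>2" by simp
  also have "\<dots> \<le> real n * real n * c\<^sup>2" using assms by (intro mult_right_mono) auto
  finally show "(frob n m F)\<^sup>2 \<le> (real n * c)\<^sup>2"
    unfolding frob_sq power_mult_distrib by (simp add: power2_eq_square[of "real n"])
qed (use assms in simp)

lemma frob_matmul: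
  "frob n m (\<lambda>i j. \<Sum>b<l. E i b * Y b j) \<le> frob n l E * frob l m Y"
proof (rule power2_le_imp_le)
  have "(\<Sum>b<l. E i b * Y b j)\<^sup>2 \<le> (\<Sum>b<l. (E i b)\<^sup>2) * (\<Sum>b<l. (Y b j)\<^sup>2)" for i j
    by (rule Cauchy_Schwarz_ineq_sum)
  then have "(frob n m (\<lambda>i j. \<Sum>b<l. E i b * Y b j))\<^sup>2 \<le> (\<Sum>j<m. \<Sum>i<n. (\<Sum>b<l. (E i b)\<^sup>2) * (\<Sum>b<l. (Y b j)\<^sup>2))"
    unfolding frob_sq by (intro sum_mono) auto
  also have "\<dots> = (\<Sum>i<n. \<Sum>b<l. (E i b)\<^sup>2) * (\<Sum>j<m. \<Sum>b<l. (Y b j)\<^sup>2)"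
    by (subst sum.swap) (simp add: sum_product)
  also have "\<dots> = (frob n l E * frob l m Y)\<^sup>2" by (simp add: frob_sq power_mult_distrib sum.swap[of _ "{..<n}"])
  finally show "(frob n m (\<lambda>i j. \<Sum>b<l. E i b * Y b j))\<^sup>2 \<le> (frob n l E * frob l m Y)\<^sup>2" .
qed simp

lemma defect_add: "defect n k L (\<lambda>i j. Y i j + Z i j) i j = defect n k L Y i j + defect n k L Z i j"
  by (simp add: defect_def algebra_simps sum.distrib)

lemma defect_mult: "defect n k L (\<lambda>i j. c * Y i j) i j = c * defect n k L Y i j"
  by (simp add: defect_def algebra_simps sum_distrib_left)

text \<open>\<open>defect n k L Y\<close> is \<open>(L L\<^sup>T - I) Y\<close>.  For a column \<open>y\<close> of \<open>Y\<close>, with \<open>z = L\<^sup>T y\<close> and \<open>D = L L\<^sup>T L - L\<close>, one has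
  \<open>|L z - y|\<^sup>2 = |y|\<^sup>2 - |z|\<^sup>2 + (y, D z)\<close>.\<close>

lemma frob_defect_le:
  assumes D: "frob n k (defect n k L L) \<le> 1"
  shows "frob n m (defect n k L Y) \<le> 2 * frob n m Y"
proof (rule power2_le_imp_le)
  have "(\<Sum>i<n. (defect n k L Y i j)\<^sup>2) \<le> 4 * (\<Sum>i<n. (Y i j)\<^sup>2)" for j
  proof -
    define y where "y i = Y i j" for i
    define z where "z a = (\<Sum>b<n. L b a * y b)" for a
    define P where "P i = (\<Sum>a<k. L i a * z a)" for i
    have yP: "(\<Sum>i<n. y i * P i) = (\<Sum>a<k. (z a)\<^sup>2)"
    proof -
      have "(\<Sum>i<n. y i * P i) = (\<Sum>i<n. \<Sum>a<k. y i * (L i a * z a))"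
        by (simp add: P_def sum_distrib_left)
      also have "\<dots> = (\<Sum>a<k. \<Sum>i<n. y i * (L i a * z a))" by (rule sum.swap)
      also have "\<dots> = (\<Sum>a<k. z a * z a)"
        by (intro sum.cong refl) (simp add: z_def sum_distrib_right ac_simps)
      finally show ?thesis by (simp add: power2_eq_square)
    qed
    have LP: "(\<Sum>i<n. L i a * P i) = (\<Sum>a'<k. z a' * (\<Sum>i<n. L i a * L i a'))" for a
      unfolding P_def sum_distrib_left by (subst sum.swap) (simp add: ac_simps)
    have PP: "(\<Sum>i<n. (P i)\<^sup>2) = (\<Sum>i<n. y i * (\<Sum>a<k. L i a * (\<Sum>b<n. L b a * P b)))"
    proof -
      have "(\<Sum>i<n. y i * (\<Sum>a<k. L i a * (\<Sum>b<n. L b a * P b))) = (\<Sum>i<n. \<Sum>a<k. y i * L i a * (\<Sum>b<n. L b a * P b))"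
        by (simp add: sum_distrib_left ac_simps)
      also have "\<dots> = (\<Sum>a<k. \<Sum>i<n. y i * L i a * (\<Sum>b<n. L b a * P b))" by (rule sum.swap)
      also have "\<dots> = (\<Sum>a<k. z a * (\<Sum>b<n. L b a * P b))"
      proof -
        have "(\<Sum>i<n. y i * L i a * W) = z a * W" for a W by (simp add: z_def sum_distrib_right) (simp add: ac_simps)
        then show ?thesis by simp
      qed
      also have "\<dots> = (\<Sum>a<k. \<Sum>b<n. z a * (L b a * P b))" by (simp add: sum_distrib_left)
      also have "\<dots> = (\<Sum>b<n. \<Sum>a<k. z a * (L b a * P b))" by (rule sum.swap)
      also have "\<dots> = (\<Sum>b<n. P b * P b)"
        by (intro sum.cong refl) (simp add: P_def sum_distrib_right ac_simps)
      finally show ?thesis by (simp add: power2_eq_square)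
    qed
    \<comment> \<open>\<open>v\<close> is \<open>D z\<close>; with \<open>P = L z\<close> it is also
      the defect of \<open>L\<close> on \<open>P\<close>.\<close>
    define v where "v i = (\<Sum>a<k. defect n k L L i a * z a)" for i
    have v: "v i = (\<Sum>a<k. L i a * (\<Sum>b<n. L b a * P b)) - P i" for i
    proof -
      have "(\<Sum>a'<k. (\<Sum>a<k. L i a * (\<Sum>b<n. L b a * L b a')) * z a') =
          (\<Sum>a'<k. \<Sum>a<k. L i a * (z a' * (\<Sum>b<n. L b a * L b a')))"
        unfolding sum_distrib_right by (intro sum.cong refl) (simp only: ac_simps)
      also have "\<dots> = (\<Sum>a<k. \<Sum>a'<k. L i a * (z a' * (\<Sum>b<n. L b a * L b a')))" by (rule sum.swap)
      also have "\<dots> = (\<Sum>a<k. L i a * (\<Sum>b<n. L b a * P b))"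
        by (simp add: LP flip: sum_distrib_left)
      finally show ?thesis by (simp add: v_def defect_def left_diff_distrib sum_subtractf P_def)
    qed
    have yv: "(\<Sum>i<n. y i * v i) = (\<Sum>i<n. (P i)\<^sup>2) - (\<Sum>a<k. (z a)\<^sup>2)"
      unfolding PP yP[symmetric] by (simp add: v right_diff_distrib sum_subtractf)
    define ny where "ny = L2_set y {..<n}"
    define nz where "nz = L2_set z {..<k}"
    have n0: "0 \<le> ny" "0 \<le> nz" by (simp_all add: ny_def nz_def)
    have ny2: "ny\<^sup>2 = (\<Sum>i<n. (y i)\<^sup>2)" and nz2: "nz\<^sup>2 = (\<Sum>a<k. (z a)\<^sup>2)"
      by (simp_all add: ny_def nz_def L2_set_def sum_nonneg)
    \<comment> \<open>The Frobenius norm bounds the operator norm, so \<open>D\<close> does not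
      lengthen \<open>z\<close>.\<close>
    have nv: "L2_set v {..<n} \<le> nz"
    proof -
      have "frob n 1 (\<lambda>i j. \<Sum>a<k. defect n k L L i a * z a) \<le> frob n k (defect n k L L) * frob k 1 (\<lambda>a j. z a)"
        by (rule frob_matmul)
      also have "\<dots> \<le> 1 * frob k 1 (\<lambda>a j. z a)" by (intro mult_right_mono D) simp
      finally have "frob n 1 (\<lambda>i j. v i) \<le> frob k 1 (\<lambda>a j. z a)" by (simp add: v_def)
      moreover have "frob l 1 (\<lambda>i j. f i) = L2_set f {..<l}" for l and f :: "nat \<Rightarrow> real"
        by (rule power2_eq_imp_eq) (simp_all add: frob_sq L2_set_def sum_nonneg)
      ultimately show ?thesis by (simp add: nz_def)
    qed
    have "(\<Sum>i<n. y i * v i) \<le> (\<Sum>i<n. \<bar>y i\<bar> * \<bar>v i\<bar>)"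
      by (intro sum_mono) (metis abs_ge_self abs_mult)
    also have "\<dots> \<le> ny * L2_set v {..<n}" unfolding ny_def by (rule L2_set_mult_ineq)
    also have "\<dots> \<le> ny * nz" using nv n0 by (intro mult_left_mono)
    finally have "(\<Sum>i<n. y i * v i) \<le> ny * nz" .
    moreover have "(\<Sum>i<n. (defect n k L Y i j)\<^sup>2) = (\<Sum>i<n. (P i)\<^sup>2 - 2 * (y i * P i) + (y i)\<^sup>2)"
      by (intro sum.cong refl) (simp add: defect_def P_def z_def y_def power2_diff)
    then have "(\<Sum>i<n. (defect n k L Y i j)\<^sup>2) = (\<Sum>i<n. (P i)\<^sup>2) - 2 * nz\<^sup>2 + ny\<^sup>2"
      by (simp add: sum.distrib sum_subtractf yP nz2 ny2 flip: sum_distrib_left)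
    ultimately have "(\<Sum>i<n. (defect n k L Y i j)\<^sup>2) \<le> ny * nz - nz\<^sup>2 + ny\<^sup>2"
      using yv nz2 by simp
    \<comment> \<open>From \<open>2 ny nz \<le> ny\<^sup>2 + nz\<^sup>2\<close> even
      \<open>3 / 2 * ny\<^sup>2\<close> would follow; 4 is taken as a convenient square.\<close>
    also have "\<dots> \<le> 4 * ny\<^sup>2"
    proof -
      have "0 \<le> (ny - nz)\<^sup>2" "0 \<le> ny\<^sup>2" "0 \<le> nz\<^sup>2" by simp_all
      then show ?thesis unfolding power2_diff by linarith
    qed
    finally show ?thesis by (simp add: ny2 y_def)
  qed
  then have "(frob n m (defect n k L Y))\<^sup>2 \<le> (\<Sum>j<m. 4 * (\<Sum>i<n. (Y i j)\<^sup>2))"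
    unfolding frob_sq by (intro sum_mono) auto
  then show "(frob n m (defect n k L Y))\<^sup>2 \<le> (2 * frob n m Y)\<^sup>2"
    by (simp add: frob_sq power_mult_distrib sum_distrib_left)
qed simp

text \<open>The rank may be below \<open>k\<close> while the output always has \<open>k\<close>
  columns. The columns from \<open>r\<close> on are zero, so \<open>Q Q\<^sup>T\<close> is still the
  orthogonal projection onto the span of the others.\<close>

definition ortho :: "nat \<Rightarrow> nat \<Rightarrow> nat \<Rightarrow> (nat \<Rightarrow> nat \<Rightarrow> real) \<Rightarrow> bool" where
  "ortho n k r Q \<longleftrightarrow> r \<le> k \<and> (\<forall>i a. r \<le> a \<longrightarrow> Q i a = 0) \<and>
     (\<forall>a<r. \<forall>b<r. (\<Sum>i<n. Q i a * Q i b) = (if a = b then 1 else 0))"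

lemma ortho_gram: "ortho n k r Q \<Longrightarrow> (\<Sum>i<n. Q i a * Q i b) = (if a = b \<and> a < r then 1 else 0)"
  unfolding ortho_def by (cases "a < r"; cases "b < r") (auto simp: not_less)

lemma ortho_entry_le:
  assumes "ortho n k r Q" "i < n"
  shows "\<bar>Q i a\<bar> \<le> 1"
proof -
  have "(Q i a)\<^sup>2 \<le> (\<Sum>i<n. Q i a * Q i a)"
    using member_le_sum[of i "{..<n}" "\<lambda>i. Q i a * Q i a"] assms(2) by (simp add: power2_eq_square)
  also have "\<dots> \<le> 1" by (simp add: ortho_gram[OF assms(1)])
  finally show ?thesis by (simp add: abs_square_le_1)
qed

lemma ortho_defect_self:
  assumes "ortho n k r Q" "a < k"
  shows "defect n k Q Q i a = 0"
proof -
  have "(\<Sum>b<k. Q i b * (\<Sum>l<n. Q l b * Q l a)) = (\<Sum>b<k. if b = a then Q i b else 0)"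
  proof (intro sum.cong refl)
    fix b
    show "Q i b * (\<Sum>l<n. Q l b * Q l a) = (if b = a then Q i b else 0)"
      using assms(1) unfolding ortho_gram[OF assms(1)] by (auto simp: ortho_def)
  qed
  then show ?thesis using assms(2) by (simp add: defect_def)
qed

text \<open>Pythagoras: the defect of \<open>Q\<close> on \<open>Y\<close> is orthogonal to the
  columns of \<open>Q\<close>, and \<open>Y - B\<close> is its negative plus a combination of these
  columns. So projecting \<open>Y\<close> is at least as good as any \<open>B\<close> with columns
  in their span.\<close>

lemma ortho_defect_le:
  assumes o: "ortho n k r Q" and B: "\<And>i j. i < n \<Longrightarrow> j < m \<Longrightarrow> B i j = (\<Sum>a<k. Q i a * c a j)"
  shows "frob n m (defect n k Q Y) \<le> frob n m (\<lambda>i j. Y i j - B i j)"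
proof (rule power2_le_imp_le)
  have "(\<Sum>i<n. (defect n k Q Y i j)\<^sup>2) \<le> (\<Sum>i<n. (Y i j - B i j)\<^sup>2)" if j: "j < m" for j
  proof -
    define e where "e a = (\<Sum>b<n. Q b a * Y b j) - c a j" for a
    let ?d = "\<lambda>i. defect n k Q Y i j"
    have Qd: "(\<Sum>i<n. Q i a * ?d i) = 0" if "a < k" for a
    proof -
      have "(\<Sum>i<n. Q i a * (\<Sum>b<k. Q i b * (\<Sum>l<n. Q l b * Y l j))) =
          (\<Sum>i<n. \<Sum>b<k. (Q i a * Q i b) * (\<Sum>l<n. Q l b * Y l j))"
        by (simp add: sum_distrib_left ac_simps)
      also have "\<dots> = (\<Sum>b<k. (\<Sum>i<n. Q i a * Q i b) * (\<Sum>l<n. Q l b * Y l j))"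
        by (subst sum.swap) (simp add: sum_distrib_right)
      also have "\<dots> = (\<Sum>b<k. if b = a then (\<Sum>l<n. Q l b * Y l j) else 0)"
      proof (intro sum.cong refl)
        fix b
        have "(\<Sum>l<n. Q l b * Y l j) = 0" if "b \<ge> r" using o that by (simp add: ortho_def)
        then show "(\<Sum>i<n. Q i a * Q i b) * (\<Sum>l<n. Q l b * Y l j) = (if b = a then (\<Sum>l<n. Q l b * Y l j) else 0)"
          unfolding ortho_gram[OF o] by (auto simp: not_less)
      qed
      also have "\<dots> = (\<Sum>l<n. Q l a * Y l j)" using that by simp
      finally show ?thesis by (simp add: defect_def right_diff_distrib sum_subtractf)
    qed
    have YB: "Y i j - B i j = (\<Sum>a<k. Q i a * e a) - ?d i" if "i < n" for i
      using B[OF that j] by (simp add: defect_def e_def right_diff_distrib sum_subtractf)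
    have cross: "(\<Sum>i<n. (\<Sum>a<k. Q i a * e a) * ?d i) = 0"
    proof -
      have "(\<Sum>i<n. (\<Sum>a<k. Q i a * e a) * ?d i) = (\<Sum>a<k. \<Sum>i<n. e a * (Q i a * ?d i))"
        by (simp only: sum_distrib_right, subst sum.swap) (simp add: ac_simps)
      also have "\<dots> = (\<Sum>a<k. e a * (\<Sum>i<n. Q i a * ?d i))" by (simp add: sum_distrib_left)
      also have "\<dots> = 0" using Qd by simp
      finally show ?thesis .
    qed
    have "(\<Sum>i<n. (Y i j - B i j)\<^sup>2) = (\<Sum>i<n. (\<Sum>a<k. Q i a * e a)\<^sup>2 - 2 * ((\<Sum>a<k. Q i a * e a) * ?d i) + (?d i)\<^sup>2)"
      by (intro sum.cong refl) (simp add: YB power2_diff)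
    also have "\<dots> = (\<Sum>i<n. (\<Sum>a<k. Q i a * e a)\<^sup>2) + (\<Sum>i<n. (?d i)\<^sup>2)"
      by (simp add: sum.distrib sum_subtractf cross flip: sum_distrib_left)
    finally show ?thesis by (simp add: sum_nonneg)
  qed
  then show "(frob n m (defect n k Q Y))\<^sup>2 \<le> (frob n m (\<lambda>i j. Y i j - B i j))\<^sup>2"
    unfolding frob_sq by (rule sum_mono) simp
qed simp

text \<open>Changing one factor of each product at a time shows that the entries of
  \<open>L L\<^sup>T - Q Q\<^sup>T\<close> are at most \<open>2 k \<delta>\<close>, hence its
  Frobenius norm is at most \<open>2 k n \<delta>\<close>.\<close>

lemma frob_defect_perturb:
  assumes "\<And>i a. i < n \<Longrightarrow> a < k \<Longrightarrow> \<bar>L i a - Q i a\<bar> \<le> \<delta>" "\<And>i a. i < n \<Longrightarrow> a < k \<Longrightarrow> \<bar>L i a\<bar> \<le> 1"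
    "\<And>i a. i < n \<Longrightarrow> a < k \<Longrightarrow> \<bar>Q i a\<bar> \<le> 1" "0 \<le> \<delta>"
  shows "frob n m (defect n k L Y) \<le> frob n m (defect n k Q Y) + 2 * real k * real n * \<delta> * frob n m Y"
proof -
  define E where "E i b = (\<Sum>a<k. L i a * L b a - Q i a * Q b a)" for i b
  have Eb: "\<bar>E i b\<bar> \<le> real k * (2 * \<delta>)" if "i < n" "b < n" for i b
  proof -
    have "\<bar>E i b\<bar> \<le> (\<Sum>a<k. \<bar>L i a * L b a - Q i a * Q b a\<bar>)" unfolding E_def by (rule sum_abs)
    also have "\<dots> \<le> (\<Sum>a<k. 2 * \<delta>)"
    proof (rule sum_mono)
      fix a assume "a \<in> {..<k}"
      then have a: "a < k" by simp
      have "L i a * L b a - Q i a * Q b a = L i a * (L b a - Q b a) + Q b a * (L i a - Q i a)"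
        by (simp add: algebra_simps)
      also have "\<bar>\<dots>\<bar> \<le> \<bar>L i a\<bar> * \<bar>L b a - Q b a\<bar> + \<bar>Q b a\<bar> * \<bar>L i a - Q i a\<bar>"
        by (metis abs_mult abs_triangle_ineq)
      also have "\<dots> \<le> 1 * \<delta> + 1 * \<delta>" using assms that a by (intro add_mono mult_mono) auto
      finally show "\<bar>L i a * L b a - Q i a * Q b a\<bar> \<le> 2 * \<delta>" by simp
    qed
    finally show ?thesis by simp
  qed
  have "defect n k L Y i j = defect n k Q Y i j + (\<Sum>b<n. E i b * Y b j)" for i j
  proof -
    have *: "(\<Sum>a<k. L i a * (\<Sum>b<n. L b a * Y b j)) = (\<Sum>b<n. (\<Sum>a<k. L i a * L b a) * Y b j)" for L :: "nat \<Rightarrow> nat \<Rightarrow> real"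
      unfolding sum_distrib_left sum_distrib_right by (subst sum.swap) (simp add: ac_simps)
    show ?thesis unfolding defect_def * E_def by (simp add: sum_subtractf left_diff_distrib)
  qed
  then have "frob n m (defect n k L Y) \<le> frob n m (defect n k Q Y) + frob n m (\<lambda>i j. \<Sum>b<n. E i b * Y b j)"
    using frob_add[of n m "defect n k Q Y"] by (metis (no_types, lifting) frob_cong)
  also have "frob n m (\<lambda>i j. \<Sum>b<n. E i b * Y b j) \<le> frob n n E * frob n m Y" by (rule frob_matmul)
  also have "frob n n E \<le> real n * (real k * (2 * \<delta>))" by (rule frob_le_const) (use Eb assms in auto)
  finally show ?thesis by (simp add: mult_right_mono ac_simps)
qed

section \<open>Orthonormal bases of column spaces\<close>

text \<open>A maximal independent set of columns has at most \<open>k\<close> elements by the rank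
  bound and spans all columns by maximality; Gram-Schmidt and normalisation turn it into the first
  \<open>r\<close> columns of \<open>Q\<close>.\<close>

lemma exists_ortho_basis:
  assumes B: "B \<in> carrier_mat n m" and rk: "vec_space.rank n B \<le> k"
  shows "\<exists>r Q c. ortho n k r Q \<and> (\<forall>i<n. \<forall>j<m. (B $$ (i, j) :: real) = (\<Sum>a<k. Q i a * c a j))"
proof -
  interpret cof_vec_space n "TYPE(real)" .
  obtain S where fS: "finite S" and max: "maximal S (\<lambda>T. T \<subseteq> set (cols B) \<and> lin_indpt T)"
    using maximal_exists_superset[of "set (cols B)" "\<lambda>T. T \<subseteq> set (cols B) \<and> lin_indpt T" "{}"]
    by (auto simp: lin_dep_def)
  have S: "S \<subseteq> set (cols B)" "lin_indpt S" using max by (auto simp: maximal_def)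
  have colsB: "set (cols B) \<subseteq> carrier_vec n" using B cols_dim by blast
  have SC: "S \<subseteq> carrier_vec n" using S colsB by blast
  have card: "card S \<le> k" using rank_card_indpt[OF B max] rk by simp
  obtain ws where ws: "set ws = S" "distinct ws" using finite_distinct_list[OF fS] by blast
  define us where "us = gram_schmidt n ws"
  have gs: "span (set ws) = span (set us)" "corthogonal us" "set us \<subseteq> carrier_vec n"
    "length us = length ws" "distinct us"
    using gram_schmidt_result[of ws us] ws S SC us_def by auto
  define r where "r = length us"
  have r: "r \<le> k" using gs(4) ws card distinct_card[OF ws(2)] by (simp add: r_def)
  have us_dim: "us ! a \<in> carrier_vec n" if "a < r" for a using gs(3) that nth_mem[of a us] by (auto simp: r_def)
  have dot: "(us ! a) \<bullet> (us ! b) = (\<Sum>i<n. us ! a $ i * us ! b $ i)" if "a < r" "b < r" for a b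
    using carrier_vecD[OF us_dim[OF that(2)]] by (simp only: scalar_prod_def lessThan_atLeast0)
  define N where "N a = sqrt ((us ! a) \<bullet> (us ! a))" for a
  have orth: "((us ! a) \<bullet> (us ! b) = 0) \<longleftrightarrow> a \<noteq> b" if "a < r" "b < r" for a b
  proof -
    have "conjugate v = v" for v :: "real vec" by (intro eq_vecI) auto
    then show ?thesis using gs(2) that unfolding corthogonal_def r_def by auto
  qed
  have Npos: "N a > 0" and N2: "N a * N a = (us ! a) \<bullet> (us ! a)" if "a < r" for a
  proof -
    have "0 \<le> (us ! a) \<bullet> (us ! a)" unfolding dot[OF that that] by (intro sum_nonneg) auto
    then show "N a > 0" "N a * N a = (us ! a) \<bullet> (us ! a)" using orth[OF that that] by (auto simp: N_def)
  qed
  define Q where "Q i a = (if a < r then us ! a $ i / N a else 0)" for i a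
  have o: "ortho n k r Q" unfolding ortho_def
  proof (intro conjI allI impI r)
    fix a b assume ab: "a < r" "b < r"
    have "(\<Sum>i<n. Q i a * Q i b) = (\<Sum>i<n. us ! a $ i * us ! b $ i) / (N a * N b)"
      using ab by (simp add: Q_def sum_divide_distrib)
    also have "\<dots> = (us ! a) \<bullet> (us ! b) / (N a * N b)" by (simp add: dot ab)
    also have "\<dots> = (if a = b then 1 else 0)" using orth[OF ab] N2[OF ab(1)] Npos[OF ab(1)] by auto
    finally show "(\<Sum>i<n. Q i a * Q i b) = (if a = b then 1 else 0)" .
  qed (simp add: Q_def)
  have "\<exists>c. \<forall>i<n. B $$ (i, j) = (\<Sum>a<k. Q i a * c a)" if j: "j < m" for j
  proof -
    have cj: "col B j \<in> set (cols B)" using j B by (auto simp: cols_def)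
    have "col B j \<in> span S"
    proof (rule ccontr)
      assume n: "col B j \<notin> span S"
      then have "col B j \<notin> S" using in_own_span[OF SC] by blast
      moreover have "lin_indpt (insert (col B j) S)"
        using lin_dep_iff_in_span[OF SC S(2) _ \<open>col B j \<notin> S\<close>] cj colsB n by auto
      ultimately show False using max cj S unfolding maximal_def by blast
    qed
    then have "col B j \<in> span (set us)" using gs(1) ws(1) by simp
    then obtain f where f: "col B j = lincomb f (set us)"
      using in_spanE finite_in_span[OF _ gs(3)] by (metis List.finite_set)
    have "B $$ (i, j) = (\<Sum>a<k. Q i a * (if a < r then f (us ! a) * N a else 0))" if i: "i < n" for i
    proof -
      have "B $$ (i, j) = col B j $ i" using i j B by simp
      also have "\<dots> = (\<Sum>x\<in>set us. f x * x $ i)" unfolding f using lincomb_index[OF i gs(3)] by simp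
      also have "\<dots> = (\<Sum>a<r. f (us ! a) * us ! a $ i)"
        by (rule sum.reindex_bij_betw[symmetric]) (use bij_betw_nth[OF gs(5)] in \<open>auto simp: r_def\<close>)
      also have "\<dots> = (\<Sum>a<r. Q i a * (if a < r then f (us ! a) * N a else 0))"
        using Npos by (intro sum.cong refl) (auto simp: Q_def less_imp_neq[symmetric])
      also have "\<dots> = (\<Sum>a<k. Q i a * (if a < r then f (us ! a) * N a else 0))"
        using r by (intro sum.mono_neutral_left) (auto simp: Q_def)
      finally show ?thesis .
    qed
    then show ?thesis by (intro exI[of _ "\<lambda>a. if a < r then f (us ! a) * N a else 0"] allI impI)
  qed
  then obtain c where "\<forall>j<m. \<forall>i<n. B $$ (i, j) = (\<Sum>a<k. Q i a * c j a)" by metis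
  with o show ?thesis by (intro exI[of _ r] exI[of _ Q] exI[of _ "\<lambda>a j. c j a"]) auto
qed

section \<open>Exhaustive search for the approximate projection\<close>

text \<open>For \<open>l = q L\<close> this is \<open>q\<^sup>2\<close> times the defect of
  \<open>L\<close> on \<open>y\<close>, an integer that the machine can compute.\<close>

definition int_defect :: "nat \<Rightarrow> nat \<Rightarrow> int \<Rightarrow> (nat \<Rightarrow> nat \<Rightarrow> int) \<Rightarrow> (nat \<Rightarrow> nat \<Rightarrow> int) \<Rightarrow> nat \<Rightarrow> nat \<Rightarrow> int" where
  "int_defect n k q l y i j = (\<Sum>a<k. l i a * (\<Sum>b<n. l b a * y b j)) - q * q * y i j"

text \<open>The second summand penalises \<open>L L\<^sup>T L \<noteq> L\<close>, so that a minimiser \<open>L\<close> acts like a projection on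
  matrices other than \<open>g\<close> as well.\<close>

definition proj_cost :: "nat \<Rightarrow> nat \<Rightarrow> int \<Rightarrow> (nat \<Rightarrow> nat \<Rightarrow> int) \<Rightarrow> (nat \<Rightarrow> nat \<Rightarrow> int) \<Rightarrow> int" where
  "proj_cost n k q g l = (\<Sum>i<n. \<Sum>j<n. (int_defect n k q l g i j)\<^sup>2) + (\<Sum>i<n. \<Sum>a<k. (int_defect n k q l l i a)\<^sup>2)"

lemma int_defect_real:
  assumes "q > 0"
  shows "real_of_int (int_defect n k q l y i j) =
    (real_of_int q)\<^sup>2 * defect n k (\<lambda>i a. l i a / q) (\<lambda>i j. y i j) i j"
  using assms by (simp add: int_defect_def defect_def right_diff_distrib power2_eq_square sum_distrib_left)

text \<open>In the penalty \<open>l\<close> itself takes the place of \<open>y\<close> and brings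
  one more factor \<open>q\<close>; this is where the weight \<open>q\<^sup>2\<close> of the penalty
  comes from.\<close>

lemma proj_cost_real:
  fixes q :: int and l g :: "nat \<Rightarrow> nat \<Rightarrow> int"
  assumes "q > 0"
  defines "L \<equiv> \<lambda>i a. real_of_int (l i a) / q"
  shows "real_of_int (proj_cost n k q g l) =
    (real_of_int q)^4 * ((frob n n (defect n k L (\<lambda>i j. g i j)))\<^sup>2 + (q * frob n k (defect n k L L))\<^sup>2)"
proof -
  have qL: "(\<lambda>i j. real_of_int (l i j)) = (\<lambda>i j. real_of_int q * L i j)" using assms by (simp add: L_def)
  have 1: "real_of_int (int_defect n k q l g i j) = (real_of_int q)\<^sup>2 * defect n k L (\<lambda>i j. g i j) i j" for i j
    unfolding L_def by (rule int_defect_real[OF assms(1)])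
  have 2: "real_of_int (int_defect n k q l l i j) = (real_of_int q)\<^sup>2 * (real_of_int q * defect n k L L i j)" for i j
    unfolding int_defect_real[OF assms(1)] qL L_def[symmetric] by (simp add: defect_mult)
  have "real_of_int (proj_cost n k q g l) =
      (\<Sum>i<n. \<Sum>j<n. ((real_of_int q)\<^sup>2 * defect n k L (\<lambda>i j. g i j) i j)\<^sup>2) +
      (\<Sum>i<n. \<Sum>j<k. ((real_of_int q)\<^sup>2 * (real_of_int q * defect n k L L i j))\<^sup>2)"
    unfolding proj_cost_def by (simp add: 1 2)
  also have "\<dots> = (real_of_int q)^4 * ((\<Sum>i<n. \<Sum>j<n. (defect n k L (\<lambda>i j. g i j) i j)\<^sup>2) +
      (real_of_int q)\<^sup>2 * (\<Sum>i<n. \<Sum>j<k. (defect n k L L i j)\<^sup>2))"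
    by (simp add: power_mult_distrib sum_distrib_left distrib_left flip: power_mult)
  also have "\<dots> = (real_of_int q)^4 * ((frob n n (defect n k L (\<lambda>i j. g i j)))\<^sup>2 + (q * frob n k (defect n k L L))\<^sup>2)"
    unfolding power_mult_distrib frob_sq by (subst (1 2) sum.swap) simp
  finally show ?thesis .
qed

text \<open>Comparison with \<open>Q\<close> rounded down to multiples of \<open>1 / q\<close>
  yields two facts. By the lower bound on \<open>q\<close>, the penalty forces
  \<open>frob n k (defect n k L L) \<le> 1\<close>, so the defect of \<open>L\<close> at most
  doubles norms; and the data term of \<open>L\<close> exceeds that of the competitor by at most
  \<open>3 n ^ 3\<close>. The coefficient 4 of the distance between \<open>M\<close> and
  \<open>g / s\<close> is 2 for the doubling, 1 for comparing \<open>g / s\<close> instead of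
  \<open>M\<close> with \<open>B\<close>, and 1 for the rounding term.\<close>

lemma minimiser_near_best:
  fixes g :: "nat \<Rightarrow> nat \<Rightarrow> int" and l :: "nat \<Rightarrow> nat \<Rightarrow> int" and q :: int and s :: real
  defines "L \<equiv> \<lambda>i a. real_of_int (l i a) / q"
  assumes kn: "1 \<le> k" "k \<le> n" and s: "s > 0"
    and l: "\<And>i a. i < n \<Longrightarrow> a < k \<Longrightarrow> \<bar>l i a\<bar> \<le> q"
    and min: "\<And>l'. (\<And>i a. i < n \<Longrightarrow> a < k \<Longrightarrow> \<bar>l' i a\<bar> \<le> q) \<Longrightarrow> proj_cost n k q g l \<le> proj_cost n k q g l'"
    and B: "B \<in> carrier_mat n n" "vec_space.rank n B \<le> k"
    and g: "\<And>i j. i < n \<Longrightarrow> j < n \<Longrightarrow> \<bar>g i j\<bar> \<le> c"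
    and q: "2 * real n * real_of_int c + 3 * real n ^ 3 \<le> real_of_int q"
  shows "frob n n (defect n k L M) \<le> frob n n (\<lambda>i j. M i j - B $$ (i, j)) + 4 * frob n n (\<lambda>i j. M i j - g i j / s)
      + 2 * real n ^ 2 / q * frob n n M + 3 * real n ^ 3 / s"
proof -
  have n1: "1 \<le> real n" using kn by simp
  have c0: "0 \<le> c" using g[of 0 0] kn by simp
  have n3: "real n ^ 2 \<le> real n ^ 3" "1 \<le> real n ^ 3" "real n ^ 3 \<ge> real n"
    using n1 power_increasing[of 2 3 "real n"] power_increasing[of 1 3 "real n"] by auto
  have q': "3 * real n ^ 3 \<le> real_of_int q" using q c0 n1 by (smt (verit) mult_nonneg_nonneg of_int_0_le_iff)
  then have q0: "real_of_int q > 0" "q > 0" using n3 by linarith+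
  \<comment> \<open>\<open>frob_defect_perturb\<close> with \<delta> equal to \<open>1 / q\<close>
    and \<open>k \<le> n\<close>.\<close>
  define \<tau> where "\<tau> = 2 * real n ^ 2 / q"
  have \<tau>: "0 \<le> \<tau>" "\<tau> \<le> 1" using q' n3 q0 by (auto simp: \<tau>_def)
  obtain r Q d where Q: "ortho n k r Q" and BQ: "\<And>i j. i < n \<Longrightarrow> j < n \<Longrightarrow> B $$ (i, j) = (\<Sum>a<k. Q i a * d a j)"
    using exists_ortho_basis[OF B] by blast
  define l0 where "l0 i a = \<lfloor>q * Q i a\<rfloor>" for i a
  define L0 where "L0 i a = real_of_int (l0 i a) / q" for i a
  have Q1: "\<bar>Q i a\<bar> \<le> 1" if "i < n" for i a using ortho_entry_le[OF Q that] .
  have l0: "\<bar>l0 i a\<bar> \<le> q" if "i < n" for i a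
  proof -
    have "real_of_int q * Q i a \<le> real_of_int q * 1" "real_of_int q * - 1 \<le> real_of_int q * Q i a"
      by (intro mult_left_mono; use Q1[OF that, of a] q0 in auto)+
    then have "- q \<le> l0 i a" "l0 i a \<le> q" unfolding l0_def by (auto simp: le_floor_iff floor_le_iff)
    then show ?thesis by simp
  qed
  have L01: "\<bar>L0 i a\<bar> \<le> 1" if "i < n" for i a
  proof -
    have "real_of_int \<bar>l0 i a\<bar> \<le> real_of_int q" using l0[OF that] by (simp only: of_int_le_iff)
    then show ?thesis using q0 by (simp add: L0_def abs_divide)
  qed
  have L0Q: "\<bar>L0 i a - Q i a\<bar> \<le> 1 / q" for i a
  proof -
    have "\<bar>real_of_int (l0 i a) - q * Q i a\<bar> \<le> 1" unfolding l0_def by linarith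
    then have "\<bar>real_of_int (l0 i a) - q * Q i a\<bar> / q \<le> 1 / q" using q0 by (intro divide_right_mono) auto
    also have "\<bar>real_of_int (l0 i a) - q * Q i a\<bar> / q = \<bar>L0 i a - Q i a\<bar>"
      using q0 by (simp add: L0_def diff_divide_distrib flip: abs_divide[of _ "real_of_int q", unfolded abs_of_pos[OF q0(1)]])
    finally show ?thesis .
  qed
  have pert: "frob n m (defect n k L0 Y) \<le> frob n m (defect n k Q Y) + \<tau> * frob n m Y" for m Y
  proof -
    have "frob n m (defect n k L0 Y) \<le> frob n m (defect n k Q Y) + 2 * real k * real n * (1 / q) * frob n m Y"
      by (rule frob_defect_perturb) (use L0Q L01 Q1 q0 in auto)
    also have "2 * real k * real n * (1 / q) * frob n m Y \<le> \<tau> * frob n m Y"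
      unfolding \<tau>_def using kn q0 by (intro mult_right_mono) (auto simp: power2_eq_square divide_right_mono mult_right_mono)
    finally show ?thesis by simp
  qed
  have contr: "frob n m (defect n k Q Y) \<le> frob n m Y" for m Y
    using ortho_defect_le[OF Q, of m "\<lambda>_ _. 0" "\<lambda>_ _. 0" Y] by simp
  let ?G = "\<lambda>i j. real_of_int (g i j)"
  define X where "X = frob n n (defect n k L ?G)"
  define Y where "Y = frob n k (defect n k L L)"
  define X0 where "X0 = frob n n (defect n k L0 ?G)"
  define Y0 where "Y0 = frob n k (defect n k L0 L0)"
  have nn: "0 \<le> X" "0 \<le> Y" "0 \<le> X0" "0 \<le> Y0" by (simp_all add: X_def Y_def X0_def Y0_def)
  \<comment> \<open>\<open>Q\<close> has no defect on itself, so only rounding counts: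
    \<open>n / q\<close> for the defect of \<open>Q\<close> on \<open>L0 - Q\<close>, and
    \<open>\<tau> n\<close> for replacing \<open>Q\<close> by \<open>L0\<close>.\<close>
  have Y0: "q * Y0 \<le> 3 * real n ^ 3"
  proof -
    have "defect n k Q L0 i a = defect n k Q (\<lambda>i a. L0 i a - Q i a) i a" if "a < k" for i a
      using defect_add[of n k Q "\<lambda>i a. L0 i a - Q i a" Q i a] ortho_defect_self[OF Q that] by simp
    then have "frob n k (defect n k Q L0) = frob n k (defect n k Q (\<lambda>i a. L0 i a - Q i a))"
      by (intro frob_cong) auto
    also have "\<dots> \<le> frob n k (\<lambda>i a. L0 i a - Q i a)" by (rule contr)
    also have "\<dots> \<le> real n * (1 / q)" by (rule frob_le_const) (use L0Q q0 kn in auto)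
    finally have 1: "frob n k (defect n k Q L0) \<le> real n * (1 / q)" .
    have "frob n k L0 \<le> real n * 1" by (rule frob_le_const) (use L01 kn in auto)
    then have "\<tau> * frob n k L0 \<le> \<tau> * real n" using \<tau> by (intro mult_left_mono) auto
    moreover have "real n * (1 / q) = real n / q" by simp
    ultimately have "Y0 \<le> real n / q + \<tau> * real n" using 1 pert[of k L0] unfolding Y0_def by linarith
    then have "q * Y0 \<le> q * (real n / q + \<tau> * real n)" using q0 by (intro mult_left_mono) auto
    also have "\<dots> = real n + 2 * real n ^ 3" using q0 by (simp add: \<tau>_def field_simps power2_eq_square power3_eq_cube)
    finally show ?thesis using n3 by linarith
  qed
  have X0: "X0 \<le> frob n n (defect n k Q ?G) + \<tau> * frob n n ?G" unfolding X0_def by (rule pert)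
  have "real_of_int (proj_cost n k q g l) \<le> real_of_int (proj_cost n k q g l0)"
    using min[of l0] l0 by simp
  then have "X\<^sup>2 + (q * Y)\<^sup>2 \<le> X0\<^sup>2 + (q * Y0)\<^sup>2"
    using q0 unfolding proj_cost_real[OF q0(2)] X_def Y_def X0_def Y0_def L_def L0_def by simp
  moreover have "X0\<^sup>2 + (q * Y0)\<^sup>2 \<le> (X0 + q * Y0)\<^sup>2"
    using nn q0 by (simp add: power2_sum)
  ultimately have S: "X\<^sup>2 + (q * Y)\<^sup>2 \<le> (X0 + q * Y0)\<^sup>2" by linarith
  have SX: "X \<le> X0 + q * Y0"
    by (rule power2_le_imp_le) (use S nn q0 zero_le_power2[of "q * Y"] in \<open>linarith, simp\<close>)
  have SY: "q * Y \<le> X0 + q * Y0"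
    by (rule power2_le_imp_le) (use S nn q0 zero_le_power2[of X] in \<open>linarith, simp\<close>)
  have "frob n n ?G \<le> real n * c"
  proof (rule frob_le_const)
    fix i j assume "i < n" "j < n"
    then show "\<bar>real_of_int (g i j)\<bar> \<le> real_of_int c" using g by (metis of_int_abs of_int_le_iff)
  qed (use c0 in auto)
  moreover have "\<tau> * frob n n ?G \<le> 1 * frob n n ?G" using \<tau> by (intro mult_right_mono) auto
  \<comment> \<open>This is what \<open>q\<close> was chosen for: \<open>X0 + q * Y0\<close> is at
    most \<open>2 n c + 3 n ^ 3\<close>, hence at most \<open>q\<close>.\<close>
  ultimately have "q * Y \<le> q * 1" using SY X0 Y0 contr[of n ?G] q by linarith
  then have Y1: "Y \<le> 1" using q0 by simp
  have D: "frob n n (defect n k L Z) \<le> 2 * frob n n Z" for Z using frob_defect_le Y1 unfolding Y_def by blast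
  let ?H = "\<lambda>i j. g i j / s" let ?E = "frob n n (\<lambda>i j. M i j - ?H i j)"
  have scale: "frob n n (defect n k K ?H) = frob n n (defect n k K ?G) / s" for K
  proof -
    have "frob n n (defect n k K ?H) = frob n n (\<lambda>i j. (1 / s) * defect n k K ?G i j)"
      by (intro frob_cong) (simp flip: defect_mult)
    also have "\<dots> = frob n n (defect n k K ?G) / s" using s by (subst frob_mult) simp
    finally show ?thesis .
  qed
  have scale': "frob n n ?H = frob n n ?G / s" using frob_mult[of n n "1 / s" ?G] s by simp
  have "frob n n (defect n k L M) \<le> frob n n (defect n k L (\<lambda>i j. M i j - ?H i j)) + frob n n (defect n k L ?H)"
  proof -
    have "frob n n (defect n k L M) = frob n n (\<lambda>i j. defect n k L (\<lambda>i j. M i j - ?H i j) i j + defect n k L ?H i j)"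
      by (intro frob_cong) (simp flip: defect_add)
    also have "\<dots> \<le> frob n n (defect n k L (\<lambda>i j. M i j - ?H i j)) + frob n n (defect n k L ?H)" by (rule frob_add)
    finally show ?thesis .
  qed
  also have "\<dots> \<le> 2 * ?E + X / s" using D[of "\<lambda>i j. M i j - ?H i j"] by (simp add: scale X_def)
  also have "X / s \<le> (frob n n (defect n k Q ?G) + \<tau> * frob n n ?G + 3 * real n ^ 3) / s"
    using SX X0 Y0 s by (intro divide_right_mono) auto
  also have "\<dots> = frob n n (defect n k Q ?H) + \<tau> * frob n n ?H + 3 * real n ^ 3 / s"
    by (simp add: scale scale' add_divide_distrib)
  also have "frob n n (defect n k Q ?H) \<le> frob n n (\<lambda>i j. ?H i j - B $$ (i, j))"
    by (rule ortho_defect_le[OF Q]) (use BQ in auto)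
  also have "\<dots> \<le> ?E + frob n n (\<lambda>i j. M i j - B $$ (i, j))"
  proof -
    have "frob n n (\<lambda>i j. ?H i j - B $$ (i, j)) = frob n n (\<lambda>i j. (- 1) * (M i j - ?H i j) + (M i j - B $$ (i, j)))"
      by (intro frob_cong) simp
    also have "\<dots> \<le> frob n n (\<lambda>i j. (- 1) * (M i j - ?H i j)) + frob n n (\<lambda>i j. M i j - B $$ (i, j))" by (rule frob_add)
    also have "frob n n (\<lambda>i j. (- 1) * (M i j - ?H i j)) = ?E" by (subst frob_mult) simp
    finally show ?thesis .
  qed
  also have "\<tau> * frob n n ?H \<le> ?E + \<tau> * frob n n M"
  proof -
    have "frob n n ?H = frob n n (\<lambda>i j. (- 1) * (M i j - ?H i j) + M i j)" by (intro frob_cong) simp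
    also have "\<dots> \<le> frob n n (\<lambda>i j. (- 1) * (M i j - ?H i j)) + frob n n M" by (rule frob_add)
    also have "frob n n (\<lambda>i j. (- 1) * (M i j - ?H i j)) = ?E" by (subst frob_mult) simp
    finally have "\<tau> * frob n n ?H \<le> \<tau> * (?E + frob n n M)" using \<tau> by (intro mult_left_mono)
    moreover have "\<tau> * ?E \<le> 1 * ?E" using \<tau> by (intro mult_right_mono) auto
    ultimately show ?thesis by (simp add: distrib_left)
  qed
  finally show ?thesis by (simp add: \<tau>_def algebra_simps)
qed

section \<open>Deterministic execution of straight-line code\<close>

definition reach :: "nat \<Rightarrow> prog \<Rightarrow> config \<Rightarrow> config \<Rightarrow> bool" where
  "reach w P c c' \<longleftrightarrow> (\<exists>t. steps w P t c = return_pmf c')"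

lemma steps_add: "steps w P (a + b) c = bind_pmf (steps w P a c) (steps w P b)"
proof (induction a arbitrary: c)
  case (Suc a)
  have "steps w P (a + b) = (\<lambda>x. bind_pmf (steps w P a x) (steps w P b))" using Suc by (intro ext)
  then show ?case by (simp add: bind_assoc_pmf)
qed (simp add: bind_return_pmf)

lemma reach_refl: "reach w P c c"
  unfolding reach_def by (rule exI[of _ 0]) simp

lemma reach_trans [trans]: "reach w P a b \<Longrightarrow> reach w P b c \<Longrightarrow> reach w P a c"
  unfolding reach_def by (metis steps_add bind_return_pmf)

text \<open>Jump targets are absolute, so a compiled fragment is correct only at the address for
  which it was compiled.\<close>

definition code_at :: "prog \<Rightarrow> nat \<Rightarrow> prog \<Rightarrow> bool" where
  "code_at P pc c \<longleftrightarrow> (\<forall>i<length c. pc + i < length P \<and> P ! (pc + i) = c ! i)"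

lemma code_at_append [simp]:
  "code_at P pc (a @ b) \<longleftrightarrow> code_at P pc a \<and> code_at P (pc + length a) b"
  unfolding code_at_def
proof (intro iffI conjI allI impI; (elim conjE)?)
  fix i assume *: "\<forall>i<length (a @ b). pc + i < length P \<and> P ! (pc + i) = (a @ b) ! i"
  show "pc + i < length P" if "i < length a" using * that by auto
  show "P ! (pc + i) = a ! i" if "i < length a" using *[rule_format, of i] that by (auto simp: nth_append)
  show "pc + length a + i < length P" if "i < length b" using *[rule_format, of "length a + i"] that by auto
  show "P ! (pc + length a + i) = b ! i" if "i < length b"
    using *[rule_format, of "length a + i"] that by (auto simp: nth_append add.assoc)
next
  fix i assume a: "\<forall>i<length a. pc + i < length P \<and> P ! (pc + i) = a ! i"
    and b: "\<forall>i<length b. pc + length a + i < length P \<and> P ! (pc + length a + i) = b ! i"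
    and i: "i < length (a @ b)"
  show "pc + i < length P" "P ! (pc + i) = (a @ b) ! i"
    using a[rule_format, of i] b[rule_format, of "i - length a"] i
    by (cases "i < length a"; simp add: nth_append)+
qed

lemma code_at_Cons [simp]:
  "code_at P pc (i # c) \<longleftrightarrow> pc < length P \<and> P ! pc = i \<and> code_at P (Suc pc) c"
  using code_at_append[of P pc "[i]" c] by (auto simp: code_at_def)

lemma code_at_Nil [simp]: "code_at P pc []"
  by (simp add: code_at_def)

fun straight :: "instr \<Rightarrow> bool" where
  "straight (Rand a) = False" | "straight (JumpZ a l) = False" | "straight (Emit a) = False"
| "straight _ = True"

fun instr_mem :: "nat \<Rightarrow> instr \<Rightarrow> mem \<Rightarrow> mem" where
  "instr_mem w (Const a v) m = m[a := v mod 2 ^ w]"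
| "instr_mem w (Arith f a b c) m = m[a := arith_val w f (m ! b) (m ! c)]"
| "instr_mem w (Load a b) m = m[a := m ! (m ! b)]"
| "instr_mem w (Store a b) m = m[m ! a := m ! b]"
| "instr_mem w _ m = m"

text \<open>Straight-line code as a partial function on memories: \<open>None\<close> stands for an
  instruction of another kind or an address out of range. Concrete code can then be checked by
  simplification.\<close>

fun block :: "nat \<Rightarrow> prog \<Rightarrow> mem \<Rightarrow> mem option" where
  "block w [] m = Some m"
| "block w (i # cs) m =
     (if straight i \<and> (\<forall>a\<in>accessed m i. a < length m) then block w cs (instr_mem w i m) else None)"

lemma exec_straight: "straight i \<Longrightarrow> exec w i (pc, m, out) = return_pmf (Suc pc, instr_mem w i m, out)"
  by (cases i) auto

lemma reach_step:
  assumes "pc < length P" "\<forall>a\<in>accessed m (P ! pc). a < length m"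
    and "exec w (P ! pc) (pc, m, out) = return_pmf c"
  shows "reach w P (pc, m, out) c"
  unfolding reach_def by (rule exI[of _ 1]) (use assms in \<open>simp add: bind_return_pmf\<close>)

lemma steps_block:
  assumes "block w cs m = Some m'" "code_at P pc cs"
  shows "steps w P (length cs) (pc, m, out) = return_pmf (pc + length cs, m', out)"
  using assms
proof (induction cs arbitrary: pc m)
  case (Cons i cs)
  from Cons.prems have "straight i" "\<forall>a\<in>accessed m i. a < length m" and b: "block w cs (instr_mem w i m) = Some m'"
    by (auto split: if_splits)
  then have "step w P (pc, m, out) = return_pmf (Suc pc, instr_mem w i m, out)"
    using Cons.prems by (simp add: exec_straight)
  then show ?case using Cons.IH[OF b] Cons.prems by (simp add: bind_return_pmf)
qed simp

lemma reach_block: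
  assumes "block w cs m = Some m'" "code_at P pc cs" "pc' = pc + length cs"
  shows "reach w P (pc, m, out) (pc', m', out)"
  unfolding reach_def using steps_block[OF assms(1,2)] assms(3) by blast

lemma reach_JumpZ:
  assumes "pc < length P" "P ! pc = JumpZ a l" "a < length m" "pc' = (if m ! a = 0 then l else Suc pc)"
  shows "reach w P (pc, m, out) (pc', m, out)"
  by (rule reach_step) (use assms in auto)

section \<open>A structured language for the word machine\<close>

text \<open>Bounded iteration, with accumulator \<open>y\<close> and counter \<open>x\<close>, is
  part of the expressions, so sums, powers and even the objectives of the searches are expressions
  without side effects. Array indices are reduced modulo variable 3, so that no read leaves the
  array.\<close>

datatype exp =
    N nat
  | X nat
  | Op arith exp exp
  | Rd nat exp
  | It nat nat exp exp exp

type_synonym vars = "nat \<Rightarrow> nat"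
type_synonym arrs = "nat \<Rightarrow> nat \<Rightarrow> nat"

primrec eval :: "nat \<Rightarrow> exp \<Rightarrow> vars \<Rightarrow> arrs \<Rightarrow> nat" where
  "eval w (N c) v A = c mod 2 ^ w"
| "eval w (X x) v A = v x"
| "eval w (Op f a b) v A = arith_val w f (eval w a v A) (eval w b v A)"
| "eval w (Rd r e) v A = A r (eval w e v A mod v 3)"
| "eval w (It y x e0 eN eb) v A =
     fold (\<lambda>i acc. eval w eb (v(y := acc, x := i)) A) [0..<eval w eN v A] (eval w e0 v A)"

datatype com = Asg nat exp | St nat exp exp | Sq com com (infixr ";;" 60) | Wh exp com

fun uses_arr :: "exp \<Rightarrow> bool" where
  "uses_arr (N c) = False"
| "uses_arr (X x) = False"
| "uses_arr (Op f a b) = (uses_arr a \<or> uses_arr b)"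
| "uses_arr (Rd r e) = True"
| "uses_arr (It y x e0 eN eb) = (uses_arr e0 \<or> uses_arr eN \<or> uses_arr eb)"

text \<open>The premises on variable 3 guarantee that reduction modulo it gives an index within the
  \<open>l\<close> cells of an array; they keep the compiled code from blocking.\<close>

inductive big_step :: "nat \<Rightarrow> nat \<Rightarrow> com \<Rightarrow> vars \<times> arrs \<Rightarrow> vars \<times> arrs \<Rightarrow> bool" for w l where
  big_step_Asg: "(uses_arr e \<Longrightarrow> 0 < v 3 \<and> v 3 \<le> l) \<Longrightarrow>
     big_step w l (Asg x e) (v, A) (v(x := eval w e v A), A)"
| big_step_St: "0 < v 3 \<Longrightarrow> v 3 \<le> l \<Longrightarrow>
     big_step w l (St r ei ev) (v, A) (v, A(r := (A r)(eval w ei v A mod v 3 := eval w ev v A)))"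
| big_step_Sq: "big_step w l c s s' \<Longrightarrow> big_step w l d s' s'' \<Longrightarrow> big_step w l (c ;; d) s s''"
| big_step_Wh0: "(uses_arr e \<Longrightarrow> 0 < v 3 \<and> v 3 \<le> l) \<Longrightarrow> eval w e v A = 0 \<Longrightarrow> big_step w l (Wh e c) (v, A) (v, A)"
| big_step_Wh: "(uses_arr e \<Longrightarrow> 0 < v 3 \<and> v 3 \<le> l) \<Longrightarrow> eval w e v A \<noteq> 0 \<Longrightarrow> big_step w l c (v, A) s' \<Longrightarrow>
     big_step w l (Wh e c) s' s'' \<Longrightarrow> big_step w l (Wh e c) (v, A) s''"

subsection \<open>Compilation\<close>

text \<open>Cells 0..29 hold the variables, cells 30..129 are an evaluation stack, and index \<open>i\<close> of array
  \<open>r < 4\<close> is cell \<open>130 + 4 * i + r\<close>.  Variable 3 holds the common length of the arrays.\<close>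

fun comp_exp :: "nat \<Rightarrow> nat \<Rightarrow> exp \<Rightarrow> prog" where
  "comp_exp pc d (N c) = [Const d c]"
| "comp_exp pc d (X x) = [Const d 0, Arith Op_Add d d x]"
| "comp_exp pc d (Op f a b) =
     (let ca = comp_exp pc d a; cb = comp_exp (pc + length ca) (d + 1) b in ca @ cb @ [Arith f d d (d + 1)])"
| "comp_exp pc d (Rd r e) = comp_exp pc d e @
     [Arith Op_Mod d d 3, Const (d + 1) 4, Arith Op_Mul d d (d + 1), Const (d + 1) (130 + r),
      Arith Op_Add d d (d + 1), Load d d]"
| "comp_exp pc d (It y x e0 eN eb) =
     (let c0 = comp_exp pc d e0; p0 = pc + length c0;
          cN = comp_exp p0 (d + 1) eN; p1 = p0 + length cN + 5;
          cb = comp_exp (p1 + 2) (d + 4) eb; p2 = p1 + 2 + length cb + 6 in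
      c0 @ cN @
      [Const (d + 4) 0, Arith Op_Add (d + 2) y (d + 4), Arith Op_Add (d + 3) x (d + 4),
       Arith Op_Add y d (d + 4), Const x 0] @
      [Arith Op_Less (d + 4) x (d + 1)] @ [JumpZ (d + 4) p2] @ cb @
      [Const (d + 5) 0, Arith Op_Add y (d + 4) (d + 5), Const (d + 5) 1, Arith Op_Add x x (d + 5),
       Const (d + 5) 0] @ [JumpZ (d + 5) p1] @
      [Const (d + 4) 0, Arith Op_Add d y (d + 4), Arith Op_Add y (d + 2) (d + 4),
       Arith Op_Add x (d + 3) (d + 4)])"

fun depth :: "exp \<Rightarrow> nat" where
  "depth (N c) = 1"
| "depth (X x) = 1"
| "depth (Op f a b) = max 2 (max (depth a) (1 + depth b))"
| "depth (Rd r e) = max 2 (depth e)"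
| "depth (It y x e0 eN eb) = max 6 (max (depth e0) (max (1 + depth eN) (4 + depth eb)))"

text \<open>Bound variables lie above 3, so an iteration never overwrites the inputs in cells 0 to 2
  or the array length.\<close>

fun wf_exp :: "exp \<Rightarrow> bool" where
  "wf_exp (N c) = True"
| "wf_exp (X x) = (x < 30)"
| "wf_exp (Op f a b) = (wf_exp a \<and> wf_exp b)"
| "wf_exp (Rd r e) = (r < 4 \<and> wf_exp e)"
| "wf_exp (It y x e0 eN eb) =
     (x \<noteq> y \<and> 3 < x \<and> 3 < y \<and> x < 30 \<and> y < 30 \<and> wf_exp e0 \<and> wf_exp eN \<and> wf_exp eb)"

fun comp_com :: "nat \<Rightarrow> com \<Rightarrow> prog" where
  "comp_com pc (Asg x e) = comp_exp pc 30 e @ [Const 31 0, Arith Op_Add x 30 31]"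
| "comp_com pc (St r ei ev) =
     (let ci = comp_exp pc 30 ei; cv = comp_exp (pc + length ci) 31 ev in ci @ cv @
      [Arith Op_Mod 30 30 3, Const 32 4, Arith Op_Mul 30 30 32, Const 32 (130 + r),
       Arith Op_Add 30 30 32, Store 30 31])"
| "comp_com pc (c ;; d) = (let cc = comp_com pc c in cc @ comp_com (pc + length cc) d)"
| "comp_com pc (Wh e c) =
     (let ce = comp_exp pc 30 e; cc = comp_com (pc + length ce + 1) c in
      ce @ [JumpZ 30 (pc + length ce + 1 + length cc + 2)] @ cc @ [Const 30 0] @ [JumpZ 30 pc])"

fun wf_com :: "com \<Rightarrow> bool" where
  "wf_com (Asg x e) = (x < 30 \<and> wf_exp e \<and> depth e \<le> 90)"
| "wf_com (St r ei ev) = (r < 4 \<and> wf_exp ei \<and> wf_exp ev \<and> depth ei \<le> 90 \<and> depth ev \<le> 90)"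
| "wf_com (c ;; d) = (wf_com c \<and> wf_com d)"
| "wf_com (Wh e c) = (wf_exp e \<and> depth e \<le> 90 \<and> wf_com c)"

text \<open>The bound \<open>length m \<le> 2 ^ w\<close> makes every address a word, so address
  arithmetic does not wrap. The four arrays are interleaved because their length is not known at
  compile time.\<close>

definition represents :: "nat \<Rightarrow> nat \<Rightarrow> mem \<Rightarrow> vars \<Rightarrow> arrs \<Rightarrow> bool" where
  "represents w l m v A \<longleftrightarrow> length m = 130 + 4 * l \<and> length m \<le> 2 ^ w \<and> (\<forall>a<length m. m ! a < 2 ^ w) \<and>
     (\<forall>x<30. m ! x = v x) \<and> (\<forall>r<4. \<forall>i<l. m ! (130 + 4 * i + r) = A r i)"

lemma arith_val_less: "x < 2 ^ w \<Longrightarrow> y < 2 ^ w \<Longrightarrow> 0 < w \<Longrightarrow> arith_val w f x y < 2 ^ w"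
proof (cases f)
  case Op_Div then show "x < 2 ^ w \<Longrightarrow> ?thesis" by (metis arith_val.simps(4) div_le_dividend order_le_less_trans)
next
  case Op_Mod then show "x < 2 ^ w \<Longrightarrow> ?thesis" by (metis arith_val.simps(5) mod_less_eq_dividend order_le_less_trans)
qed auto

lemma represents_stack:
  assumes "represents w l m v A" "30 \<le> a" "a < 130" "x < 2 ^ w"
  shows "represents w l (m[a := x]) v A"
  using assms by (auto simp: represents_def nth_list_update)

lemma represents_var:
  assumes "represents w l m v A" "a < 30" "x < 2 ^ w"
  shows "represents w l (m[a := x]) (v(a := x)) A"
  using assms by (auto simp: represents_def nth_list_update)

lemma represents_arr:
  assumes "represents w l m v A" "r < 4" "i < l" "x < 2 ^ w" "a = 130 + 4 * i + r"
  shows "represents w l (m[a := x]) v (A(r := (A r)(i := x)))"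
proof -
  have "i' = i \<and> r' = r" if "4 * i' + r' = 4 * i + r" "r' < 4" for i' r' :: nat
    using that assms(2) by presburger
  then show ?thesis using assms by (auto simp: represents_def nth_list_update)
qed

text \<open>Splits the code of an iteration into its nine pieces once and for all, with the pieces
  opaque, so that addresses are not recomputed inside the main induction.\<close>

lemma code_at_loop:
  assumes "code_at P pc (c0 @ cN @ B1 @ B2 @ [j1] @ cb @ B3 @ [j2] @ B4)"
    and "length B1 = 5" "length B2 = 1" "length B3 = 5"
  shows "code_at P pc c0" "code_at P (pc + length c0) cN" "code_at P (pc + length c0 + length cN) B1"
    "code_at P (pc + length c0 + length cN + 5) B2"
    "pc + length c0 + length cN + 5 + 1 < length P \<and> P ! (pc + length c0 + length cN + 5 + 1) = j1"
    "code_at P (pc + length c0 + length cN + 5 + 2) cb"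
    "code_at P (pc + length c0 + length cN + 5 + 2 + length cb) B3"
    "pc + length c0 + length cN + 5 + 2 + length cb + 5 < length P \<and>
     P ! (pc + length c0 + length cN + 5 + 2 + length cb + 5) = j2"
    "code_at P (pc + length c0 + length cN + 5 + 2 + length cb + 6) B4"
  using assms by (simp_all add: ac_simps eval_nat_numeral)

lemma length_loop:
  assumes "length B1 = 5" "length B2 = 1" "length B3 = 5" "length B4 = 4"
  shows "pc + length (c0 @ cN @ B1 @ B2 @ [j1] @ cb @ B3 @ [j2] @ B4) =
    pc + length c0 + length cN + 5 + 2 + length cb + 6 + 4"
  using assms by simp

text \<open>The value ends up in stack cell \<open>d\<close>, and the stack cells below
  \<open>d\<close> survive. This frame condition lets operands and saved loop data wait on the stack
  while a subexpression is evaluated.\<close>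

lemma comp_exp_correct:
  assumes "represents w l m v A" "wf_exp e" "30 \<le> d" "d + depth e \<le> 130" "0 < w"
    and "uses_arr e \<Longrightarrow> 0 < v 3 \<and> v 3 \<le> l"
    and "code_at P pc (comp_exp pc d e)"
  shows "\<exists>m'. reach w P (pc, m, out) (pc + length (comp_exp pc d e), m', out) \<and> represents w l m' v A \<and>
     m' ! d = eval w e v A \<and> (\<forall>a<d. 30 \<le> a \<longrightarrow> m' ! a = m ! a)"
  using assms
proof (induction e arbitrary: m v pc d)
  case (N c)
  show ?case
    by (rule exI[of _ "m[d := c mod 2 ^ w]"], intro conjI, rule reach_block[where cs = "[Const d c]"])
      (use N in \<open>auto simp: represents_def nth_list_update\<close>)
next
  case (X x)
  have "x < length m" "\<forall>a<length m. m ! a < 2 ^ w" "m ! x = v x" using X unfolding represents_def by auto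
  then have "v x < 2 ^ w" by metis
  show ?case
    by (rule exI[of _ "m[d := v x]"], intro conjI, rule reach_block[where cs = "[Const d 0, Arith Op_Add d d x]"])
      (use X \<open>v x < 2 ^ w\<close> in \<open>auto simp: represents_def nth_list_update\<close>)
next
  case (Op f a b)
  have dep: "d + depth a \<le> 130" "d + 1 + depth b \<le> 130" "d + 2 \<le> 130"
    using Op.prems(4) unfolding depth.simps by linarith+
  let ?ca = "comp_exp pc d a" let ?cb = "comp_exp (pc + length ?ca) (d + 1) b"
  have "code_at P pc ?ca" using Op.prems by (simp add: Let_def)
  from Op.IH(1)[OF Op.prems(1) _ _ _ _ _ this] Op.prems dep
  obtain m1 where m1: "reach w P (pc, m, out) (pc + length ?ca, m1, out)" "represents w l m1 v A"
    "m1 ! d = eval w a v A" "\<forall>a<d. 30 \<le> a \<longrightarrow> m1 ! a = m ! a" by auto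
  have "code_at P (pc + length ?ca) ?cb" using Op.prems by (simp add: Let_def)
  from Op.IH(2)[OF m1(2) _ _ _ _ _ this] Op.prems dep
  obtain m2 where m2: "reach w P (pc + length ?ca, m1, out) (pc + length ?ca + length ?cb, m2, out)"
    "represents w l m2 v A" "m2 ! (d + 1) = eval w b v A" "\<forall>a<d+1. 30 \<le> a \<longrightarrow> m2 ! a = m1 ! a" by auto
  have lt: "m2 ! d < 2 ^ w" "m2 ! (d + 1) < 2 ^ w" using m2(2) Op.prems dep by (auto simp: represents_def)
  have v: "arith_val w f (m2 ! d) (m2 ! (d + 1)) < 2 ^ w" by (rule arith_val_less) (use lt Op.prems in auto)
  have "reach w P (pc + length ?ca + length ?cb, m2, out)
     (pc + length (comp_exp pc d (Op f a b)), m2[d := arith_val w f (m2 ! d) (m2 ! (d + 1))], out)"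
    by (rule reach_block[where cs = "[Arith f d d (d + 1)]"])
      (use Op.prems dep m2(2) in \<open>auto simp: represents_def Let_def add.assoc\<close>)
  with m1(1) m2(1) have "reach w P (pc, m, out)
    (pc + length (comp_exp pc d (Op f a b)), m2[d := arith_val w f (m2 ! d) (m2 ! (d + 1))], out)"
    by (meson reach_trans)
  moreover have "d < length m2" using m2(2) Op.prems dep by (auto simp: represents_def)
  ultimately show ?case using represents_stack[OF m2(2) _ _ v, of d] Op.prems dep m1 m2
    by (intro exI[of _ "m2[d := arith_val w f (m2 ! d) (m2 ! (d + 1))]"]) (auto simp: nth_list_update)
next
  case (Rd r e)
  have dep: "d + depth e \<le> 130" "d + 2 \<le> 130"
    using Rd.prems(4) unfolding depth.simps by linarith+
  let ?c = "comp_exp pc d e"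
  have "code_at P pc ?c" using Rd.prems by simp
  from Rd.IH[OF Rd.prems(1) _ _ _ _ _ this] Rd.prems dep
  obtain m1 where m1: "reach w P (pc, m, out) (pc + length ?c, m1, out)" "represents w l m1 v A"
    "m1 ! d = eval w e v A" "\<forall>a<d. 30 \<le> a \<longrightarrow> m1 ! a = m ! a" by auto
  let ?i = "eval w e v A mod v 3"
  have v3: "0 < v 3" "v 3 \<le> l" using Rd.prems by auto
  then have i: "?i < l" by (meson mod_less_divisor order_less_le_trans)
  have len: "length m1 = 130 + 4 * l" "130 + 4 * l \<le> 2 ^ w" using m1(2) by (auto simp: represents_def)
  have three: "m1 ! 3 = v 3" using m1(2) by (auto simp: represents_def)
  have r4: "r < 4" using Rd.prems by auto
  have W: "?i * 4 + (130 + r) < 2 ^ w" "4 < (2::nat) ^ w" "130 + r < 2 ^ w" "?i * 4 < 2 ^ w" using i len r4 by linarith+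
  have arr: "m1 ! (130 + 4 * ?i + r) = A r ?i" using m1(2) r4 i by (auto simp: represents_def)
  have "130 + 4 * ?i + r < length m1" "\<forall>a<length m1. m1 ! a < 2 ^ w"
    using m1(2) r4 i len by (auto simp: represents_def)
  then have Aw: "A r ?i < 2 ^ w" unfolding arr[symmetric] by blast
  \<comment> \<open>Net effect of the six instructions of the array read, which touch only cells
    \<open>d\<close> and \<open>d + 1\<close>.\<close>
  define m2 where "m2 = m1[d + 1 := 130 + r, d := A r ?i]"
  have d: "d + 1 < 130" "30 \<le> d" using Rd.prems dep by auto
  have "reach w P (pc + length ?c, m1, out) (pc + length (comp_exp pc d (Rd r e)), m2, out)"
    apply (rule reach_block[where cs = "[Arith Op_Mod d d 3, Const (d + 1) 4, Arith Op_Mul d d (d + 1), Const (d + 1) (130 + r),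
      Arith Op_Add d d (d + 1), Load d d]"])
    using Rd.prems len d W i r4 arr m1(3) three
    by (auto simp: m2_def nth_list_update ac_simps intro!: nth_equalityI)
  with m1(1) have "reach w P (pc, m, out) (pc + length (comp_exp pc d (Rd r e)), m2, out)" by (rule reach_trans)
  moreover have "represents w l m2 v A" unfolding m2_def
    by (intro represents_stack m1(2)) (use d Aw W in auto)
  moreover have "m2 ! d = A r ?i" "\<forall>a<d. 30 \<le> a \<longrightarrow> m2 ! a = m ! a" using d len m1(4) by (auto simp: m2_def)
  ultimately show ?case by (intro exI[of _ m2]) simp
next
  case (It y x e0 eN eb)
  have dep: "d + depth e0 \<le> 130" "d + 1 + depth eN \<le> 130" "d + 4 + depth eb \<le> 130" "d + 6 \<le> 130"
    using It.prems(4) unfolding depth.simps by linarith+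
  let ?c0 = "comp_exp pc d e0" let ?p0 = "pc + length ?c0"
  let ?cN = "comp_exp ?p0 (d + 1) eN" let ?pN = "?p0 + length ?cN" let ?p1 = "?pN + 5"
  let ?cb = "comp_exp (?p1 + 2) (d + 4) eb" let ?pb = "?p1 + 2 + length ?cb" let ?p2 = "?pb + 6"
  let ?B1 = "[Const (d + 4) 0, Arith Op_Add (d + 2) y (d + 4), Arith Op_Add (d + 3) x (d + 4),
       Arith Op_Add y d (d + 4), Const x 0]"
  let ?B2 = "[Arith Op_Less (d + 4) x (d + 1)]"
  let ?B3 = "[Const (d + 5) 0, Arith Op_Add y (d + 4) (d + 5), Const (d + 5) 1, Arith Op_Add x x (d + 5),
       Const (d + 5) 0]"
  let ?B4 = "[Const (d + 4) 0, Arith Op_Add d y (d + 4), Arith Op_Add y (d + 2) (d + 4),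
       Arith Op_Add x (d + 3) (d + 4)]"
  have code: "code_at P pc ?c0" "code_at P ?p0 ?cN" "code_at P ?pN ?B1" "code_at P ?p1 ?B2"
    "?p1 + 1 < length P \<and> P ! (?p1 + 1) = JumpZ (d + 4) ?p2"
    "code_at P (?p1 + 2) ?cb" "code_at P ?pb ?B3" "?pb + 5 < length P \<and> P ! (?pb + 5) = JumpZ (d + 5) ?p1"
    "code_at P ?p2 ?B4"
    using code_at_loop[OF It.prems(7)[unfolded comp_exp.simps Let_def]] by simp_all
  have plen: "pc + length (comp_exp pc d (It y x e0 eN eb)) = ?p2 + 4"
    unfolding comp_exp.simps Let_def by (rule length_loop) simp_all
  have xy: "x \<noteq> y" "3 < x" "3 < y" "x < 30" "y < 30" using It.prems by auto
  have d: "30 \<le> d" "d + 6 \<le> 130" using It.prems dep by auto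
  from It.IH(1)[OF It.prems(1) _ _ _ _ _ code(1)] It.prems dep
  obtain m1 where m1: "reach w P (pc, m, out) (?p0, m1, out)" "represents w l m1 v A"
    "m1 ! d = eval w e0 v A" "\<forall>a<d. 30 \<le> a \<longrightarrow> m1 ! a = m ! a" by auto
  from It.IH(2)[OF m1(2) _ _ _ _ _ code(2)] It.prems dep
  obtain m2 where m2: "reach w P (?p0, m1, out) (?pN, m2, out)" "represents w l m2 v A"
    "m2 ! (d + 1) = eval w eN v A" "\<forall>a<d + 1. 30 \<le> a \<longrightarrow> m2 ! a = m1 ! a" by auto
  let ?N = "eval w eN v A"
  define acc where "acc j = fold (\<lambda>i a. eval w eb (v(y := a, x := i)) A) [0..<j] (eval w e0 v A)" for j
  have acc_Suc: "acc (Suc j) = eval w eb (v(y := acc j, x := j)) A" for j by (simp add: acc_def)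
  have len: "length m2 = 130 + 4 * l" "130 + 4 * l \<le> 2 ^ w" using m2(2) by (auto simp: represents_def)
  have words: "\<forall>a<length m2. m2 ! a < 2 ^ w" using m2(2) by (auto simp: represents_def)
  have NW: "?N < 2 ^ w" using words m2(3) d len by (metis add.commute add_lessD1 less_le_trans numeral_Bit0 trans_less_add1 le_add1 add_le_cancel_left m2(3) nat_add_left_cancel_less add_less_le_mono order_less_le_trans less_add_one add_mono_thms_linordered_field(1) linorder_not_le one_less_numeral_iff semiring_norm(76) not_add_less1)
  have vx: "m2 ! x = v x" "m2 ! y = v y" using m2(2) xy by (auto simp: represents_def)
  have vW: "v x < 2 ^ w" "v y < 2 ^ w" "m2 ! d < 2 ^ w" using words vx xy len d by (auto simp flip: vx)
  have md: "m2 ! d = acc 0" using m2(4) m1(3) d by (auto simp: acc_def)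
  \<comment> \<open>Invariant at the head of the loop: the cells of \<open>y\<close> and
    \<open>x\<close> hold accumulator and counter, while the bound and the former values of
    \<open>y\<close> and \<open>x\<close> wait in stack cells \<open>d + 1\<close> to
    \<open>d + 3\<close>.\<close>
  define I where "I j m' \<longleftrightarrow> represents w l m' (v(y := acc j, x := j)) A \<and> m' ! (d + 1) = ?N \<and>
     m' ! (d + 2) = v y \<and> m' ! (d + 3) = v x \<and> (\<forall>a<d. 30 \<le> a \<longrightarrow> m' ! a = m ! a)" for j m'
  define m3 where "m3 = m2[d + 4 := 0, d + 2 := v y, d + 3 := v x, y := acc 0, x := 0]"
  have r3: "reach w P (?pN, m2, out) (?p1, m3, out)"
    by (rule reach_block[OF _ code(3)]) (use len d xy vx vW md in \<open>auto simp: m3_def nth_list_update\<close>)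
  have I0: "I 0 m3"
  proof -
    have "represents w l m3 (v(y := acc 0, x := 0)) A"
      unfolding m3_def by (intro represents_var represents_stack m2(2)) (use d xy vW md in auto)
    then show ?thesis unfolding I_def using d xy len m1(4) m2(3,4) by (auto simp: m3_def nth_list_update)
  qed
  have It1: "\<exists>m''. reach w P (?p1, m', out) (?p1, m'', out) \<and> I (Suc j) m''" if "I j m'" "j < ?N" for j m'
  proof -
    let ?v = "v(y := acc j, x := j)"
    have rep: "represents w l m' ?v A" and m': "m' ! (d + 1) = ?N" "m' ! (d + 2) = v y" "m' ! (d + 3) = v x"
      "\<forall>a<d. 30 \<le> a \<longrightarrow> m' ! a = m ! a" using that by (auto simp: I_def)
    have len': "length m' = 130 + 4 * l" using rep by (auto simp: represents_def)
    have x': "m' ! x = j" using rep xy by (auto simp: represents_def)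
    let ?ma = "m'[d + 4 := 1]"
    have ra: "reach w P (?p1, m', out) (?p1 + 1, ?ma, out)"
      by (rule reach_block[OF _ code(4)]) (use len' d xy x' m' that in auto)
    have rb: "reach w P (?p1 + 1, ?ma, out) (?p1 + 2, ?ma, out)"
      by (rule reach_JumpZ[OF conjunct1[OF code(5)] conjunct2[OF code(5)]]) (use len' d in auto)
    have one: "1 < (2::nat) ^ w" using \<open>0 < w\<close> by (rule one_less_power[rotated]) simp
    have rep': "represents w l ?ma ?v A" by (rule represents_stack[OF rep]) (use d one in auto)
    have v3: "?v 3 = v 3" using xy by auto
    have ua: "uses_arr eb \<Longrightarrow> 0 < ?v 3 \<and> ?v 3 \<le> l" unfolding v3 using It.prems(6) by auto
    have wfb: "wf_exp eb" and d4: "30 \<le> d + 4" using It.prems d by auto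
    from It.IH(3)[OF rep' wfb d4 dep(3) \<open>0 < w\<close> ua code(6)]
    obtain mb where mb: "reach w P (?p1 + 2, ?ma, out) (?pb, mb, out)" "represents w l mb ?v A"
      "mb ! (d + 4) = eval w eb ?v A" "\<forall>a<d + 4. 30 \<le> a \<longrightarrow> mb ! a = ?ma ! a" by blast
    have mbl: "length mb = 130 + 4 * l" using mb(2) by (auto simp: represents_def)
    have mbx: "mb ! x = j" using mb(2) xy by (auto simp: represents_def)
    have "mb ! (d + 4) < 2 ^ w" using mb(2) d mbl by (auto simp: represents_def)
    then have aW: "acc (Suc j) < 2 ^ w" "mb ! (d + 4) = acc (Suc j)" using mb(3) by (auto simp: acc_Suc)
    have jW: "Suc j < 2 ^ w" using that NW by simp
    define mc where "mc = mb[d + 5 := 0, y := acc (Suc j), x := Suc j]"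
    have rc: "reach w P (?pb, mb, out) (?pb + 5, mc, out)"
      by (rule reach_block[OF _ code(7)])
        (use mbl d xy aW jW mbx one in \<open>auto simp: mc_def nth_list_update intro!: nth_equalityI\<close>)
    have rd: "reach w P (?pb + 5, mc, out) (?p1, mc, out)"
      by (rule reach_JumpZ[OF conjunct1[OF code(8)] conjunct2[OF code(8)]]) (use mbl d xy in \<open>auto simp: mc_def nth_list_update\<close>)
    have "represents w l mc (?v(y := acc (Suc j), x := Suc j)) A"
      unfolding mc_def by (intro represents_var represents_stack mb(2)) (use d xy aW jW in auto)
    moreover have "?v(y := acc (Suc j), x := Suc j) = v(y := acc (Suc j), x := Suc j)" using xy by auto
    ultimately have "I (Suc j) mc"
      unfolding I_def using mb(4) m' d xy mbl len' by (auto simp: mc_def nth_list_update)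
    with ra rb mb(1) rc rd show ?thesis by (meson reach_trans)
  qed
  have "\<exists>m'. reach w P (?p1, m3, out) (?p1, m', out) \<and> I j m'" if "j \<le> ?N" for j
    using that
  proof (induction j)
    case 0 then show ?case using I0 reach_refl by blast
  next
    case (Suc j) then show ?case using It1 by (meson Suc_le_eq less_imp_le reach_trans)
  qed
  from this[OF order_refl] obtain m4 where r4: "reach w P (?p1, m3, out) (?p1, m4, out)" and I4: "I ?N m4" by blast
  let ?v = "v(y := acc ?N, x := ?N)"
  have rep4: "represents w l m4 ?v A" and m4: "m4 ! (d + 1) = ?N" "m4 ! (d + 2) = v y" "m4 ! (d + 3) = v x"
      "\<forall>a<d. 30 \<le> a \<longrightarrow> m4 ! a = m ! a" using I4 by (auto simp: I_def)
  have len4: "length m4 = 130 + 4 * l" "\<forall>a<length m4. m4 ! a < 2 ^ w" using rep4 by (auto simp: represents_def)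
  have x4: "m4 ! x = ?N" "m4 ! y = acc ?N" using rep4 xy by (auto simp: represents_def)
  have aW: "acc ?N < 2 ^ w" unfolding x4(2)[symmetric] using len4 xy by auto
  let ?m5 = "m4[d + 4 := 0]"
  have r5: "reach w P (?p1, m4, out) (?p1 + 1, ?m5, out)"
    by (rule reach_block[OF _ code(4)]) (use len4 d xy x4 m4 in auto)
  have r6: "reach w P (?p1 + 1, ?m5, out) (?p2, ?m5, out)"
    by (rule reach_JumpZ[OF conjunct1[OF code(5)] conjunct2[OF code(5)]]) (use len4 d in auto)
  define m6 where "m6 = ?m5[d := acc ?N, y := v y, x := v x]"
  have r7: "reach w P (?p2, ?m5, out) (?p2 + 4, m6, out)"
    by (rule reach_block[OF _ code(9)]) (use len4 d xy x4 m4 vW aW in \<open>auto simp: m6_def nth_list_update\<close>)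
  have "represents w l m6 (?v(y := v y, x := v x)) A"
    unfolding m6_def by (intro represents_var represents_stack rep4) (use d xy vW aW in auto)
  moreover have "?v(y := v y, x := v x) = v" using xy by auto
  ultimately have rep6: "represents w l m6 v A" by simp
  have "m6 ! d = eval w (It y x e0 eN eb) v A" "\<forall>a<d. 30 \<le> a \<longrightarrow> m6 ! a = m ! a"
    using d xy len4 m4(4) by (auto simp: m6_def acc_def nth_list_update)
  moreover have "reach w P (pc, m, out) (?p2 + 4, m6, out)"
    using m1(1) m2(1) r3 r4 r5 r6 r7 by (meson reach_trans)
  ultimately show ?case unfolding plen using rep6 by blast
qed

text \<open>Induction follows the derivation rather than the command, because the loop case falls
  back on the same command.\<close>

lemma comp_com_correct:
  assumes "big_step w l c s s'" "represents w l m (fst s) (snd s)" "wf_com c" "0 < w" "code_at P pc (comp_com pc c)"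
  shows "\<exists>m'. reach w P (pc, m, out) (pc + length (comp_com pc c), m', out) \<and> represents w l m' (fst s') (snd s')"
  using assms
proof (induction arbitrary: m pc rule: big_step.induct)
  case (big_step_Asg e v x A)
  let ?c = "comp_exp pc 30 e"
  from comp_exp_correct[where d = 30 and e = e and pc = pc and m = m and v = v and A = A and w = w and l = l and P = P and out = out] big_step_Asg
  obtain m1 where m1: "reach w P (pc, m, out) (pc + length ?c, m1, out)" "represents w l m1 v A"
    "m1 ! 30 = eval w e v A" by auto
  have len: "length m1 = 130 + 4 * l" "\<forall>a<length m1. m1 ! a < 2 ^ w" using m1(2) by (auto simp: represents_def)
  have eW: "eval w e v A < 2 ^ w" unfolding m1(3)[symmetric] using len by auto
  have "reach w P (pc + length ?c, m1, out) (pc + length ?c + 2, m1[31 := 0, x := eval w e v A], out)"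
    by (rule reach_block[where cs = "[Const 31 0, Arith Op_Add x 30 31]"])
      (use big_step_Asg.prems m1(3) len eW in auto)
  moreover have "represents w l (m1[31 := 0, x := eval w e v A]) (v(x := eval w e v A)) A"
    by (intro represents_var represents_stack m1(2)) (use big_step_Asg.prems eW in auto)
  ultimately have "reach w P (pc, m, out) (pc + length ?c + 2, m1[31 := 0, x := eval w e v A], out) \<and>
    represents w l (m1[31 := 0, x := eval w e v A]) (v(x := eval w e v A)) A"
    using m1(1) by (blast intro: reach_trans)
  then show ?case by (intro exI[of _ "m1[31 := 0, x := eval w e v A]"]) (simp add: fun_upd_def)
next
  case (big_step_St v r ei ev A)
  let ?ci = "comp_exp pc 30 ei" let ?cv = "comp_exp (pc + length ?ci) 31 ev"
  from comp_exp_correct[where d = 30 and e = ei and pc = pc and m = m and v = v and A = A and w = w and l = l and P = P and out = out] big_step_St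
  obtain m1 where m1: "reach w P (pc, m, out) (pc + length ?ci, m1, out)" "represents w l m1 v A"
    "m1 ! 30 = eval w ei v A" by (auto simp: Let_def)
  from comp_exp_correct[where d = 31 and e = ev and pc = "pc + length ?ci" and m = m1 and v = v and A = A and w = w and l = l and P = P and out = out] big_step_St m1(2)
  obtain m2 where m2: "reach w P (pc + length ?ci, m1, out) (pc + length ?ci + length ?cv, m2, out)"
    "represents w l m2 v A" "m2 ! 31 = eval w ev v A" "m2 ! 30 = m1 ! 30" by (auto simp: Let_def)
  let ?i = "eval w ei v A mod v 3"
  have i: "?i < l" using big_step_St.hyps by (meson mod_less_divisor order_less_le_trans)
  have len: "length m2 = 130 + 4 * l" "130 + 4 * l \<le> 2 ^ w" "\<forall>a<length m2. m2 ! a < 2 ^ w" "m2 ! 3 = v 3"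
    using m2(2) by (auto simp: represents_def)
  have r4: "r < 4" using big_step_St.prems by auto
  have W: "?i * 4 + (130 + r) < 2 ^ w" "4 < (2::nat) ^ w" "130 + r < 2 ^ w" "?i * 4 < 2 ^ w" using i len r4 by linarith+
  have eW: "eval w ev v A < 2 ^ w" unfolding m2(3)[symmetric] using len by auto
  define m3 where "m3 = m2[32 := 130 + r, 30 := 130 + 4 * ?i + r]"
  have "reach w P (pc + length ?ci + length ?cv, m2, out)
      (pc + length (comp_com pc (St r ei ev)), m3[130 + 4 * ?i + r := eval w ev v A], out)"
    apply (rule reach_block[where cs = "[Arith Op_Mod 30 30 3, Const 32 4, Arith Op_Mul 30 30 32,
        Const 32 (130 + r), Arith Op_Add 30 30 32, Store 30 31]"])
    using big_step_St.prems len W i r4 m1(3) m2(3,4)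
    by (auto simp: m3_def nth_list_update list_update_swap ac_simps Let_def)
  moreover have "represents w l m3 v A" unfolding m3_def
    by (intro represents_stack m2(2)) (use W in \<open>auto simp: mult.commute\<close>)
  then have "represents w l (m3[130 + 4 * ?i + r := eval w ev v A]) v (A(r := (A r)(?i := eval w ev v A)))"
    by (rule represents_arr) (use r4 i eW in auto)
  ultimately have "reach w P (pc, m, out)
      (pc + length (comp_com pc (St r ei ev)), m3[130 + 4 * ?i + r := eval w ev v A], out) \<and>
    represents w l (m3[130 + 4 * ?i + r := eval w ev v A]) v (A(r := (A r)(?i := eval w ev v A)))"
    using m1(1) m2(1) by (blast intro: reach_trans)
  then show ?case by (intro exI[of _ "m3[130 + 4 * ?i + r := eval w ev v A]"]) (simp add: fun_upd_def)
next
  case (big_step_Sq c s s' d s'')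
  let ?cc = "comp_com pc c"
  from big_step_Sq.IH(1)[OF big_step_Sq.prems(1), of pc] big_step_Sq.prems obtain m1 where
    m1: "reach w P (pc, m, out) (pc + length ?cc, m1, out)" "represents w l m1 (fst s') (snd s')"
    by (auto simp: Let_def)
  from big_step_Sq.IH(2)[OF m1(2), of "pc + length ?cc"] big_step_Sq.prems obtain m2 where
    "reach w P (pc + length ?cc, m1, out) (pc + length ?cc + length (comp_com (pc + length ?cc) d), m2, out)"
    "represents w l m2 (fst s'') (snd s'')"
    by (auto simp: Let_def)
  with m1(1) show ?case by (auto simp: Let_def add.assoc intro: reach_trans)
next
  case (big_step_Wh0 e v A c)
  let ?c = "comp_exp pc 30 e"
  from comp_exp_correct[where d = 30 and e = e and pc = pc and m = m and v = v and A = A and w = w and l = l and P = P and out = out] big_step_Wh0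
  obtain m1 where m1: "reach w P (pc, m, out) (pc + length ?c, m1, out)" "represents w l m1 v A"
    "m1 ! 30 = eval w e v A" by (auto simp: Let_def)
  have "reach w P (pc + length ?c, m1, out) (pc + length (comp_com pc (Wh e c)), m1, out)"
    by (rule reach_JumpZ[where a = 30]) (use big_step_Wh0 m1 in \<open>auto simp: Let_def represents_def\<close>)
  with m1 show ?case by (auto intro: reach_trans)
next
  case (big_step_Wh e v A c s' s'')
  let ?c = "comp_exp pc 30 e"
  let ?p1 = "pc + length ?c + 1" let ?cc = "comp_com ?p1 c" let ?p2 = "?p1 + length ?cc"
  from comp_exp_correct[where d = 30 and e = e and pc = pc and m = m and v = v and A = A and w = w and l = l and P = P and out = out] big_step_Wh.hyps big_step_Wh.prems
  obtain m1 where m1: "reach w P (pc, m, out) (pc + length ?c, m1, out)" "represents w l m1 v A"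
    "m1 ! 30 = eval w e v A" by (auto simp: Let_def)
  have r2: "reach w P (pc + length ?c, m1, out) (?p1, m1, out)"
    by (rule reach_JumpZ[where a = 30]) (use big_step_Wh.hyps big_step_Wh.prems m1 in \<open>auto simp: Let_def represents_def\<close>)
  from big_step_Wh.IH(1)[of m1 ?p1] m1(2) big_step_Wh.prems obtain m2 where
    m2: "reach w P (?p1, m1, out) (?p2, m2, out)" "represents w l m2 (fst s') (snd s')"
    by (auto simp: Let_def)
  have len: "length m2 = 130 + 4 * l" using m2(2) by (auto simp: represents_def)
  \<comment> \<open>The machine has conditional jumps only; clearing cell 30 makes the jump back
    certain.\<close>
  have r3: "reach w P (?p2, m2, out) (?p2 + 1, m2[30 := 0], out)"
    by (rule reach_block[where cs = "[Const 30 0]"]) (use big_step_Wh.prems len in \<open>auto simp: Let_def\<close>)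
  have r4: "reach w P (?p2 + 1, m2[30 := 0], out) (pc, m2[30 := 0], out)"
    by (rule reach_JumpZ[where a = 30]) (use big_step_Wh.prems len in \<open>auto simp: Let_def algebra_simps\<close>)
  have "represents w l (m2[30 := 0]) (fst s') (snd s')" by (rule represents_stack[OF m2(2)]) auto
  from big_step_Wh.IH(2)[OF this big_step_Wh.prems(2,3,4)] obtain m3 where
    "reach w P (pc, m2[30 := 0], out) (pc + length (comp_com pc (Wh e c)), m3, out)"
    "represents w l m3 (fst s'') (snd s'')" by auto
  with m1(1) r2 m2(1) r3 r4 show ?case by (meson reach_trans)
qed

section \<open>Reasoning about programs\<close>

definition words :: "nat \<Rightarrow> vars \<Rightarrow> arrs \<Rightarrow> bool" where
  "words w v A \<longleftrightarrow> 0 < w \<and> (\<forall>x. v x < 2 ^ w) \<and> (\<forall>r i. A r i < 2 ^ w)"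

lemma eval_less:
  assumes "words w v A"
  shows "eval w e v A < 2 ^ w"
  using assms
proof (induction e arbitrary: v)
  case (Op f a b)
  then show ?case by (auto intro!: arith_val_less simp: words_def)
next
  case (It y x e0 eN eb)
  have "fold (\<lambda>i acc. eval w eb (v(y := acc, x := i)) A) [0..<j] (eval w e0 v A) < 2 ^ w"
    if "j \<le> eval w eN v A" for j
    using that
  proof (induction j)
    case (Suc j)
    have "j < 2 ^ w" using It.IH(2)[OF It.prems] Suc.prems by simp
    then show ?case using Suc It.prems by (auto intro!: It.IH(3) simp: words_def)
  qed (use It in simp)
  then show ?case by simp
qed (auto simp: words_def)

lemma big_step_words: "big_step w l c s s' \<Longrightarrow> words w (fst s) (snd s) \<Longrightarrow> words w (fst s') (snd s')"
proof (induction rule: big_step.induct)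
  case (big_step_Asg e v x A)
  then show ?case using eval_less[of w v A e] by (auto simp: words_def)
next
  case (big_step_St v r ei ev A)
  then show ?case using eval_less[of w v A ev] by (auto simp: words_def)
qed auto

fun fv :: "exp \<Rightarrow> nat set" where
  "fv (N c) = {}"
| "fv (X x) = {x}"
| "fv (Op f a b) = fv a \<union> fv b"
| "fv (Rd r e) = insert 3 (fv e)"
| "fv (It y x e0 eN eb) = fv e0 \<union> fv eN \<union> (fv eb - {x, y})"

fun arrays :: "exp \<Rightarrow> nat set" where
  "arrays (N c) = {}"
| "arrays (X x) = {}"
| "arrays (Op f a b) = arrays a \<union> arrays b"
| "arrays (Rd r e) = insert r (arrays e)"
| "arrays (It y x e0 eN eb) = arrays e0 \<union> arrays eN \<union> arrays eb"

lemma eval_cong: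
  assumes "\<And>x. x \<in> fv e \<Longrightarrow> v x = v' x" "\<And>r. r \<in> arrays e \<Longrightarrow> A r = A' r"
  shows "eval w e v A = eval w e v' A'"
  using assms
proof (induction e arbitrary: v v')
  case (Op f a b)
  have "eval w a v A = eval w a v' A'" "eval w b v A = eval w b v' A'"
    by (rule Op.IH; use Op.prems in auto)+
  then show ?case by simp
next
  case (Rd r e)
  have "eval w e v A = eval w e v' A'" by (rule Rd.IH; use Rd.prems in auto)
  then show ?case using Rd.prems by simp
next
  case (It y x e0 eN eb)
  have 0: "eval w e0 v A = eval w e0 v' A'" "eval w eN v A = eval w eN v' A'"
    by (rule It.IH(1) It.IH(2); use It.prems in auto)+
  have "eval w eb (v(y := a, x := i)) A = eval w eb (v'(y := a, x := i)) A'" for a i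
    by (rule It.IH(3)) (use It.prems in auto)
  with 0 show ?case by simp
qed auto

text \<open>Total correctness: a big-step derivation exists only for terminating runs, and the
  theorem claims that every run halts.\<close>

definition triple :: "nat \<Rightarrow> nat \<Rightarrow> (vars \<Rightarrow> arrs \<Rightarrow> bool) \<Rightarrow> com \<Rightarrow> (vars \<Rightarrow> arrs \<Rightarrow> bool) \<Rightarrow> bool" where
  "triple w l P c Q \<longleftrightarrow> (\<forall>v A. words w v A \<longrightarrow> P v A \<longrightarrow> (\<exists>v' A'. big_step w l c (v, A) (v', A') \<and> words w v' A' \<and> Q v' A'))"

lemma triple_Asg:
  assumes "\<And>v A. words w v A \<Longrightarrow> P v A \<Longrightarrow> (uses_arr e \<longrightarrow> 0 < v 3 \<and> v 3 \<le> l) \<and> Q (v(x := eval w e v A)) A"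
  shows "triple w l P (Asg x e) Q"
  unfolding triple_def
proof (intro allI impI)
  fix v A assume "words w v A" "P v A"
  with assms[of v A] have "big_step w l (Asg x e) (v, A) (v(x := eval w e v A), A)" "Q (v(x := eval w e v A)) A"
    by (auto intro: big_step_Asg)
  then show "\<exists>v' A'. big_step w l (Asg x e) (v, A) (v', A') \<and> words w v' A' \<and> Q v' A'"
    using big_step_words[of w l "Asg x e" "(v, A)"] \<open>words w v A\<close> by fastforce
qed

lemma triple_St:
  assumes "\<And>v A. words w v A \<Longrightarrow> P v A \<Longrightarrow> 0 < v 3 \<and> v 3 \<le> l \<and>
    Q v (A(r := (A r)(eval w ei v A mod v 3 := eval w ev v A)))"
  shows "triple w l P (St r ei ev) Q"
  unfolding triple_def
proof (intro allI impI)
  fix v A assume "words w v A" "P v A"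
  with assms[of v A] have "big_step w l (St r ei ev) (v, A) (v, A(r := (A r)(eval w ei v A mod v 3 := eval w ev v A)))"
    "Q v (A(r := (A r)(eval w ei v A mod v 3 := eval w ev v A)))"
    by (auto intro: big_step_St)
  then show "\<exists>v' A'. big_step w l (St r ei ev) (v, A) (v', A') \<and> words w v' A' \<and> Q v' A'"
    using big_step_words[of w l "St r ei ev" "(v, A)"] \<open>words w v A\<close> by fastforce
qed

lemma triple_Sq: "triple w l P c Q \<Longrightarrow> triple w l Q d R \<Longrightarrow> triple w l P (c ;; d) R"
  unfolding triple_def by (meson big_step_Sq)

lemma triple_conseq:
  "triple w l P c Q \<Longrightarrow> (\<And>v A. words w v A \<Longrightarrow> P' v A \<Longrightarrow> P v A) \<Longrightarrow>
   (\<And>v A. words w v A \<Longrightarrow> Q v A \<Longrightarrow> Q' v A) \<Longrightarrow> triple w l P' c Q'"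
  unfolding triple_def by metis

text \<open>The invariant is indexed by the number of completed rounds and the condition fails
  exactly at \<open>m\<close>, so \<open>m - j\<close> is the variant.\<close>

lemma triple_Wh:
  assumes body: "\<And>j. j < m \<Longrightarrow> triple w l (I j) c (I (Suc j))"
    and cond: "\<And>j v A. words w v A \<Longrightarrow> j \<le> m \<Longrightarrow> I j v A \<Longrightarrow> (uses_arr e \<longrightarrow> 0 < v 3 \<and> v 3 \<le> l) \<and> (eval w e v A = 0 \<longleftrightarrow> j = m)"
  shows "triple w l (I 0) (Wh e c) (I m)"
proof -
  have "\<exists>v' A'. big_step w l (Wh e c) (v, A) (v', A') \<and> words w v' A' \<and> I m v' A'"
    if "words w v A" "I j v A" "j \<le> m" for j v A
    using that(3,1,2)
  proof (induction j arbitrary: v A rule: inc_induct)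
    case base
    then show ?case using cond[of v A m] by (intro exI[of _ v] exI[of _ A]) (auto intro: big_step_Wh0)
  next
    case (step j)
    then obtain v1 A1 where 1: "big_step w l c (v, A) (v1, A1)" "words w v1 A1" "I (Suc j) v1 A1"
      using body[of j] unfolding triple_def by blast
    from step.IH[OF this(2,3)] obtain v' A' where "big_step w l (Wh e c) (v1, A1) (v', A')" "words w v' A'" "I m v' A'"
      by blast
    moreover have "big_step w l (Wh e c) (v, A) (v', A')"
      by (rule big_step_Wh[OF _ _ 1(1) calculation(1)]) (use cond[of v A j] step in auto)
    ultimately show ?case by blast
  qed
  then show ?thesis unfolding triple_def by blast
qed

definition For :: "nat \<Rightarrow> exp \<Rightarrow> com \<Rightarrow> com" where
  "For x e c = Asg x (N 0) ;; Wh (Op Op_Less (X x) e) (c ;; Asg x (Op Op_Add (X x) (N 1)))"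

lemma triple_For:
  assumes init: "\<And>v A. words w v A \<Longrightarrow> P v A \<Longrightarrow> I 0 (v(x := 0)) A"
    and bnd: "\<And>i v A. words w v A \<Longrightarrow> i \<le> b \<Longrightarrow> I i v A \<Longrightarrow> v x = i \<and> eval w e v A = b"
    and e: "\<not> uses_arr e"
    and b: "b < 2 ^ w"
    and body: "\<And>i. i < b \<Longrightarrow> triple w l (I i) c (\<lambda>v A. v x = i \<and> I (Suc i) (v(x := Suc i)) A)"
  shows "triple w l P (For x e c) (I b)"
  unfolding For_def
proof (rule triple_Sq)
  show "triple w l P (Asg x (N 0)) (I 0)" by (rule triple_Asg) (use init in auto)
  show "triple w l (I 0) (Wh (Op Op_Less (X x) e) (c ;; Asg x (Op Op_Add (X x) (N 1)))) (I b)"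
  proof (rule triple_Wh)
    fix j assume j: "j < b"
    show "triple w l (I j) (c ;; Asg x (Op Op_Add (X x) (N 1))) (I (Suc j))"
    proof (rule triple_Sq[OF body[OF j]], rule triple_Asg)
      fix v A assume "words w v A" and *: "v x = j \<and> I (Suc j) (v(x := Suc j)) A"
      then have "0 < w" by (simp add: words_def)
      then have "1 < (2::nat) ^ w" "w \<noteq> 0" using one_less_power[of "2::nat" w] by auto
      then show "(uses_arr (Op Op_Add (X x) (N 1)) \<longrightarrow> 0 < v 3 \<and> v 3 \<le> l) \<and>
        I (Suc j) (v(x := eval w (Op Op_Add (X x) (N 1)) v A)) A"
        using * j b by simp
    qed
  next
    fix j v A assume "words w v A" "j \<le> b" "I j v A"
    then show "(uses_arr (Op Op_Less (X x) e) \<longrightarrow> 0 < v 3 \<and> v 3 \<le> l) \<and>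
         (eval w (Op Op_Less (X x) e) v A = 0 \<longleftrightarrow> j = b)"
      using bnd[of v A j] e by auto
  qed
qed

subsection \<open>Derived expressions\<close>

text \<open>All sums share accumulator 26: an iteration binds its variables locally, so nested sums
  do not disturb each other.\<close>

definition SumE :: "nat \<Rightarrow> exp \<Rightarrow> exp \<Rightarrow> exp" where
  "SumE x eN eb = It 26 x (N 0) eN (Op Op_Add (X 26) eb)"

text \<open>One round of an iteration whose accumulator starts with the value of \<open>e\<close>;
  29 is a dummy counter.\<close>

definition LetE :: "nat \<Rightarrow> exp \<Rightarrow> exp \<Rightarrow> exp" where
  "LetE y e b = It y 29 e (N 1) b"

text \<open>Truth values are the words 0 and 1, so connectives and case distinctions become
  arithmetic.\<close>

definition NotE :: "exp \<Rightarrow> exp" where "NotE c = Op Op_Sub (N 1) c"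
definition LeE :: "exp \<Rightarrow> exp \<Rightarrow> exp" where "LeE a b = NotE (Op Op_Less b a)"
definition EqE :: "exp \<Rightarrow> exp \<Rightarrow> exp" where "EqE a b = Op Op_Sub (NotE (Op Op_Less a b)) (Op Op_Less b a)"
definition IteE :: "exp \<Rightarrow> exp \<Rightarrow> exp \<Rightarrow> exp" where
  "IteE c a b = Op Op_Add (Op Op_Mul c a) (Op Op_Mul (NotE c) b)"

lemmas exp_defs = SumE_def LetE_def NotE_def LeE_def EqE_def IteE_def

lemma eval_SumE:
  assumes "26 \<notin> fv eb" "x \<noteq> 26"
  shows "eval w (SumE x eN eb) v A = (\<Sum>i<eval w eN v A. eval w eb (v(x := i)) A) mod 2 ^ w"
proof -
  define f where "f i = eval w eb (v(x := i)) A" for i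
  have f: "eval w eb (v(26 := a, x := i)) A = f i" for a i
    unfolding f_def by (rule eval_cong) (use assms in auto)
  have X: "(v(26 := a, x := i)) 26 = a" for a i using assms by simp
  have "fold (\<lambda>i acc. (acc + f i) mod 2 ^ w) [0..<j] 0 = (\<Sum>i<j. f i) mod 2 ^ w" for j
    by (induction j) (simp_all add: mod_add_left_eq)
  then show ?thesis by (simp add: SumE_def f X del: fun_upd_apply flip: f_def)
qed

lemma eval_LetE:
  assumes "29 \<notin> fv b" "y \<noteq> 29" "0 < w"
  shows "eval w (LetE y e b) v A = eval w b (v(y := eval w e v A)) A"
proof -
  have "eval w b (v(y := a, 29 := 0)) A = eval w b (v(y := a)) A" for a
    by (rule eval_cong) (use assms in auto)
  moreover have "1 < (2::nat) ^ w" using assms(3) by (rule one_less_power[rotated]) simp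
  ultimately show ?thesis using assms(3) by (simp add: LetE_def)
qed

lemma eval_NotE: "0 < w \<Longrightarrow> eval w c v A \<le> 1 \<Longrightarrow> eval w (NotE c) v A = 1 - eval w c v A"
  using one_less_power[of "2::nat" w]
  by (cases "eval w c v A") (auto simp: NotE_def mod_add_right_eq mod_Suc)

lemma eval_LeE: "0 < w \<Longrightarrow> eval w (LeE a b) v A = (if eval w a v A \<le> eval w b v A then 1 else 0)"
  by (subst LeE_def, subst eval_NotE) auto

lemma eval_EqE:
  assumes "0 < w"
  shows "eval w (EqE a b) v A = (if eval w a v A = eval w b v A then 1 else 0)"
proof -
  have "1 < (2::nat) ^ w" using assms by (rule one_less_power[rotated]) simp
  moreover have "eval w (NotE (Op Op_Less a b)) v A = (if eval w a v A < eval w b v A then 0 else 1)"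
    by (subst eval_NotE) (use assms in auto)
  ultimately show ?thesis by (auto simp: EqE_def mod_Suc)
qed

lemma eval_IteE:
  assumes "words w v A" "eval w c v A = (if b then 1 else 0)"
  shows "eval w (IteE c x y) v A = (if b then eval w x v A else eval w y v A)"
proof -
  have w: "0 < w" using assms by (simp add: words_def)
  have "eval w (NotE c) v A = (if b then 0 else 1)" by (subst eval_NotE) (use assms w in auto)
  then show ?thesis using eval_less[OF assms(1), of x] eval_less[OF assms(1), of y] assms(2)
    by (simp add: IteE_def)
qed

lemma fv_SumE [simp]: "fv (SumE x a b) = fv a \<union> (fv b - {x, 26})" by (auto simp: SumE_def)
lemma fv_LetE [simp]: "fv (LetE y a b) = fv a \<union> (fv b - {29, y})" by (auto simp: LetE_def)
lemma fv_NotE [simp]: "fv (NotE a) = fv a" by (simp add: NotE_def)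
lemma fv_LeE [simp]: "fv (LeE a b) = fv a \<union> fv b" by (auto simp: LeE_def)
lemma fv_EqE [simp]: "fv (EqE a b) = fv a \<union> fv b" by (auto simp: EqE_def)
lemma fv_IteE [simp]: "fv (IteE c a b) = fv c \<union> fv a \<union> fv b" by (auto simp: IteE_def)

text \<open>Evaluation of ring expressions is correct modulo the word size; a result that is known to lie in
  the range of words is then exact.\<close>

definition evals_to :: "nat \<Rightarrow> exp \<Rightarrow> vars \<Rightarrow> arrs \<Rightarrow> int \<Rightarrow> bool" where
  "evals_to w e v A z \<longleftrightarrow> [int (eval w e v A) = z] (mod 2 ^ w)"

lemma evals_to_nat: "eval w e v A = z \<Longrightarrow> evals_to w e v A (int z)"
  by (simp add: evals_to_def)

lemma evals_to_exact:
  assumes "evals_to w e v A z" "words w v A" "0 \<le> z" "z < 2 ^ w"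
  shows "eval w e v A = nat z"
proof -
  have "int (eval w e v A) < 2 ^ w" using eval_less[OF assms(2), of e] by (metis of_nat_less_iff of_nat_numeral of_nat_power)
  then have "int (eval w e v A) = z" using assms by (simp add: evals_to_def cong_def)
  then show ?thesis by simp
qed

lemma int_mod_cong: "[int (a mod 2 ^ w) = int a] (mod 2 ^ w)"
  by (simp add: cong_def zmod_int)

lemma evals_to_Add: "evals_to w a v A x \<Longrightarrow> evals_to w b v A y \<Longrightarrow> evals_to w (Op Op_Add a b) v A (x + y)"
  unfolding evals_to_def by (simp only: eval.simps arith_val.simps)
    (rule cong_trans[OF int_mod_cong], simp add: cong_add)

lemma evals_to_Mul: "evals_to w a v A x \<Longrightarrow> evals_to w b v A y \<Longrightarrow> evals_to w (Op Op_Mul a b) v A (x * y)"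
  unfolding evals_to_def by (simp only: eval.simps arith_val.simps)
    (rule cong_trans[OF int_mod_cong], simp add: cong_mult)

lemma evals_to_Sub:
  assumes "words w v A" "evals_to w a v A x" "evals_to w b v A y"
  shows "evals_to w (Op Op_Sub a b) v A (x - y)"
proof -
  let ?a = "eval w a v A" let ?b = "eval w b v A"
  have "?b < 2 ^ w" by (rule eval_less[OF assms(1)])
  then have "int (?a + (2 ^ w - ?b)) = int ?a - int ?b + 2 ^ w" by (simp add: of_nat_diff)
  moreover have "[int ?a - int ?b + 2 ^ w = x - y] (mod 2 ^ w)"
    using cong_diff[OF assms(2,3)[unfolded evals_to_def]] by (simp add: cong_def)
  ultimately show ?thesis unfolding evals_to_def by (simp only: eval.simps arith_val.simps)
    (rule cong_trans[OF int_mod_cong], simp only:)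
qed

lemma evals_to_SumE:
  assumes "26 \<notin> fv eb" "x \<noteq> 26" "eval w eN v A = m" "\<And>i. i < m \<Longrightarrow> evals_to w eb (v(x := i)) A (f i)"
  shows "evals_to w (SumE x eN eb) v A (\<Sum>i<m. f i)"
  unfolding evals_to_def eval_SumE[OF assms(1,2)] assms(3)
proof (rule cong_trans[OF int_mod_cong])
  show "[int (\<Sum>i<m. eval w eb (v(x := i)) A) = (\<Sum>i<m. f i)] (mod 2 ^ w)"
    unfolding of_nat_sum by (rule cong_sum) (use assms(4) in \<open>auto simp: evals_to_def\<close>)
qed

lemma words_upd [simp]: "words w v A \<Longrightarrow> a < 2 ^ w \<Longrightarrow> words w (v(x := a)) A"
  by (auto simp: words_def)

section \<open>Exhaustive search\<close>

definition digit :: "nat \<Rightarrow> nat \<Rightarrow> nat \<Rightarrow> nat" where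
  "digit W c i = (c div W ^ i) mod W"

text \<open>Counting in base \<open>W\<close>: the carry reaches place \<open>i\<close> exactly when
  all lower places have become 0.\<close>

lemma digit_Suc:
  "W > 0 \<Longrightarrow> digit W (Suc c) i = (digit W c i + (if Suc c mod W ^ i = 0 then 1 else 0)) mod W"
  by (simp add: digit_def div_Suc mod_Suc_eq)

text \<open>The carry leaves place \<open>i\<close> exactly when it has reached that place and
  turned it into 0; \<open>search\<close> updates its carry by this rule.\<close>

lemma mod_power_Suc_eq_0: "(c::nat) mod W ^ Suc i = 0 \<longleftrightarrow> c mod W ^ i = 0 \<and> digit W c i = 0"
proof -
  have "c mod W ^ Suc i = W ^ i * (c div W ^ i mod W) + c mod W ^ i"
    using mod_mult2_eq[of c "W ^ i" W] by (simp add: mult.commute)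
  then show ?thesis by (auto simp: digit_def)
qed

lemma digit_power: "W > 0 \<Longrightarrow> i < n \<Longrightarrow> digit W (W ^ n) i = 0"
proof -
  assume "W > 0" "i < n"
  then have "W ^ n = W ^ i * (W * W ^ (n - Suc i))" by (metis add_Suc_right add_Suc_shift le_add_diff_inverse Suc_le_eq power_Suc power_add)
  then show ?thesis using \<open>W > 0\<close> by (simp add: digit_def)
qed

lemma exists_digits:
  assumes "\<And>i. i < n \<Longrightarrow> a i < W" "W > 0"
  shows "\<exists>c < W ^ n. \<forall>i<n. digit W c i = a i"
  using assms(1)
proof (induction n)
  case (Suc n)
  then obtain c where c: "c < W ^ n" "\<forall>i<n. digit W c i = a i" by auto
  have an: "a n < W" using Suc.prems by simp
  let ?c = "c + W ^ n * a n"
  have "?c < W ^ n + W ^ n * a n" using c by simp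
  also have "\<dots> = W ^ n * Suc (a n)" by simp
  also have "\<dots> \<le> W ^ n * W" using an by (intro mult_le_mono2) simp
  finally have "?c < W ^ Suc n" by (simp add: mult.commute)
  moreover have "digit W ?c i = a i" if "i < Suc n" for i
  proof (cases "i = n")
    case True
    then show ?thesis using c an assms(2) by (simp add: digit_def)
  next
    case False
    then have i: "i < n" using that by simp
    then have "W ^ n = W ^ i * (W * W ^ (n - Suc i))" by (metis add_Suc_right add_Suc_shift le_add_diff_inverse Suc_le_eq power_Suc power_add)
    then have e: "?c = c + W ^ i * (W * (W ^ (n - Suc i) * a n))" by (metis mult.assoc)
    show ?thesis unfolding e using c i assms(2) by (simp add: digit_def)
  qed
  ultimately show ?case by blast
qed simp

text \<open>Array 0 is a counter in base \<open>2 ^ w\<close> that runs through all vectors of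
  \<open>len\<close> words. Variable 13 is the least cost so far and starts with the largest word,
  so the first candidate is always taken; 15 is the current cost, 16 tells whether the candidate is
  copied to array \<open>D\<close> from index \<open>off\<close> on, and 17 is the carry. The search
  stops when the carry leaves the last place, which also resets array 0 to zero for the next
  search.\<close>

definition search :: "exp \<Rightarrow> exp \<Rightarrow> nat \<Rightarrow> exp \<Rightarrow> com" where
  "search len cost D off =
     Asg 13 (Op Op_Sub (N 0) (N 1)) ;; Asg 14 (N 1) ;;
     Wh (X 14) (
       Asg 15 cost ;; Asg 16 (LeE (X 15) (X 13)) ;; Asg 13 (IteE (X 16) (X 15) (X 13)) ;;
       For 18 len (St D (Op Op_Add off (X 18)) (IteE (X 16) (Rd 0 (X 18)) (Rd D (Op Op_Add off (X 18))))) ;;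
       Asg 17 (N 1) ;;
       For 18 len (St 0 (X 18) (Op Op_Add (Rd 0 (X 18)) (X 17)) ;;
                   Asg 17 (Op Op_Mul (X 17) (EqE (Rd 0 (X 18)) (N 0)))) ;;
       Asg 14 (Op Op_Sub (N 1) (X 17)))"

definition window :: "nat \<Rightarrow> nat \<Rightarrow> (nat \<Rightarrow> nat) \<Rightarrow> (nat \<Rightarrow> nat) \<Rightarrow> nat \<Rightarrow> nat" where
  "window off len b a i = (if off \<le> i \<and> i < off + len then b (i - off) else a i)"

abbreviation scratch :: "nat set" where "scratch \<equiv> {13, 14, 15, 16, 17, 18}"

text \<open>Invariant before candidate \<open>c\<close>: array 0 shows the digits of
  \<open>c\<close>, and array \<open>D\<close> holds a minimiser among the earlier candidates. Array
  \<open>D\<close> and the scratch variables change during the search, so the cost has to be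
  independent of them.\<close>

lemma search_correct:
  fixes v0 :: vars and A0 :: arrs and w l n m D :: nat
  defines "W \<equiv> (2::nat) ^ w"
  assumes words0: "words w v0 A0"
    and l: "v0 3 = l" "0 < l"
    and len: "eval w len v0 A0 = n" "fv len \<inter> scratch = {}" "arrays len = {}" "\<not> uses_arr len"
    and off: "eval w off v0 A0 = m" "fv off \<inter> scratch = {}" "arrays off = {}"
    and cost: "fv cost \<inter> scratch = {}" "D \<notin> arrays cost"
    and D: "D \<noteq> 0" and bnd: "m + n \<le> l"
    and zero: "\<And>i. i < n \<Longrightarrow> A0 0 i = 0"
  defines "F \<equiv> \<lambda>c. eval w cost v0 (A0(0 := window 0 n c (A0 0)))"
  shows "\<exists>v' A' b. big_step w l (search len cost D off) (v0, A0) (v', A') \<and> words w v' A' \<and>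
     (\<forall>x. x \<notin> scratch \<longrightarrow> v' x = v0 x) \<and> (\<forall>i<n. b i < W) \<and> A' = A0(D := window m n b (A0 D)) \<and>
     (\<forall>c. (\<forall>i<n. c i < W) \<longrightarrow> F b \<le> F c)"
proof -
  have w: "0 < w" using words0 by (simp add: words_def)
  have W: "1 < W" unfolding W_def using w by (rule one_less_power[rotated]) simp
  have W0: "0 < W" using W by simp
  have lW: "l < W" using words0 l by (auto simp: words_def W_def)
  define agr where "agr v \<longleftrightarrow> (\<forall>x. x \<notin> scratch \<longrightarrow> v x = v0 x)" for v :: vars
  have agr_fv: "v x = v0 x" if "agr v" "x \<in> fv e" "fv e \<inter> scratch = {}" for v x e
    using that unfolding agr_def by blast
  have agr3: "agr v \<Longrightarrow> v 3 = l" for v using l by (auto simp: agr_def)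
  have agr_len: "eval w len v A = n" if "agr v" for v A
    unfolding len(1)[symmetric] by (rule eval_cong) (simp_all add: agr_fv[OF that _ len(2)] len(3))
  have agr_off: "eval w off v A = m" if "agr v" for v A
    unfolding off(1)[symmetric] by (rule eval_cong) (simp_all add: agr_fv[OF that _ off(2)] off(3))
  have agr_cost: "eval w cost v A = eval w cost v0 A'" if a: "agr v" "\<And>r. r \<noteq> D \<Longrightarrow> A r = A' r" for v A A'
  proof (rule eval_cong)
    show "v x = v0 x" if "x \<in> fv cost" for x by (rule agr_fv[OF a(1) that cost(1)])
    show "A r = A' r" if "r \<in> arrays cost" for r by (rule a(2)) (use that cost(2) in auto)
  qed
  have agr_upd: "x \<in> scratch \<Longrightarrow> agr (v(x := a)) = agr v" for v x a
    unfolding agr_def by (metis fun_upd_other)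
  let ?dig = "\<lambda>c. digit W c"
  define cand where "cand c = window 0 n (?dig c) (A0 0)" for c
  \<comment> \<open>For \<open>c = 0\<close> nothing has been found yet and variable 13 holds the
    sentinel \<open>W - 1\<close>.\<close>
  define best where "best c v A \<longleftrightarrow>
     (if c = 0 then A D = A0 D \<and> v 13 = W - 1
      else \<exists>b<c. A D = window m n (?dig b) (A0 D) \<and> v 13 = F (?dig b) \<and> (\<forall>c'<c. F (?dig b) \<le> F (?dig c')))"
    for c and v :: vars and A :: arrs
  define base where "base v A \<longleftrightarrow> agr v \<and> (\<forall>r. r \<noteq> 0 \<longrightarrow> r \<noteq> D \<longrightarrow> A r = A0 r)" for v and A :: arrs
  define I where "I c v A \<longleftrightarrow> base v A \<and> A 0 = cand c \<and> best c v A \<and> v 14 = (if c = W ^ n then 0 else 1)" for c v A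
  have best_upd: "x \<noteq> 13 \<Longrightarrow> best c (v(x := a)) A = best c v A" for c v A x a by (simp add: best_def)
  have best_A: "A D = A' D \<Longrightarrow> best c v A = best c v A'" for c v A A' by (simp add: best_def)
  have costF: "base v A \<Longrightarrow> A 0 = cand c \<Longrightarrow> eval w cost v A = F (?dig c)" for v A c
    unfolding F_def by (rule agr_cost) (auto simp: base_def cand_def)
  have FW: "F c < W" if "\<And>i. i < n \<Longrightarrow> c i < W" for c
    unfolding F_def W_def by (rule eval_less) (use words0 that in \<open>auto simp: words_def window_def W_def\<close>)
  have dW: "?dig c i < W" for c i using W by (simp add: digit_def)
  have body: "triple w l (I c) (
       Asg 15 cost ;; Asg 16 (LeE (X 15) (X 13)) ;; Asg 13 (IteE (X 16) (X 15) (X 13)) ;;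
       For 18 len (St D (Op Op_Add off (X 18)) (IteE (X 16) (Rd 0 (X 18)) (Rd D (Op Op_Add off (X 18))))) ;;
       Asg 17 (N 1) ;;
       For 18 len (St 0 (X 18) (Op Op_Add (Rd 0 (X 18)) (X 17)) ;;
                   Asg 17 (Op Op_Mul (X 17) (EqE (Rd 0 (X 18)) (N 0)))) ;;
       Asg 14 (Op Op_Sub (N 1) (X 17))) (I (Suc c))" if c: "c < W ^ n" for c
  proof -
    define I1 where "I1 v A \<longleftrightarrow> base v A \<and> A 0 = cand c \<and> best c v A \<and> v 15 = F (?dig c)" for v A
    define I2 where "I2 v A \<longleftrightarrow> base v A \<and> A 0 = cand c \<and> best c v A \<and> v 15 = F (?dig c) \<and>
      v 16 = (if F (?dig c) \<le> v 13 then 1 else 0)" for v A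
    \<comment> \<open>The copy overwrites the earlier record, which is therefore remembered
      existentially as \<open>v1\<close> and \<open>A1\<close>.\<close>
    define I3 where "I3 i v A \<longleftrightarrow> base v A \<and> A 0 = cand c \<and> v 18 = i \<and>
      (\<exists>v1 A1. best c v1 A1 \<and> v 16 = (if F (?dig c) \<le> v1 13 then 1 else 0) \<and>
         v 13 = (if F (?dig c) \<le> v1 13 then F (?dig c) else v1 13) \<and>
         A D = (if F (?dig c) \<le> v1 13 then window m i (?dig c) (A1 D) else A1 D))" for i v A
    define I4 where "I4 v A \<longleftrightarrow> base v A \<and> A 0 = cand c \<and> best (Suc c) v A" for v A
    define I5 where "I5 v A \<longleftrightarrow> base v A \<and> A 0 = cand c \<and> best (Suc c) v A \<and> v 17 = 1" for v A
    define I6 where "I6 i v A \<longleftrightarrow> base v A \<and> best (Suc c) v A \<and> v 18 = i \<and>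
      A 0 = window 0 i (?dig (Suc c)) (cand c) \<and> v 17 = (if Suc c mod W ^ i = 0 then 1 else 0)" for i v A
    have 1: "triple w l (I c) (Asg 15 cost) I1"
      by (rule triple_Asg) (auto simp: I_def I1_def costF best_upd base_def agr_upd agr3 l)
    have 2: "triple w l I1 (Asg 16 (LeE (X 15) (X 13))) I2"
      by (rule triple_Asg) (use w in \<open>auto simp: I2_def I1_def best_upd base_def agr_upd agr3 l eval_LeE\<close>)
    have 3: "triple w l I2 (Asg 13 (IteE (X 16) (X 15) (X 13))) (\<lambda>v A. I3 0 (v(18 := 0)) A)"
    proof (rule triple_Asg, intro conjI)
      fix v A assume wv: "words w v A" and I2: "I2 v A"
      show "uses_arr (IteE (X 16) (X 15) (X 13)) \<longrightarrow> 0 < v 3 \<and> v 3 \<le> l"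
        using I2 l by (auto simp: I2_def base_def agr3)
      have "eval w (X 16) v A = (if F (?dig c) \<le> v 13 then 1 else 0)" using I2 by (simp add: I2_def)
      then have e: "eval w (IteE (X 16) (X 15) (X 13)) v A = (if F (?dig c) \<le> v 13 then v 15 else v 13)"
        using eval_IteE[OF wv] by simp
      have "window m 0 (?dig c) a = a" for a by (auto simp: window_def)
      then show "I3 0 ((v(13 := eval w (IteE (X 16) (X 15) (X 13)) v A))(18 := 0)) A"
        unfolding e using I2 by (auto simp: I3_def I2_def base_def agr_upd intro!: exI[of _ v] exI[of _ A])
    qed
    have 4: "triple w l (\<lambda>v A. I3 0 (v(18 := 0)) A) (For 18 len (St D (Op Op_Add off (X 18)) (IteE (X 16) (Rd 0 (X 18)) (Rd D (Op Op_Add off (X 18)))))) (I3 n)"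
    proof (rule triple_For)
      fix v A assume "I3 0 (v(18 := 0)) A" then show "I3 0 (v(18 := 0)) A" .
    next
      fix i v A assume "words w v A" "i \<le> n" "I3 i v A"
      then show "v 18 = i \<and> eval w len v A = n" by (auto simp: I3_def base_def agr_len)
    next
      fix i assume i: "i < n"
      show "triple w l (I3 i) (St D (Op Op_Add off (X 18)) (IteE (X 16) (Rd 0 (X 18)) (Rd D (Op Op_Add off (X 18)))))
             (\<lambda>v A. v 18 = i \<and> I3 (Suc i) (v(18 := Suc i)) A)"
      proof (rule triple_St)
        fix v A assume wv: "words w v A" and I3: "I3 i v A"
        then obtain v1 A1 where 1: "best c v1 A1" "v 16 = (if F (?dig c) \<le> v1 13 then 1 else 0)"
         "v 13 = (if F (?dig c) \<le> v1 13 then F (?dig c) else v1 13)"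
         "A D = (if F (?dig c) \<le> v1 13 then window m i (?dig c) (A1 D) else A1 D)" by (auto simp: I3_def)
        have v: "v 3 = l" "v 18 = i" "eval w off v A = m" "A 0 = cand c" using I3 by (auto simp: I3_def base_def agr3 agr_off)
        have ei: "eval w (Op Op_Add off (X 18)) v A = m + i" using v i bnd lW by (simp add: W_def)
        have il: "i < l" "m + i < l" using i bnd by auto
        have ev: "eval w (IteE (X 16) (Rd 0 (X 18)) (Rd D (Op Op_Add off (X 18)))) v A =
           (if F (?dig c) \<le> v1 13 then ?dig c i else A D (m + i))"
          unfolding eval_IteE[OF wv, of "X 16" "F (?dig c) \<le> v1 13", unfolded eval.simps(2), OF 1(2)]
          using v il i ei by (simp del: eval.simps(3) add: cand_def window_def)
        have "I3 (Suc i) (v(18 := Suc i)) (A(D := (A D)(m + i := if F (?dig c) \<le> v1 13 then ?dig c i else A D (m + i))))"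
        proof -
          have "(window m i (?dig c) (A1 D))(m + i := ?dig c i) = window m (Suc i) (?dig c) (A1 D)"
            by (auto simp: window_def fun_eq_iff)
          then show ?thesis using I3 1 D by (auto simp: I3_def base_def agr_upd intro!: exI[of _ v1] exI[of _ A1])
        qed
        then show "0 < v 3 \<and> v 3 \<le> l \<and> (v 18 = i \<and> I3 (Suc i) (v(18 := Suc i))
          (A(D := (A D)(eval w (Op Op_Add off (X 18)) v A mod v 3 :=
                 eval w (IteE (X 16) (Rd 0 (X 18)) (Rd D (Op Op_Add off (X 18)))) v A))))"
          unfolding ei ev using v il l by simp
      qed
    qed (use len(4) bnd lW in \<open>simp_all add: W_def\<close>)
    have I34: "I4 v A" if "I3 n v A" for v A
    proof -
      from that obtain v1 A1 where 1: "best c v1 A1" "v 13 = (if F (?dig c) \<le> v1 13 then F (?dig c) else v1 13)"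
         "A D = (if F (?dig c) \<le> v1 13 then window m n (?dig c) (A1 D) else A1 D)" by (auto simp: I3_def)
      have ww: "window m n (?dig c) (window m n b a) = window m n (?dig c) a" for b a
        by (auto simp: window_def fun_eq_iff)
      have "best (Suc c) v A"
      proof (cases "c = 0")
        case True
        \<comment> \<open>Costs are words, hence at most the sentinel.\<close>
        have "F (?dig c) \<le> v1 13" using 1(1) FW[of "?dig c"] dW True by (auto simp: best_def)
        then show ?thesis using 1 True by (auto simp: best_def)
      next
        case False
        then obtain b where b: "b < c" "A1 D = window m n (?dig b) (A0 D)" "v1 13 = F (?dig b)"
          "\<forall>c'<c. F (?dig b) \<le> F (?dig c')" using 1(1) by (auto simp: best_def)
        show ?thesis
        proof (cases "F (?dig c) \<le> v1 13")
          case True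
          then have "F (?dig c) \<le> F (?dig c')" if "c' < Suc c" for c'
            using b that by (cases "c' = c") (auto intro: order_trans)
          then show ?thesis using 1 b True by (auto simp: best_def ww intro!: exI[of _ c])
        next
          case Fa: False
          then have "F (?dig b) \<le> F (?dig c')" if "c' < Suc c" for c'
            using b that by (cases "c' = c") auto
          then show ?thesis using 1 b Fa by (auto simp: best_def intro!: exI[of _ b])
        qed
      qed
      then show ?thesis using that by (auto simp: I3_def I4_def)
    qed
    have 5: "triple w l (I3 n) (Asg 17 (N 1)) I5"
    proof (rule triple_Asg)
      fix v A assume "words w v A" "I3 n v A"
      from I34[OF this(2)] show "(uses_arr (N 1) \<longrightarrow> 0 < v 3 \<and> v 3 \<le> l) \<and> I5 (v(17 := eval w (N 1) v A)) A"
        using W w by (auto simp: I4_def I5_def base_def agr_upd best_upd W_def)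
    qed
    have 6: "triple w l I5 (For 18 len (St 0 (X 18) (Op Op_Add (Rd 0 (X 18)) (X 17)) ;;
                   Asg 17 (Op Op_Mul (X 17) (EqE (Rd 0 (X 18)) (N 0))))) (I6 n)"
    proof (rule triple_For)
      fix v A assume "words w v A" "I5 v A"
      moreover have "window 0 0 b a = a" for a b by (auto simp: window_def fun_eq_iff)
      ultimately show "I6 0 (v(18 := 0)) A" by (auto simp: I5_def I6_def base_def agr_upd best_upd)
    next
      fix i v A assume "words w v A" "i \<le> n" "I6 i v A"
      then show "v 18 = i \<and> eval w len v A = n" by (auto simp: I6_def base_def agr_len)
    next
      fix i assume i: "i < n"
      define J where "J v A \<longleftrightarrow> base v A \<and> best (Suc c) v A \<and> v 18 = i \<and>
        A 0 = window 0 (Suc i) (?dig (Suc c)) (cand c) \<and> v 17 = (if Suc c mod W ^ i = 0 then 1 else 0)" for v A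
      have il: "i < l" using i bnd by simp
      show "triple w l (I6 i) (St 0 (X 18) (Op Op_Add (Rd 0 (X 18)) (X 17)) ;;
                   Asg 17 (Op Op_Mul (X 17) (EqE (Rd 0 (X 18)) (N 0)))) (\<lambda>v A. v 18 = i \<and> I6 (Suc i) (v(18 := Suc i)) A)"
      proof (rule triple_Sq)
        show "triple w l (I6 i) (St 0 (X 18) (Op Op_Add (Rd 0 (X 18)) (X 17))) J"
        proof (rule triple_St)
          fix v A assume wv: "words w v A" and I6: "I6 i v A"
          then have v: "v 3 = l" "v 18 = i" by (auto simp: I6_def base_def agr3)
          have "A 0 i = ?dig c i" using I6 i by (auto simp: I6_def window_def cand_def)
          then have e: "eval w (Op Op_Add (Rd 0 (X 18)) (X 17)) v A = ?dig (Suc c) i"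
            using v il I6 W by (simp add: I6_def digit_Suc W_def)
          have "(window 0 i (?dig (Suc c)) (cand c))(i := ?dig (Suc c) i) = window 0 (Suc i) (?dig (Suc c)) (cand c)"
            by (auto simp: window_def fun_eq_iff)
          then show "0 < v 3 \<and> v 3 \<le> l \<and> J v (A(0 := (A 0)(eval w (X 18) v A mod v 3 := eval w (Op Op_Add (Rd 0 (X 18)) (X 17)) v A)))"
            unfolding e using I6 v il l D best_A[of "A(0 := z)" A "Suc c" v for z] by (simp add: I6_def J_def base_def)
        qed
        show "triple w l J (Asg 17 (Op Op_Mul (X 17) (EqE (Rd 0 (X 18)) (N 0)))) (\<lambda>v A. v 18 = i \<and> I6 (Suc i) (v(18 := Suc i)) A)"
        proof (rule triple_Asg)
          fix v A assume wv: "words w v A" and J: "J v A"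
          then have v: "v 3 = l" "v 18 = i" by (auto simp: J_def base_def agr3)
          have "A 0 i = ?dig (Suc c) i" using J i by (auto simp: J_def window_def)
          then have "eval w (EqE (Rd 0 (X 18)) (N 0)) v A = (if ?dig (Suc c) i = 0 then 1 else 0)"
            using v il w by (simp add: eval_EqE)
          then have "eval w (Op Op_Mul (X 17) (EqE (Rd 0 (X 18)) (N 0))) v A = (if Suc c mod W ^ Suc i = 0 then 1 else 0)"
            using J W unfolding mod_power_Suc_eq_0 by (auto simp: J_def W_def)
          then show "(uses_arr (Op Op_Mul (X 17) (EqE (Rd 0 (X 18)) (N 0))) \<longrightarrow> 0 < v 3 \<and> v 3 \<le> l) \<and>
           ((v(17 := eval w (Op Op_Mul (X 17) (EqE (Rd 0 (X 18)) (N 0))) v A)) 18 = i \<and>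
           I6 (Suc i) ((v(17 := eval w (Op Op_Mul (X 17) (EqE (Rd 0 (X 18)) (N 0))) v A))(18 := Suc i)) A)"
            using J v l by (simp add: I6_def J_def base_def agr_upd best_upd del: eval.simps)
        qed
      qed
    qed (use len(4) bnd lW in \<open>simp_all add: W_def\<close>)
    have 7: "triple w l (I6 n) (Asg 14 (Op Op_Sub (N 1) (X 17))) (I (Suc c))"
    proof (rule triple_Asg)
      fix v A assume wv: "words w v A" and I6: "I6 n v A"
      have "Suc c mod W ^ n = 0 \<longleftrightarrow> Suc c = W ^ n" using c by (cases "Suc c = W ^ n") auto
      then have e: "eval w (Op Op_Sub (N 1) (X 17)) v A = (if Suc c = W ^ n then 0 else 1)"
        using I6 W by (auto simp: I6_def W_def)
      have "window 0 n (?dig (Suc c)) (cand c) = cand (Suc c)" by (auto simp: window_def cand_def fun_eq_iff)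
      then show "(uses_arr (Op Op_Sub (N 1) (X 17)) \<longrightarrow> 0 < v 3 \<and> v 3 \<le> l) \<and>
         I (Suc c) (v(14 := eval w (Op Op_Sub (N 1) (X 17)) v A)) A"
        unfolding e using I6 by (simp add: I6_def I_def base_def agr_upd best_upd)
    qed
    show ?thesis by (rule triple_Sq[OF 1] triple_Sq[OF 2] triple_Sq[OF 3] triple_Sq[OF 4] triple_Sq[OF 5] triple_Sq[OF 6] 7)+
  qed
  have Wn: "0 < W ^ n" using W by simp
  have "triple w l (\<lambda>v A. v = v0 \<and> A = A0) (search len cost D off) (I (W ^ n))"
    unfolding search_def
  proof (rule triple_Sq[OF _ triple_Sq[OF _ triple_Wh]])
    show "triple w l (\<lambda>v A. v = v0 \<and> A = A0) (Asg 13 (Op Op_Sub (N 0) (N 1))) (\<lambda>v A. base v A \<and> A = A0 \<and> v 13 = W - 1)"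
      by (rule triple_Asg) (use W in \<open>auto simp: base_def agr_def W_def\<close>)
    have "cand 0 = A0 0" using zero by (auto simp: cand_def window_def digit_def fun_eq_iff)
    then show "triple w l (\<lambda>v A. base v A \<and> A = A0 \<and> v 13 = W - 1) (Asg 14 (N 1)) (I 0)"
      by (intro triple_Asg) (use W Wn w in \<open>auto simp: I_def base_def agr_upd best_def W_def\<close>)
  next
    fix j v A assume "I j v A"
    then show "(uses_arr (X 14) \<longrightarrow> 0 < v 3 \<and> v 3 \<le> l) \<and> (eval w (X 14) v A = 0 \<longleftrightarrow> j = W ^ n)"
      by (simp add: I_def)
  qed (rule body)
  then obtain v' A' where r: "big_step w l (search len cost D off) (v0, A0) (v', A')" "words w v' A'" "I (W ^ n) v' A'"
    using words0 unfolding triple_def by blast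
  from r(3) Wn obtain b where b: "A' D = window m n (?dig b) (A0 D)" "\<forall>c'<W ^ n. F (?dig b) \<le> F (?dig c')"
    unfolding I_def best_def by (auto split: if_splits)
  \<comment> \<open>The digits of \<open>W ^ n\<close> below place \<open>n\<close> vanish: the
    counter is back at its initial zeros.\<close>
  have "cand (W ^ n) = A0 0" using zero by (auto simp: cand_def window_def digit_power[OF W0] fun_eq_iff)
  then have "A' = A0(D := window m n (?dig b) (A0 D))"
  proof (intro ext)
    fix r i show "A' r i = (A0(D := window m n (?dig b) (A0 D))) r i"
      using r(3) b(1) \<open>cand (W ^ n) = A0 0\<close> D unfolding I_def base_def by (cases "r = D"; cases "r = 0") simp_all
  qed
  moreover have "F (?dig b) \<le> F c" if cW: "\<forall>i<n. c i < W" for c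
  proof -
    obtain c' where c': "c' < W ^ n" "\<forall>i<n. ?dig c' i = c i" using exists_digits[of n c W] cW W0 by blast
    then have "window 0 n (?dig c') (A0 0) = window 0 n c (A0 0)" by (auto simp: window_def fun_eq_iff)
    then have "F (?dig c') = F c" by (simp add: F_def)
    then show ?thesis using b(2) c'(1) by auto
  qed
  ultimately show ?thesis using r dW
    by (intro exI[of _ v'] exI[of _ A'] exI[of _ "?dig b"]) (auto simp: I_def base_def agr_def)
qed

section \<open>The streaming algorithm\<close>

definition pow_mod :: "exp \<Rightarrow> exp \<Rightarrow> exp" where
  "pow_mod b r = It 25 24 (N 1) r (Op Op_Mod (Op Op_Mul (X 25) b) (X 7))"

text \<open>A candidate for a sparse column is a list of words \<open>c\<close>, each of which stands for the entry
  \<open>c div n mod p\<close> at position \<open>c mod n\<close>.\<close>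

definition syndrome_cost :: exp where
  "syndrome_cost = SumE 27 (X 11) (NotE (EqE
     (Op Op_Mod (SumE 21 (X 8) (Op Op_Mod (Op Op_Mul
        (Op Op_Mod (Op Op_Div (Rd 0 (X 21)) (X 4)) (X 7))
        (pow_mod (Op Op_Mod (Rd 0 (X 21)) (X 4)) (X 27))) (X 7))) (X 7))
     (Rd 1 (Op Op_Add (Op Op_Mul (X 12) (X 11)) (X 27)))))"

text \<open>Several of the \<open>t\<close> words may name the same position, and then their values
  are added; so every candidate describes a column with at most \<open>t\<close> nonzero
  entries.\<close>

definition residue_exp :: "nat \<Rightarrow> nat \<Rightarrow> exp" where
  "residue_exp b j = (let Z = Rd 2 (Op Op_Add (Op Op_Mul (X j) (X 8)) (X 21)) in
     Op Op_Mod (SumE 21 (X 8)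
       (IteE (EqE (Op Op_Mod Z (X 4)) (X b)) (Op Op_Mod (Op Op_Div Z (X 4)) (X 7)) (N 0))) (X 7))"

text \<open>Variable 28 is the residue of an entry, and 19 the smaller of this residue and its
  negative modulo \<open>p\<close>; the final sum is \<open>log_int\<close>.\<close>

definition log_exp :: "nat \<Rightarrow> nat \<Rightarrow> exp" where
  "log_exp b j = LetE 28 (residue_exp b j)
     (LetE 19 (IteE (Op Op_Less (X 28) (Op Op_Sub (X 7) (X 28))) (X 28) (Op Op_Sub (X 7) (X 28)))
       (SumE 24 (Op Op_Mul (X 6) (X 19)) (Op Op_Div (X 10) (Op Op_Add (X 6) (X 24)))))"

text \<open>Every word is read as an integer between \<open>- q\<close> and \<open>q\<close>,
  represented modulo \<open>2 ^ w\<close>; thus a search over all words is a search over all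
  admissible numerators.\<close>

definition entry_exp :: "nat \<Rightarrow> nat \<Rightarrow> exp" where
  "entry_exp i a = Op Op_Sub
     (Op Op_Mod (Rd 0 (Op Op_Add (Op Op_Mul (X i) (X 5)) (X a))) (Op Op_Add (Op Op_Add (X 9) (X 9)) (N 1))) (X 9)"

text \<open>\<open>y\<close> takes the variable that holds the row, as it is read at the summation
  index 23 and at the outer row 20.\<close>

definition defect_exp :: "(nat \<Rightarrow> exp) \<Rightarrow> exp" where
  "defect_exp y = Op Op_Sub
     (SumE 25 (X 5) (Op Op_Mul (entry_exp 20 25) (SumE 23 (X 4) (Op Op_Mul (entry_exp 23 25) (y 23)))))
     (Op Op_Mul (Op Op_Mul (X 9) (X 9)) (y 20))"

definition square_exp :: "exp \<Rightarrow> exp" where "square_exp e = Op Op_Mul e e"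

definition proj_cost_exp :: exp where
  "proj_cost_exp = Op Op_Add
     (SumE 20 (X 4) (SumE 22 (X 4) (square_exp (defect_exp (\<lambda>b. log_exp b 22)))))
     (SumE 20 (X 4) (SumE 22 (X 5) (square_exp (defect_exp (\<lambda>b. entry_exp b 22)))))"

text \<open>Variables 4 to 11 receive \<open>n\<close>, \<open>k\<close>, \<open>R\<close>,
  \<open>p\<close>, \<open>t\<close>, \<open>q\<close>, \<open>Q\<close> and \<open>2 t\<close>, and
  variable 3 the array length. The word length is not passed to the program: it is found by counting
  the exponents \<open>i\<close> for which \<open>2 ^ i\<close> does not vanish modulo
  \<open>2 ^ w\<close>. The search for a prime moves up from \<open>2 R + 1\<close> and stands still
  once it meets one.\<close>

definition init_com :: com where
  "init_com =
     Asg 4 (X 0) ;; Asg 5 (X 1) ;;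
     Asg 12 (SumE 20 (Op Op_Sub (N 0) (N 1)) (LeE (N 1) (It 25 24 (N 1) (X 20) (Op Op_Add (X 25) (X 25))))) ;;
     Asg 6 (It 25 24 (N 1) (Op Op_Div (X 12) (N 80)) (Op Op_Add (X 25) (X 25))) ;;
     Asg 8 (Op Op_Mul (Op Op_Mul (X 5) (Op Op_Mul (X 2) (X 2))) (Op Op_Mul (X 12) (Op Op_Mul (X 12) (X 12)))) ;;
     Asg 9 (It 25 24 (N 1) (N 11) (Op Op_Mul (X 25) (X 6))) ;;
     Asg 10 (It 25 24 (N 1) (N 6) (Op Op_Mul (X 25) (X 6))) ;;
     Asg 11 (Op Op_Add (X 8) (X 8)) ;;
     Asg 7 (It 25 24 (Op Op_Add (Op Op_Add (X 6) (X 6)) (N 1)) (Op Op_Mul (X 6) (Op Op_Mul (X 6) (X 6)))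
       (IteE (EqE (SumE 20 (X 25) (Op Op_Mul (LeE (N 2) (X 20)) (EqE (Op Op_Mod (X 25) (X 20)) (N 0)))) (N 0))
         (X 25) (Op Op_Add (X 25) (N 1)))) ;;
     Asg 3 (Op Op_Mul (X 4) (X 11))"

text \<open>Variables 0, 1 and 2 hold row, column and increment. Adding \<Delta> in row
  \<open>i\<close> changes the \<open>r\<close>-th power sum of the column by
  \<open>\<Delta> * i ^ r\<close>. After that all columns are decoded from array 1 into array 2, and
  array 3 receives the new output.\<close>

definition update_com :: com where
  "update_com =
     For 18 (X 11) (St 1 (Op Op_Add (Op Op_Mul (X 1) (X 11)) (X 18))
       (Op Op_Mod (Op Op_Add (Rd 1 (Op Op_Add (Op Op_Mul (X 1) (X 11)) (X 18)))
          (Op Op_Mul (IteE (EqE (X 2) (N 1)) (N 1) (Op Op_Sub (X 7) (N 1))) (pow_mod (X 0) (X 18)))) (X 7))) ;;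
     For 12 (X 4) (search (X 8) syndrome_cost 2 (Op Op_Mul (X 12) (X 8))) ;;
     search (Op Op_Mul (X 4) (X 5)) proj_cost_exp 3 (N 0)"

lemma wf_init: "wf_com init_com"
  by (simp add: init_com_def exp_defs)

lemma wf_update: "wf_com update_com"
  by (simp add: update_com_def search_def For_def syndrome_cost_def proj_cost_exp_def square_exp_def
      defect_exp_def log_exp_def entry_exp_def residue_exp_def pow_mod_def Let_def exp_defs)

section \<open>Exactness of the machine arithmetic\<close>

locale sketch =
  fixes w n k E R p t :: nat
  assumes R_power: "R ^ 80 = 2 ^ w" and w_pos: "0 < w" and R_ge: "16 \<le> R"
    and n_le: "n \<le> R" and k_pos: "1 \<le> k" and k_le: "k \<le> n"
    and t_le: "t \<le> R ^ 6" and k_le_t: "k \<le> t"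
    and p_prime: "prime p" and p_gt: "2 * R < p" and p_le: "p \<le> R ^ 3"
begin

abbreviation "W \<equiv> (2::nat) ^ w"
abbreviation "q \<equiv> R ^ 11"
abbreviation "Q \<equiv> R ^ 6"
abbreviation "len \<equiv> n * (2 * t)"

text \<open>All sizes are bounded by powers of \<open>R\<close>, so the absence of overflow becomes
  a comparison of an exponent with 80.\<close>

lemma word_bound: "x \<le> R ^ a \<Longrightarrow> a < 80 \<Longrightarrow> x < W"
  unfolding R_power[symmetric] using power_strict_increasing[of a 80 R] R_ge by linarith

lemma pos: "0 < n" "0 < t" "0 < p" "0 < R" "1 < W" "1 < p" "0 < len"
  using k_pos k_le k_le_t R_ge p_gt one_less_power[OF _ w_pos, of "2::nat"] by auto

lemma two_t_W: "2 * t < W" and t_p_W: "t * p < W"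
proof -
  have "2 * t \<le> len" using pos by simp
  also have "\<dots> \<le> R * (R * R ^ 6)" using n_le t_le R_ge by (intro mult_le_mono) auto
  also have "\<dots> = R ^ 8" by (simp add: power_numeral_reduce)
  finally show "2 * t < W" by (rule word_bound) simp
  have "t * p \<le> R ^ 6 * R ^ 3" using t_le p_le by (intro mult_le_mono)
  also have "\<dots> = R ^ 9" by (simp add: power_numeral_reduce)
  finally show "t * p < W" by (rule word_bound) simp
qed

lemma nk_le_len: "n * k \<le> len" using k_le_t by (intro mult_le_mono) auto

definition params :: "vars \<Rightarrow> bool" where
  "params v \<longleftrightarrow> v 3 = len \<and> v 4 = n \<and> v 5 = k \<and> v 6 = R \<and> v 7 = p \<and> v 8 = t \<and> v 9 = q \<and> v 10 = Q \<and> v 11 = 2 * t"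

lemma params_upd [simp]: "11 < x \<Longrightarrow> params (v(x := a)) = params v"
  by (simp add: params_def)

lemma len_W: "len < W"
proof -
  have "len \<le> R * (R * R ^ 6)" using n_le t_le R_ge by (intro mult_le_mono) auto
  also have "\<dots> = R ^ 8" by (simp add: power_numeral_reduce)
  finally show ?thesis by (rule word_bound) simp
qed

lemma eval_sum_nat:
  assumes "26 \<notin> fv eb" "x \<noteq> 26" "eval w eN v A = m" "\<And>i. i < m \<Longrightarrow> eval w eb (v(x := i)) A = f i"
    "(\<Sum>i<m. f i) < W"
  shows "eval w (SumE x eN eb) v A = (\<Sum>i<m. f i)"
  unfolding eval_SumE[OF assms(1,2)] assms(3) using assms(4,5) by simp

lemma eval_pow_mod:
  assumes "params v" "{24, 25} \<inter> fv b = {}" "eval w b v A \<le> R"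
  shows "eval w (pow_mod b r) v A = eval w b v A ^ eval w r v A mod p"
proof -
  let ?b = "eval w b v A"
  have b: "eval w b (v(25 := a, 24 := i)) A = ?b" for a i by (rule eval_cong) (use assms in auto)
  have "fold (\<lambda>i acc. (acc * ?b) mod W mod p) [0..<j] 1 = ?b ^ j mod p" for j
  proof (induction j)
    case (Suc j)
    have "?b ^ j mod p < p" using pos by simp
    then have "?b ^ j mod p * ?b \<le> R ^ 3 * R" using assms(3) p_le by (intro mult_le_mono) auto
    then have "?b ^ j mod p * ?b < W" by (intro word_bound[of _ 4]) (simp_all add: power_numeral_reduce)
    then show ?case using Suc mod_mult_left_eq[of "?b ^ j" p ?b] by (simp add: mult.commute)
  qed (use pos in simp)
  then show ?thesis using assms(1) pos w_pos by (simp add: pow_mod_def b params_def del: fun_upd_apply) (simp add: params_def)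
qed

definition pos_of :: "nat \<Rightarrow> nat" where "pos_of c = c mod n"
definition val_of :: "nat \<Rightarrow> nat" where "val_of c = (c div n) mod p"

lemma pos_of_less: "pos_of c < n" using pos by (simp add: pos_of_def)
lemma val_of_less: "val_of c < p" using pos by (simp add: val_of_def)

definition syn :: "(nat \<Rightarrow> nat) \<Rightarrow> nat \<Rightarrow> nat" where
  "syn c r = (\<Sum>l<t. val_of (c l) * pos_of (c l) ^ r) mod p"

text \<open>Taken as a cost to be minimised, so that columns with too many nonzero entries need no
  special treatment: whatever minimiser is found is accepted.\<close>

definition mismatches :: "(nat \<Rightarrow> nat) \<Rightarrow> (nat \<Rightarrow> nat) \<Rightarrow> nat" where
  "mismatches S c = (\<Sum>r<2 * t. if syn c r = S r then 0 else 1)"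

lemma eval_syndrome_cost:
  assumes "words w v A" "params v" "v 12 = j" "j < n"
  shows "eval w syndrome_cost v A = mismatches (\<lambda>r. A 1 (j * (2 * t) + r)) (A 0)"
  unfolding syndrome_cost_def mismatches_def
proof (rule eval_sum_nat)
  show "eval w (X 11) v A = 2 * t" using assms by (simp add: params_def)
  have "(\<Sum>r<2 * t. if syn (A 0) r = A 1 (j * (2 * t) + r) then 0 else 1) \<le> (\<Sum>r<2 * t. 1::nat)"
    by (intro sum_mono) auto
  also have "\<dots> \<le> len" using pos by simp
  also have "\<dots> < W" by (rule len_W)
  finally show "(\<Sum>r<2 * t. if syn (A 0) r = A 1 (j * (2 * t) + r) then 0 else 1) < W" .
next
  fix r assume r: "r < 2 * t"
  let ?v = "v(27 := r)"
  have wv: "words w ?v A" and pv: "params ?v" using assms r two_t_W by auto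
  let ?P = "Op Op_Mod (Rd 0 (X 21)) (X 4)"
  have tm: "eval w (Op Op_Mod (Op Op_Mul (Op Op_Mod (Op Op_Div (Rd 0 (X 21)) (X 4)) (X 7)) (pow_mod ?P (X 27))) (X 7)) (?v(21 := l)) A
      = (val_of (A 0 l) * pos_of (A 0 l) ^ r) mod p" if l: "l < t" for l
  proof -
    have ll: "l < len" using l pos by (metis less_le_trans mult_le_mono One_nat_def Suc_leI le_add2 mult_1 mult_2)
    have P: "eval w ?P (?v(21 := l)) A = pos_of (A 0 l)"
      using pv ll by (simp add: params_def pos_of_def)
    have "eval w (pow_mod ?P (X 27)) (?v(21 := l)) A = pos_of (A 0 l) ^ r mod p"
      by (subst eval_pow_mod) (use pv P pos_of_less[of "A 0 l"] n_le in auto)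
    moreover have "val_of (A 0 l) * (pos_of (A 0 l) ^ r mod p) < W"
    proof -
      have "val_of (A 0 l) * (pos_of (A 0 l) ^ r mod p) \<le> R ^ 3 * R ^ 3"
        using val_of_less[of "A 0 l"] p_le pos mod_less_divisor[of p "pos_of (A 0 l) ^ r"]
        by (intro mult_le_mono) linarith+
      then show ?thesis by (intro word_bound[of _ 6]) (simp_all flip: power_add)
    qed
    ultimately show ?thesis using pv ll by (simp add: params_def val_of_def mod_mult_right_eq del: P)
  qed
  have "eval w (SumE 21 (X 8) (Op Op_Mod (Op Op_Mul (Op Op_Mod (Op Op_Div (Rd 0 (X 21)) (X 4)) (X 7)) (pow_mod ?P (X 27))) (X 7))) ?v A
      = (\<Sum>l<t. (val_of (A 0 l) * pos_of (A 0 l) ^ r) mod p)"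
  proof (rule eval_sum_nat)
    have "(\<Sum>l<t. (val_of (A 0 l) * pos_of (A 0 l) ^ r) mod p) \<le> (\<Sum>l<t. p)"
      using pos by (intro sum_mono) (simp add: less_imp_le)
    also have "\<dots> < W" using t_p_W by simp
    finally show "(\<Sum>l<t. (val_of (A 0 l) * pos_of (A 0 l) ^ r) mod p) < W" .
  next
    show "eval w (X 8) ?v A = t" using pv by (simp add: params_def)
  qed (rule tm | simp add: pow_mod_def)+
  moreover have "eval w (Rd 1 (Op Op_Add (Op Op_Mul (X 12) (X 11)) (X 27))) ?v A = A 1 (j * (2 * t) + r)"
  proof -
    have "Suc j * (2 * t) \<le> len" using assms(4) by (intro mult_le_mono1) simp
    then have i: "j * (2 * t) + r < len" using r by simp
    then have "j * (2 * t) + r < W" using len_W by (rule less_trans)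
    with i show ?thesis using assms by (simp add: params_def)
  qed
  ultimately show "eval w (NotE (EqE (Op Op_Mod (SumE 21 (X 8) (Op Op_Mod (Op Op_Mul (Op Op_Mod (Op Op_Div (Rd 0 (X 21)) (X 4)) (X 7)) (pow_mod ?P (X 27))) (X 7))) (X 7))
     (Rd 1 (Op Op_Add (Op Op_Mul (X 12) (X 11)) (X 27))))) ?v A = (if syn (A 0) r = A 1 (j * (2 * t) + r) then 0 else 1)"
    using w_pos pv by (simp add: eval_NotE eval_EqE syn_def mod_sum_eq params_def)
qed (auto simp: pow_mod_def)

definition residue :: "(nat \<Rightarrow> nat) \<Rightarrow> nat \<Rightarrow> nat" where
  "residue c b = (\<Sum>l<t. if pos_of (c l) = b then val_of (c l) else 0) mod p"

text \<open>The distance of the residue from the nearest multiple of \<open>p\<close>.\<close>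

definition magnitude :: "(nat \<Rightarrow> nat) \<Rightarrow> nat \<Rightarrow> nat" where
  "magnitude c b = (if residue c b < p - residue c b then residue c b else p - residue c b)"

definition block_of :: "(nat \<Rightarrow> nat) \<Rightarrow> nat \<Rightarrow> nat \<Rightarrow> nat" where
  "block_of Z j l = Z (j * t + l)"

definition gval :: "(nat \<Rightarrow> nat) \<Rightarrow> nat \<Rightarrow> nat \<Rightarrow> nat" where
  "gval Z b j = log_int R Q (magnitude (block_of Z j) b)"

definition lval :: "(nat \<Rightarrow> nat) \<Rightarrow> nat \<Rightarrow> nat \<Rightarrow> int" where
  "lval C i a = int (C (i * k + a) mod (2 * q + 1)) - int q"

lemma residue_less: "residue c b < p" using pos by (simp add: residue_def)

lemma magnitude_le: "magnitude c b \<le> p" using residue_less[of c b] by (auto simp: magnitude_def)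

text \<open>At most \<open>R * R ^ 3\<close> terms, each at most \<open>Q div R\<close>, which is
  \<open>R ^ 5\<close>.\<close>

lemma gval_le: "gval Z b j \<le> R ^ 9"
proof -
  have "gval Z b j \<le> (\<Sum>u<R * magnitude (block_of Z j) b. R ^ 5)"
    unfolding gval_def log_int_def
  proof (intro sum_mono)
    fix u
    have "R ^ 6 div (R + u) \<le> R ^ 6 div R" using pos by (intro div_le_mono2) auto
    also have "R ^ 6 div R = R ^ 5" using pos power_Suc[of R 5] by simp
    finally show "R ^ 6 div (R + u) \<le> R ^ 5" .
  qed
  also have "\<dots> = R * magnitude (block_of Z j) b * R ^ 5" by simp
  also have "\<dots> \<le> R * R ^ 3 * R ^ 5" using magnitude_le p_le by (intro mult_le_mono) (auto intro: order_trans)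
  also have "\<dots> = R ^ 9" by (simp add: power_numeral_reduce)
  finally show ?thesis .
qed

lemma eval_residue:
  assumes "words w v A" "params v" "b \<notin> {21, 26, 29}" "j \<notin> {21, 26, 29}" "v b < n" "v j < n"
  shows "eval w (residue_exp b j) v A = residue (block_of (A 2) (v j)) (v b)"
proof -
  let ?Z = "Rd 2 (Op Op_Add (Op Op_Mul (X j) (X 8)) (X 21))"
  let ?c = "block_of (A 2) (v j)"
  have Z: "eval w ?Z (v(21 := l)) A = ?c l" if l: "l < t" for l
  proof -
    have "Suc (v j) * t \<le> n * t" using assms by (intro mult_le_mono1) simp
    then have i: "v j * t + l < len" using l by simp
    then have "v j * t + l < W" using len_W by (rule less_trans)
    with i show ?thesis using assms by (simp add: params_def block_of_def)
  qed
  have "eval w (SumE 21 (X 8)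
       (IteE (EqE (Op Op_Mod ?Z (X 4)) (X b)) (Op Op_Mod (Op Op_Div ?Z (X 4)) (X 7)) (N 0))) v A =
     (\<Sum>l<t. if pos_of (?c l) = v b then val_of (?c l) else 0)"
  proof (rule eval_sum_nat)
    have "(\<Sum>l<t. if pos_of (?c l) = v b then val_of (?c l) else 0) \<le> (\<Sum>l<t. p)"
      using val_of_less by (intro sum_mono) (auto intro: less_imp_le)
    also have "\<dots> < W" using t_p_W by simp
    finally show "(\<Sum>l<t. if pos_of (?c l) = v b then val_of (?c l) else 0) < W" .
  next
    fix l assume l: "l < t"
    have wv: "words w (v(21 := l)) A" using assms l two_t_W by auto
    have e: "eval w (EqE (Op Op_Mod ?Z (X 4)) (X b)) (v(21 := l)) A = (if pos_of (?c l) = v b then 1 else 0)"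
      unfolding eval_EqE[OF w_pos] using Z[OF l] assms by (simp add: params_def pos_of_def del: eval.simps(4))
    show "eval w (IteE (EqE (Op Op_Mod ?Z (X 4)) (X b)) (Op Op_Mod (Op Op_Div ?Z (X 4)) (X 7)) (N 0)) (v(21 := l)) A =
      (if pos_of (?c l) = v b then val_of (?c l) else 0)"
      unfolding eval_IteE[OF wv e] using Z[OF l] assms by (simp add: params_def val_of_def del: eval.simps(4))
  qed (use assms in \<open>auto simp: params_def\<close>)
  then show ?thesis using assms by (simp add: residue_exp_def Let_def residue_def params_def)
qed

lemma eval_log_exp:
  assumes "words w v A" "params v" "b \<notin> {19, 21, 24, 26, 28, 29}" "j \<notin> {19, 21, 24, 26, 28, 29}" "v b < n" "v j < n"
  shows "eval w (log_exp b j) v A = gval (A 2) (v b) (v j)"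
proof -
  let ?z = "residue (block_of (A 2) (v j)) (v b)" let ?y = "magnitude (block_of (A 2) (v j)) (v b)"
  let ?v = "v(28 := ?z)"
  have pW: "p < W" using p_le by (rule word_bound) simp
  have z: "eval w (residue_exp b j) v A = ?z" by (rule eval_residue) (use assms in auto)
  have wv: "words w ?v A" using assms less_trans[OF residue_less pW] by auto
  have s: "eval w (Op Op_Sub (X 7) (X 28)) ?v A = p - ?z"
  proof -
    have "(p + (W - ?z)) = (p - ?z) + W" using residue_less[of "block_of (A 2) (v j)" "v b"] pW by linarith
    moreover have "p - ?z < W" using pW by linarith
    ultimately show ?thesis using assms by (simp add: params_def)
  qed
  have y: "eval w (IteE (Op Op_Less (X 28) (Op Op_Sub (X 7) (X 28))) (X 28) (Op Op_Sub (X 7) (X 28))) ?v A = ?y"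
    by (subst eval_IteE[OF wv, where b = "?z < p - ?z"]) (use s in \<open>simp_all add: magnitude_def\<close>)
  let ?w = "?v(19 := ?y)"
  have yR: "?y \<le> R ^ 3" using magnitude_le p_le by (rule order_trans)
  have Ry: "R * ?y \<le> R ^ 4" using yR by (simp add: power_numeral_reduce)
  have RyW: "R * ?y < W" using Ry by (rule word_bound) simp
  have "eval w (SumE 24 (Op Op_Mul (X 6) (X 19)) (Op Op_Div (X 10) (Op Op_Add (X 6) (X 24)))) ?w A = gval (A 2) (v b) (v j)"
    unfolding gval_def log_int_def
  proof (rule eval_sum_nat)
    show "eval w (Op Op_Mul (X 6) (X 19)) ?w A = R * ?y" using assms RyW by (simp add: params_def)
    show "(\<Sum>u<R * ?y. R ^ 6 div (R + u)) < W"
      using gval_le[of "A 2" "v b" "v j"] unfolding gval_def log_int_def by (rule word_bound) simp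
    fix u assume "u < R * ?y"
    then have "R + u \<le> R ^ 4 + R ^ 4" using Ry self_le_power[of R 4] R_ge by (intro add_mono) auto
    also have "\<dots> \<le> R ^ 4 * R" proof -
      have "R ^ 4 * 2 \<le> R ^ 4 * R" using R_ge by (intro mult_le_mono2) simp
      then show ?thesis by (simp only: mult_2_right)
    qed
    also have "\<dots> = R ^ 5" by (simp add: power_numeral_reduce)
    finally have "R + u < W" by (rule word_bound) simp
    then show "eval w (Op Op_Div (X 10) (Op Op_Add (X 6) (X 24))) (?w(24 := u)) A = R ^ 6 div (R + u)"
      using assms by (simp add: params_def)
  qed auto
  then show ?thesis unfolding log_exp_def using w_pos by (simp add: eval_LetE z y del: eval.simps fun_upd_apply)
qed

lemma lval_abs: "\<bar>lval C i a\<bar> \<le> int q"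
proof -
  have "C (i * k + a) mod (2 * q + 1) < 2 * q + 1" by simp
  then show ?thesis unfolding lval_def by linarith
qed

lemma evals_entry_exp:
  assumes "words w v A" "params v" "v i < n" "v a < k"
  shows "evals_to w (entry_exp i a) v A (lval (A 0) (v i) (v a))"
  unfolding entry_exp_def lval_def
proof (rule evals_to_Sub[OF assms(1)]; rule evals_to_nat)
  have "Suc (v i) * k \<le> n * k" using assms by (intro mult_le_mono1) simp
  then have i: "v i * k + v a < len" using assms(4) nk_le_len unfolding mult_Suc by linarith
  then have "v i * k + v a < W" using len_W by (rule less_trans)
  moreover have "2 * q + 1 < W"
  proof (rule word_bound[of _ 12])
    have "1 \<le> q" "3 * q \<le> R * q" using R_ge by (simp, intro mult_le_mono1, simp)
    moreover have "R * q = R ^ 12" using power_Suc[of R 11] by simp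
    ultimately show "2 * q + 1 \<le> R ^ 12" by linarith
  qed simp
  ultimately show "eval w (Op Op_Mod (Rd 0 (Op Op_Add (Op Op_Mul (X i) (X 5)) (X a))) (Op Op_Add (Op Op_Add (X 9) (X 9)) (N 1))) v A
      = A 0 (v i * k + v a) mod (2 * q + 1)"
    using assms i pos w_pos by (simp add: params_def mult_2)
qed (use assms in \<open>simp add: params_def\<close>)

lemma evals_defect_exp:
  assumes "words w v A" "params v" "v 20 = i" "i < n"
    and fv: "26 \<notin> fv (y 23)"
    and y: "\<And>v' b. words w v' A \<Longrightarrow> params v' \<Longrightarrow> v' 22 = v 22 \<Longrightarrow> b \<in> {20, 23} \<Longrightarrow> v' b < n \<Longrightarrow>
      evals_to w (y b) v' A (h (v' b))"
  shows "evals_to w (defect_exp y) v A (int_defect n k (int q) (lval (A 0)) (\<lambda>b j. h b) i j)"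
  unfolding defect_exp_def int_defect_def
proof (intro evals_to_Sub evals_to_SumE evals_to_Mul)
  have nW: "n < W" using n_le by (intro word_bound[of _ 1]) auto
  have kW: "k < W" using nW k_le by simp
  {
    fix a assume a: "a < k"
    let ?v = "v(25 := a)"
    have v: "words w ?v A" "params ?v" using assms a kW by auto
    show "evals_to w (entry_exp 20 25) ?v A (lval (A 0) i a)"
      using evals_entry_exp[OF v, of 20 25] assms a by simp
    show "eval w (X 4) ?v A = n" using assms by (simp add: params_def)
    fix b assume b: "b < n"
    let ?u = "?v(23 := b)"
    have u: "words w ?u A" "params ?u" using v b nW by auto
    show "evals_to w (entry_exp 23 25) ?u A (lval (A 0) b a)"
      using evals_entry_exp[OF u, of 23 25] b a by simp
    show "evals_to w (y 23) ?u A (h b)" using y[OF u, of 23] b by simp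
  }
  show "evals_to w (y 20) v A (h i)" using y[OF assms(1,2), of 20] assms by simp
  show "26 \<notin> fv (Op Op_Mul (entry_exp 23 25) (y 23))" using fv by (auto simp: entry_exp_def)
  show "evals_to w (X 9) v A (int q)" using assms(2) by (intro evals_to_nat) (simp add: params_def)
  then show "evals_to w (X 9) v A (int q)" .
qed (use assms in \<open>auto simp: params_def entry_exp_def\<close>)

text \<open>With all factors at most \<open>R ^ 11\<close>, the double sum is at most
  \<open>k n\<close> times \<open>R ^ 33\<close> and the subtracted term at most
  \<open>R ^ 33\<close>; the factor \<open>k n + 1\<close> is absorbed into
  \<open>R ^ 3\<close>.\<close>

lemma int_defect_abs:
  assumes "\<And>i j. i < n \<Longrightarrow> j < m \<Longrightarrow> \<bar>y i j\<bar> \<le> int (R ^ 11)" "i < n" "j < m"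
  shows "\<bar>int_defect n k (int q) (lval C) y i j\<bar> \<le> int (R ^ 36)"
proof -
  have y: "\<bar>y b j\<bar> \<le> int (R ^ 11)" if "b < n" for b using assms that by auto
  have 1: "\<bar>\<Sum>b<n. lval C b a * y b j\<bar> \<le> int n * (int q * int (R ^ 11))" for a
  proof -
    have "\<bar>\<Sum>b<n. lval C b a * y b j\<bar> \<le> (\<Sum>b<n. \<bar>lval C b a * y b j\<bar>)" by (rule sum_abs)
    also have "\<dots> \<le> (\<Sum>b<n. int q * int (R ^ 11))"
      unfolding abs_mult using y lval_abs by (intro sum_mono mult_mono) auto
    finally show ?thesis by simp
  qed
  have 2: "\<bar>\<Sum>a<k. lval C i a * (\<Sum>b<n. lval C b a * y b j)\<bar> \<le> int k * (int q * (int n * (int q * int (R ^ 11))))"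
  proof -
    have "\<bar>\<Sum>a<k. lval C i a * (\<Sum>b<n. lval C b a * y b j)\<bar> \<le> (\<Sum>a<k. \<bar>lval C i a * (\<Sum>b<n. lval C b a * y b j)\<bar>)"
      by (rule sum_abs)
    also have "\<dots> \<le> (\<Sum>a<k. int q * (int n * (int q * int (R ^ 11))))"
      unfolding abs_mult using 1 lval_abs by (intro sum_mono mult_mono) auto
    finally show ?thesis by simp
  qed
  have 3: "\<bar>int q * int q * y i j\<bar> \<le> int q * int q * int (R ^ 11)"
    unfolding abs_mult using y[OF assms(2)] by (intro mult_mono) auto
  have "\<bar>int_defect n k (int q) (lval C) y i j\<bar> \<le> int k * (int q * (int n * (int q * int (R ^ 11)))) + int q * int q * int (R ^ 11)"
    unfolding int_defect_def using 2 3 by linarith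
  also have "\<dots> = int ((k * n + 1) * R ^ 33)"
    by (simp add: algebra_simps flip: power_add)
  also have "\<dots> \<le> int (R ^ 36)"
  proof -
    have "k * n + 1 \<le> R * R + 1" using k_le n_le by (intro add_mono mult_le_mono) auto
    also have "\<dots> \<le> R * R * R"
    proof -
      have "R * R + 1 \<le> R * R * 2" using pos by simp
      also have "\<dots> \<le> R * R * R" using R_ge by (intro mult_le_mono2) simp
      finally show ?thesis .
    qed
    finally have "(k * n + 1) * R ^ 33 \<le> R * R * R * R ^ 33" by (rule mult_le_mono1)
    also have "\<dots> = R ^ 36" by (simp add: power_numeral_reduce)
    finally show ?thesis by (simp only: of_nat_le_iff)
  qed
  finally show ?thesis .
qed

text \<open>The largest quantity of the whole computation, from which the exponent 80 stems:
  \<open>n * n + n * k\<close> squares of size \<open>R ^ 72\<close> sum to at most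
  \<open>R ^ 75\<close>.\<close>

lemma proj_cost_range:
  "0 \<le> proj_cost n k (int q) (\<lambda>b j. int (gval Z b j)) (lval C)"
  "proj_cost n k (int q) (\<lambda>b j. int (gval Z b j)) (lval C) < 2 ^ w"
proof -
  let ?g = "\<lambda>b j. int (gval Z b j)"
  show "0 \<le> proj_cost n k (int q) ?g (lval C)" unfolding proj_cost_def by (intro add_nonneg_nonneg sum_nonneg) auto
  have g: "\<bar>?g i j\<bar> \<le> int (R ^ 11)" for i j
    using gval_le[of Z i j] power_increasing[of 9 11 R] pos by (simp only: abs_of_nat of_nat_le_iff) linarith
  have sq: "x\<^sup>2 \<le> (int (R ^ 36))\<^sup>2" if "\<bar>x\<bar> \<le> int (R ^ 36)" for x
    using that by (metis abs_ge_zero power2_abs power_mono)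
  have "proj_cost n k (int q) ?g (lval C) \<le> (\<Sum>i<n. \<Sum>j<n. (int (R ^ 36))\<^sup>2) + (\<Sum>i<n. \<Sum>j<k. (int (R ^ 36))\<^sup>2)"
    unfolding proj_cost_def
    by (intro add_mono sum_mono sq int_defect_abs[where m = n] int_defect_abs[where m = k]) (use g lval_abs in auto)
  also have "\<dots> = int ((n * n + n * k) * R ^ 72)" by (simp add: algebra_simps flip: power_mult)
  also have "\<dots> < int W"
  proof -
    have "n * n + n * k \<le> R * R + R * R" using k_le n_le by (intro add_mono mult_le_mono) auto
    also have "\<dots> = R * R * 2" by simp
    also have "\<dots> \<le> R * R * R" using R_ge by (intro mult_le_mono2) simp
    finally have "(n * n + n * k) * R ^ 72 \<le> R * R * R * R ^ 72" by (rule mult_le_mono1)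
    also have "\<dots> = R ^ 75" by (simp add: power_numeral_reduce)
    finally have "(n * n + n * k) * R ^ 72 < W" by (rule word_bound) simp
    then show ?thesis by (simp only: of_nat_less_iff)
  qed
  finally show "proj_cost n k (int q) ?g (lval C) < 2 ^ w" by simp
qed

text \<open>The intermediate differences may be negative and are tracked only modulo
  \<open>2 ^ w\<close>; the total is exact because it lies in the range of words.\<close>

lemma eval_proj_cost:
  assumes v: "words w v A" "params v"
  shows "eval w proj_cost_exp v A = nat (proj_cost n k (int q) (\<lambda>b j. int (gval (A 2) b j)) (lval (A 0)))"
proof (rule evals_to_exact[OF _ v(1) proj_cost_range])
  have nW: "n < W" using n_le by (intro word_bound[of _ 1]) auto
  have kW: "k < W" using nW k_le by simp
  \<comment> \<open>Only column \<open>j\<close> of the matrix enters, so the matrix may be replaced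
    by that column, as \<open>defect_exp\<close> expects.\<close>
  have d: "int_defect n k (int q) l h i j = int_defect n k (int q) l (\<lambda>b j'. h b j) i j'" for l h i j j'
    by (simp add: int_defect_def)
  have fvl: "26 \<notin> fv (square_exp (defect_exp (\<lambda>b. log_exp b 22)))" "26 \<notin> fv (square_exp (defect_exp (\<lambda>b. entry_exp b 22)))"
    by (auto simp: square_exp_def defect_exp_def log_exp_def entry_exp_def residue_exp_def Let_def)
  show "evals_to w proj_cost_exp v A (proj_cost n k (int q) (\<lambda>b j. int (gval (A 2) b j)) (lval (A 0)))"
    unfolding proj_cost_exp_def proj_cost_def
  proof (intro evals_to_Add evals_to_SumE)
    fix i assume i: "i < n"
    let ?v = "v(20 := i)"
    have v1: "words w ?v A" "params ?v" using v i nW by auto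
    show "eval w (X 4) ?v A = n" "eval w (X 5) ?v A = k" using v by (auto simp: params_def)
    {
      fix j assume j: "j < n"
      let ?u = "?v(22 := j)"
      have u: "words w ?u A" "params ?u" using v1 j nW by auto
      show "evals_to w (square_exp (defect_exp (\<lambda>b. log_exp b 22))) ?u A
         ((int_defect n k (int q) (lval (A 0)) (\<lambda>b j. int (gval (A 2) b j)) i j)\<^sup>2)"
        unfolding square_exp_def power2_eq_square d[of "lval (A 0)" "\<lambda>b j. int (gval (A 2) b j)" i j j]
      proof (intro evals_to_Mul evals_defect_exp u)
        fix v' :: vars and b :: nat assume v': "words w v' A" "params v'" "v' 22 = ?u 22" "b \<in> {20, 23}" "v' b < n"
        have "eval w (log_exp b 22) v' A = gval (A 2) (v' b) (v' 22)"
          by (rule eval_log_exp) (use v' j in auto)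
        then show "evals_to w (log_exp b 22) v' A (int (gval (A 2) (v' b) j))"
          using v' by (intro evals_to_nat) simp
        then show "evals_to w (log_exp b 22) v' A (int (gval (A 2) (v' b) j))" .
      qed (use i j in \<open>auto simp: log_exp_def residue_exp_def Let_def\<close>)
    next
      fix j assume j: "j < k"
      let ?u = "?v(22 := j)"
      have u: "words w ?u A" "params ?u" using v1 j kW by auto
      show "evals_to w (square_exp (defect_exp (\<lambda>b. entry_exp b 22))) ?u A
         ((int_defect n k (int q) (lval (A 0)) (lval (A 0)) i j)\<^sup>2)"
        unfolding square_exp_def power2_eq_square d[of "lval (A 0)" "lval (A 0)" i j j]
      proof (intro evals_to_Mul evals_defect_exp u)
        fix v' :: vars and b :: nat assume v': "words w v' A" "params v'" "v' 22 = ?u 22" "b \<in> {20, 23}" "v' b < n"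
        show "evals_to w (entry_exp b 22) v' A (lval (A 0) (v' b) j)"
          using evals_entry_exp[of v' A b 22] v' j by simp
        then show "evals_to w (entry_exp b 22) v' A (lval (A 0) (v' b) j)" .
      qed (use i j in \<open>auto simp: entry_exp_def\<close>)
    }
  qed (use v fvl in \<open>auto simp: params_def\<close>)
qed

end

subsection \<open>Correctness of the initialisation\<close>

text \<open>The known variable values over unchanged arrays; each assignment of the initialisation
  prepends one pair.\<close>

definition holds :: "(nat \<times> nat) list \<Rightarrow> arrs \<Rightarrow> vars \<Rightarrow> arrs \<Rightarrow> bool" where
  "holds S A0 v A \<longleftrightarrow> A = A0 \<and> (\<forall>(x, a) \<in> set S. v x = a)"

lemma triple_holds_Asg:
  assumes "\<not> uses_arr e" "x \<notin> fst ` set S" "\<And>v. words w v A0 \<Longrightarrow> holds S A0 v A0 \<Longrightarrow> eval w e v A0 = a"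
  shows "triple w l (holds S A0) (Asg x e) (holds ((x, a) # S) A0)"
proof (rule triple_Asg)
  fix v A assume "words w v A" and h: "holds S A0 v A"
  then have e: "eval w e v A = a" using assms(3) by (auto simp: holds_def)
  have "y \<noteq> x" if "(y, b) \<in> set S" for y b using assms(2) that by force
  then show "(uses_arr e \<longrightarrow> 0 < v 3 \<and> v 3 \<le> l) \<and> holds ((x, a) # S) A0 (v(x := eval w e v A)) A"
    using h assms(1) unfolding e by (auto simp: holds_def)
qed

lemma two_power_mod: "(2::nat) ^ i mod 2 ^ w = (if i < w then 2 ^ i else 0)"
  by (auto simp: not_less le_imp_power_dvd)

lemma eval_doubling:
  "0 < w \<Longrightarrow> eval w (It 25 24 (N 1) e (Op Op_Add (X 25) (X 25))) v A = 2 ^ eval w e v A mod 2 ^ w"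
proof -
  assume "0 < w"
  have "fold (\<lambda>i acc. (acc + acc) mod 2 ^ w) [0..<j] (1 mod 2 ^ w) = 2 ^ j mod (2::nat) ^ w" for j
    by (induction j) (simp_all add: mod_add_eq mult_2)
  then show ?thesis by simp
qed

lemma eval_power:
  assumes "0 < w" "v 6 = R"
  shows "eval w (It 25 24 (N 1) e (Op Op_Mul (X 25) (X 6))) v A = R ^ eval w e v A mod 2 ^ w"
proof -
  have "fold (\<lambda>i acc. (acc * R) mod 2 ^ w) [0..<j] (1 mod 2 ^ w) = R ^ j mod (2::nat) ^ w" for j
  proof (induction j)
    case (Suc j)
    then show ?case using mod_mult_left_eq[of "R ^ j" "2 ^ w" R] by (simp add: mult.commute)
  qed simp
  then show ?thesis using assms by simp
qed

lemma prime_iff_count: "2 \<le> (y::nat) \<Longrightarrow> prime y \<longleftrightarrow> (\<Sum>d<y. if 2 \<le> d \<and> y mod d = 0 then 1 else 0 :: nat) = 0"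
  unfolding prime_nat_iff' by (auto simp: dvd_eq_mod_eq_0)

text \<open>The value rises by one per round until it meets \<open>p\<close>, which explains the
  minimum.\<close>

lemma least_prime_iteration:
  assumes "\<And>y. a \<le> y \<Longrightarrow> y < p \<Longrightarrow> \<not> prime y" "prime p" "a \<le> p"
  shows "fold (\<lambda>i y. if prime y then y else Suc y) [0..<j] a = min (a + j) p"
proof (induction j)
  case (Suc j)
  then show ?case using assms(1)[of "a + j"] assms(2) by (cases "a + j < p") (auto simp: min_def)
qed (use assms in simp)

locale sketch_init = sketch +
  assumes R_def: "R = 2 ^ (w div 80)" and t_def: "t = k * (E * E) * (w * (w * w))"
    and E_le: "E \<le> R" and w_le: "w \<le> R" and p_least: "\<And>y. 2 * R < y \<Longrightarrow> y < p \<Longrightarrow> \<not> prime y"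
begin

text \<open>\<open>2 ^ i\<close> vanishes modulo \<open>2 ^ w\<close> exactly from
  \<open>i = w\<close> on, and the number of rounds, the largest word \<open>2 ^ w - 1\<close>,
  exceeds \<open>w\<close>.\<close>

lemma eval_word_length:
  "eval w (SumE 20 (Op Op_Sub (N 0) (N 1)) (LeE (N 1) (It 25 24 (N 1) (X 20) (Op Op_Add (X 25) (X 25))))) v A = w"
proof -
  have "eval w (SumE 20 (Op Op_Sub (N 0) (N 1)) (LeE (N 1) (It 25 24 (N 1) (X 20) (Op Op_Add (X 25) (X 25))))) v A
     = (\<Sum>i<W - 1. if i < w then 1 else 0)"
  proof (rule eval_sum_nat)
    fix i
    show "eval w (LeE (N 1) (It 25 24 (N 1) (X 20) (Op Op_Add (X 25) (X 25)))) (v(20 := i)) A = (if i < w then 1 else 0)"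
      unfolding eval_LeE[OF w_pos] eval_doubling[OF w_pos] using pos(5) w_pos by (simp add: two_power_mod)
  next
    have "(\<Sum>i<W - 1. if i < w then 1 else 0) \<le> (\<Sum>i<W - 1. 1::nat)" by (intro sum_mono) auto
    also have "\<dots> < W" using pos by simp
    finally show "(\<Sum>i<W - 1. if i < w then 1 else 0) < W" .
  qed (use pos w_pos in \<open>auto simp: LeE_def NotE_def\<close>)
  also have "\<dots> = card ({..<W - 1} \<inter> {i. i < w})" by (simp add: sum.If_cases)
  also have "{..<W - 1} \<inter> {i. i < w} = {..<w}"
  proof -
    have "w < W - 1"
    proof -
      have "2 \<le> w"
      proof (rule ccontr)
        assume "\<not> 2 \<le> w"
        then have "R = 1" by (simp add: R_def)
        then show False using R_ge by simp
      qed
      then have "(2::nat) ^ w = 2 ^ 2 * 2 ^ (w - 2)" by (metis le_add_diff_inverse power_add)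
      then show ?thesis using less_exp[of "w - 2"] by (simp only: power2_eq_square)
    qed
    then show ?thesis by auto
  qed
  finally show ?thesis by simp
qed

lemma eval_least_prime:
  assumes "words w v A" "v 6 = R"
  shows "eval w (It 25 24 (Op Op_Add (Op Op_Add (X 6) (X 6)) (N 1)) (Op Op_Mul (X 6) (Op Op_Mul (X 6) (X 6)))
       (IteE (EqE (SumE 20 (X 25) (Op Op_Mul (LeE (N 2) (X 20)) (EqE (Op Op_Mod (X 25) (X 20)) (N 0)))) (N 0))
         (X 25) (Op Op_Add (X 25) (N 1)))) v A = p" (is "eval w (It 25 24 ?s ?m ?b) v A = p")
proof -
  have pW: "p < W" using p_le by (rule word_bound) simp
  have two: "2 < W" using R_ge by (intro word_bound[of _ 1]) auto
  have s: "eval w ?s v A = 2 * R + 1" using assms p_gt pW w_pos by simp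
  have m: "eval w ?m v A = R ^ 3"
  proof -
    have "R * (R * R) = R ^ 3" by (simp add: power_numeral_reduce)
    moreover have "R ^ 3 < W" "R ^ 2 < W" by (rule word_bound[of _ 3], simp_all) (rule word_bound[of _ 2], simp_all)
    ultimately show ?thesis using assms by (simp add: power2_eq_square)
  qed
  have b: "eval w ?b (v(25 := y, 24 := i)) A = (if prime y then y else Suc y)" if y: "2 \<le> y" "y \<le> p" and i: "i < R ^ 3" for y i
  proof -
    let ?v = "v(25 := y, 24 := i)"
    have "i < W" using i by (intro word_bound[of _ 3]) auto
    then have wv: "words w ?v A" using assms y pW by auto
    have "eval w (SumE 20 (X 25) (Op Op_Mul (LeE (N 2) (X 20)) (EqE (Op Op_Mod (X 25) (X 20)) (N 0)))) ?v A =
       (\<Sum>d<y. if 2 \<le> d \<and> y mod d = 0 then 1 else 0)"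
    proof (rule eval_sum_nat)
      fix d
      show "eval w (Op Op_Mul (LeE (N 2) (X 20)) (EqE (Op Op_Mod (X 25) (X 20)) (N 0))) (?v(20 := d)) A
        = (if 2 \<le> d \<and> y mod d = 0 then 1 else 0)"
        using two pos(5) w_pos by (simp add: eval_LeE eval_EqE)
    next
      have "(\<Sum>d<y. if 2 \<le> d \<and> y mod d = 0 then 1 else 0) \<le> (\<Sum>d<y. 1::nat)" by (intro sum_mono) auto
      also have "\<dots> < W" using y pW by simp
      finally show "(\<Sum>d<y. if 2 \<le> d \<and> y mod d = 0 then 1 else 0) < W" .
    qed (auto simp: LeE_def NotE_def EqE_def)
    then have e: "eval w (EqE (SumE 20 (X 25) (Op Op_Mul (LeE (N 2) (X 20)) (EqE (Op Op_Mod (X 25) (X 20)) (N 0)))) (N 0)) ?v A =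
      (if prime y then 1 else 0)"
      unfolding eval_EqE[OF w_pos] prime_iff_count[OF y(1)] by simp
    have "Suc p < W" using p_le R_ge one_le_power[of R 3]
      by (intro word_bound[of _ 4]) (simp_all add: power_Suc[of R 3, simplified] Suc_le_eq, intro le_less_trans[of p "R ^ 3" "R * R ^ 3"], simp_all)
    then show ?thesis unfolding eval_IteE[OF wv e] using y w_pos pos(5) by simp
  qed
  define G where "G i y = eval w ?b (v(25 := y, 24 := i)) A" for i y
  have G: "(\<lambda>i y. eval w ?b (v(25 := y, 24 := i)) A) = G" by (intro ext) (simp only: G_def)
  have 1: "fold G [0..<j] (2 * R + 1) = fold (\<lambda>i y. if prime y then y else Suc y) [0..<j] (2 * R + 1)" if "j \<le> R ^ 3" for j
    using that
  proof (induction j)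
    case (Suc j)
    let ?y = "fold (\<lambda>i y. if prime y then y else Suc y) [0..<j] (2 * R + 1)"
    have y: "?y = min (2 * R + 1 + j) p"
      by (rule least_prime_iteration) (use p_least p_prime p_gt in auto)
    have "2 \<le> ?y" "?y \<le> p" unfolding y using p_gt R_ge by auto
    then have "G j ?y = (if prime ?y then ?y else Suc ?y)" unfolding G_def by (rule b) (use Suc.prems in simp)
    then show ?case using Suc by simp
  qed simp
  \<comment> \<open>\<open>R ^ 3\<close> rounds suffice because
    \<open>p \<le> R ^ 3\<close>.\<close>
  have 2: "fold (\<lambda>i y. if prime y then y else Suc y) [0..<R ^ 3] (2 * R + 1) = min (2 * R + 1 + R ^ 3) p"
    by (rule least_prime_iteration) (use p_least p_prime p_gt in auto)
  show ?thesis unfolding eval.simps(5) s m G 1[OF order_refl] 2 using p_le by simp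
qed

lemma init_correct:
  assumes "words w v0 A0" "v0 0 = n" "v0 1 = k" "v0 2 = E"
  shows "\<exists>v'. big_step w l init_com (v0, A0) (v', A0) \<and> words w v' A0 \<and> params v'"
proof -
  have RW: "R < W" by (rule word_bound[of _ 1]) auto
  \<comment> \<open>For smaller \<open>w\<close> the exponent in \<open>R_def\<close> would be 0.
    Hence the constant 80 of the program is a word and is not truncated.\<close>
  have "80 \<le> w"
  proof (rule ccontr)
    assume "\<not> 80 \<le> w"
    then have "R = 1" by (simp add: R_def)
    then show False using R_ge by simp
  qed
  then have w80: "80 < W" using less_exp[of w] by linarith
  have wW: "w < W" by (rule less_exp)
  have dw: "w div 80 < w" using w_pos by (intro div_less_dividend) auto
  have bounds: "E * E < W" "k * (E * E) < W" "w * w < W" "w * (w * w) < W" "k * (E * E) * (w * (w * w)) < W"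
  proof -
    have "E * E \<le> R * R" "k * (E * E) \<le> R * (R * R)" "w * w \<le> R * R" "w * (w * w) \<le> R * (R * R)"
      using E_le w_le k_le n_le by (auto intro!: mult_le_mono)
    moreover have "R * R < W" "R * (R * R) < W"
      using word_bound[of "R ^ 2" 2] word_bound[of "R ^ 3" 3] by (simp_all add: power2_eq_square power3_eq_cube)
    ultimately show "E * E < W" "k * (E * E) < W" "w * w < W" "w * (w * w) < W" by linarith+
    show "k * (E * E) * (w * (w * w)) < W" unfolding t_def[symmetric] using t_le by (rule word_bound) simp
  qed
  let ?S0 = "[(0, n), (1, k), (2, E)]" let ?S1 = "(4, n) # ?S0" let ?S2 = "(5, k) # ?S1"
  let ?S3 = "(12, w) # ?S2" let ?S4 = "(6, R) # ?S3" let ?S5 = "(8, t) # ?S4" let ?S6 = "(9, q) # ?S5"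
  let ?S7 = "(10, Q) # ?S6" let ?S8 = "(11, 2 * t) # ?S7" let ?S9 = "(7, p) # ?S8"
  note H = triple_holds_Asg[of _ _ _ w A0 _ l]
  have 1: "triple w l (holds ?S0 A0) (Asg 4 (X 0)) (holds ?S1 A0)" by (rule H) (auto simp: holds_def)
  have 2: "triple w l (holds ?S1 A0) (Asg 5 (X 1)) (holds ?S2 A0)" by (rule H) (auto simp: holds_def)
  have 3: "triple w l (holds ?S2 A0) (Asg 12 (SumE 20 (Op Op_Sub (N 0) (N 1))
      (LeE (N 1) (It 25 24 (N 1) (X 20) (Op Op_Add (X 25) (X 25)))))) (holds ?S3 A0)"
    by (rule H[OF _ _ eval_word_length]) (auto simp: exp_defs)
  have 4: "triple w l (holds ?S3 A0) (Asg 6 (It 25 24 (N 1) (Op Op_Div (X 12) (N 80)) (Op Op_Add (X 25) (X 25)))) (holds ?S4 A0)"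
  proof (rule H)
    fix v assume "holds ?S3 A0 v A0"
    then show "eval w (It 25 24 (N 1) (Op Op_Div (X 12) (N 80)) (Op Op_Add (X 25) (X 25))) v A0 = R"
      unfolding eval_doubling[OF w_pos] using w80 dw by (simp add: holds_def two_power_mod R_def)
  qed auto
  have 5: "triple w l (holds ?S4 A0) (Asg 8 (Op Op_Mul (Op Op_Mul (X 5) (Op Op_Mul (X 2) (X 2)))
      (Op Op_Mul (X 12) (Op Op_Mul (X 12) (X 12))))) (holds ?S5 A0)"
    by (rule H) (use bounds in \<open>auto simp: holds_def t_def\<close>)
  have 6: "triple w l (holds ?S5 A0) (Asg 9 (It 25 24 (N 1) (N 11) (Op Op_Mul (X 25) (X 6)))) (holds ?S6 A0)"
  proof (rule H)
    fix v assume "holds ?S5 A0 v A0"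
    then have "v 6 = R" by (simp add: holds_def)
    then show "eval w (It 25 24 (N 1) (N 11) (Op Op_Mul (X 25) (X 6))) v A0 = q"
      unfolding eval_power[of w v R, OF w_pos \<open>v 6 = R\<close>] using w80 word_bound[of "R ^ 11" 11] by simp
  qed auto
  have 7: "triple w l (holds ?S6 A0) (Asg 10 (It 25 24 (N 1) (N 6) (Op Op_Mul (X 25) (X 6)))) (holds ?S7 A0)"
  proof (rule H)
    fix v assume "holds ?S6 A0 v A0"
    then have "v 6 = R" by (simp add: holds_def)
    then show "eval w (It 25 24 (N 1) (N 6) (Op Op_Mul (X 25) (X 6))) v A0 = Q"
      unfolding eval_power[of w v R, OF w_pos \<open>v 6 = R\<close>] using w80 word_bound[of "R ^ 6" 6] by simp
  qed auto
  have 8: "triple w l (holds ?S7 A0) (Asg 11 (Op Op_Add (X 8) (X 8))) (holds ?S8 A0)"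
    by (rule H) (use two_t_W in \<open>auto simp: holds_def mult_2\<close>)
  have 9: "triple w l (holds ?S8 A0) (Asg 7 (It 25 24 (Op Op_Add (Op Op_Add (X 6) (X 6)) (N 1)) (Op Op_Mul (X 6) (Op Op_Mul (X 6) (X 6)))
       (IteE (EqE (SumE 20 (X 25) (Op Op_Mul (LeE (N 2) (X 20)) (EqE (Op Op_Mod (X 25) (X 20)) (N 0)))) (N 0))
         (X 25) (Op Op_Add (X 25) (N 1))))) (holds ?S9 A0)"
    by (rule H[OF _ _ eval_least_prime]) (auto simp: exp_defs holds_def)
  have 10: "triple w l (holds ?S9 A0) (Asg 3 (Op Op_Mul (X 4) (X 11))) (holds ((3, len) # ?S9) A0)"
    by (rule H) (use len_W in \<open>auto simp: holds_def\<close>)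
  have "triple w l (holds ?S0 A0) init_com (holds ((3, len) # ?S9) A0)"
    unfolding init_com_def
    by (rule triple_Sq[OF 1 triple_Sq[OF 2 triple_Sq[OF 3 triple_Sq[OF 4 triple_Sq[OF 5 triple_Sq[OF 6 triple_Sq[OF 7 triple_Sq[OF 8 triple_Sq[OF 9 10]]]]]]]]])
  moreover have "holds [(0, n), (1, k), (2, E)] A0 v0 A0" using assms by (simp add: holds_def)
  ultimately obtain v' A' where "big_step w l init_com (v0, A0) (v', A')" "words w v' A'"
    "holds ((3, len) # ?S9) A0 v' A'"
    using assms(1) unfolding triple_def by blast
  then show ?thesis by (auto simp: holds_def params_def)
qed

end

subsection \<open>Correctness of an update\<close>

context sketch
begin

lemma syn_cong: "(\<And>l. l < t \<Longrightarrow> c l = c' l) \<Longrightarrow> syn c r = syn c' r"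
  unfolding syn_def by (intro arg_cong[of _ _ "\<lambda>x. x mod p"] sum.cong) auto

lemma mismatches_cong: "(\<And>l. l < t \<Longrightarrow> c l = c' l) \<Longrightarrow> mismatches S c = mismatches S c'"
  unfolding mismatches_def using syn_cong[of c c'] by simp

lemma block_index_less: "i < n \<Longrightarrow> a < k \<Longrightarrow> i * k + a < n * k"
proof -
  assume "i < n" "a < k"
  then have "Suc i * k \<le> n * k" by (intro mult_le_mono1) simp
  with \<open>a < k\<close> show ?thesis by simp
qed

lemma int_defect_cong:
  assumes "\<And>i a. i < n \<Longrightarrow> a < k \<Longrightarrow> l i a = l' i a" "\<And>i. i < n \<Longrightarrow> y i j = y' i j" "i < n"
  shows "int_defect n k q' l y i j = int_defect n k q' l' y' i j"
  unfolding int_defect_def using assms by simp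

lemma proj_cost_cong:
  assumes "\<And>i a. i < n \<Longrightarrow> a < k \<Longrightarrow> l i a = l' i a"
  shows "proj_cost n k q' g l = proj_cost n k q' g l'"
  unfolding proj_cost_def
  by (intro arg_cong2[of _ _ _ _ "(+)"] sum.cong refl arg_cong[of _ _ power2] arg_cong[of _ _ "\<lambda>x. x\<^sup>2"] int_defect_cong) (use assms in auto)

lemma lval_cong: "C (i * k + a) = C' (i * k + a) \<Longrightarrow> lval C i a = lval C' i a"
  by (simp add: lval_def)

text \<open>\<delta> is the increment as a residue modulo \<open>p\<close>; comparing variable 2
  with 1 distinguishes the words that encode 1 and -1.\<close>

lemma update_syndromes:
  assumes wv: "words w v A" and pv: "params v" and ij: "v 0 < n" "v 1 < n"
    and S: "\<And>r. r < 2 * t \<Longrightarrow> A 1 (v 1 * (2 * t) + r) < p"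
    and d: "v 2 = 1 \<and> \<delta> = 1 \<or> v 2 = W - 1 \<and> \<delta> = p - 1"
  shows "triple w len (\<lambda>v' A'. v' = v \<and> A' = A)
     (For 18 (X 11) (St 1 (Op Op_Add (Op Op_Mul (X 1) (X 11)) (X 18))
       (Op Op_Mod (Op Op_Add (Rd 1 (Op Op_Add (Op Op_Mul (X 1) (X 11)) (X 18)))
          (Op Op_Mul (IteE (EqE (X 2) (N 1)) (N 1) (Op Op_Sub (X 7) (N 1))) (pow_mod (X 0) (X 18)))) (X 7))))
     (\<lambda>v' A'. (\<exists>a. v' = v(18 := a)) \<and>
        A' = A(1 := window (v 1 * (2 * t)) (2 * t) (\<lambda>r. (A 1 (v 1 * (2 * t) + r) + \<delta> * v 0 ^ r) mod p) (A 1)))"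
    (is "triple _ _ _ (For 18 (X 11) (St 1 ?ei ?ev)) _")
proof -
  let ?m = "v 1 * (2 * t)" let ?f = "\<lambda>r. (A 1 (?m + r) + \<delta> * v 0 ^ r) mod p"
  have pW: "p < W" using p_le by (rule word_bound) simp
  have m: "?m + r < len" if "r < 2 * t" for r
  proof -
    have "Suc (v 1) * (2 * t) \<le> len" using ij by (intro mult_le_mono1) simp
    with that show ?thesis by simp
  qed
  define I where "I r v' A' \<longleftrightarrow> v' = v(18 := r) \<and> A' = A(1 := window ?m r ?f (A 1))" for r v' A'
  have W2: "2 < W" using R_ge by (intro word_bound[of _ 1]) auto
  have "triple w len (\<lambda>v' A'. v' = v \<and> A' = A) (For 18 (X 11) (St 1 ?ei ?ev)) (I (2 * t))"
  proof (rule triple_For)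
    fix r assume r: "r < 2 * t"
    show "triple w len (I r) (St 1 ?ei ?ev) (\<lambda>v A. v 18 = r \<and> I (Suc r) (v(18 := Suc r)) A)"
    proof (rule triple_St)
      fix v' A' assume w': "words w v' A'" and I: "I r v' A'"
      then have p': "params v'" and v': "v' = v(18 := r)" using pv by (auto simp: I_def)
      have "?m < len" using m[of 0] pos by simp
      then have ei: "eval w ?ei v' A' = ?m + r"
        using v' p' m[OF r] len_W by (simp add: params_def)
      have e: "eval w (IteE (EqE (X 2) (N 1)) (N 1) (Op Op_Sub (X 7) (N 1))) v' A' = \<delta>"
      proof -
        have "eval w (EqE (X 2) (N 1)) v' A' = (if v 2 = 1 then 1 else 0)"
          unfolding eval_EqE[OF w_pos] using v' pos(5) w_pos by simp
        from eval_IteE[OF w' this] have 1: "eval w (IteE (EqE (X 2) (N 1)) (N 1) (Op Op_Sub (X 7) (N 1))) v' A' =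
          (if v 2 = 1 then 1 mod W else (p + (W - 1 mod W)) mod W)" using p' by (simp add: params_def)
        have "p + (W - 1) = (p - 1) + W" using pos by linarith
        then have "(p + (W - 1)) mod W = (p - 1) mod W" by (simp only: mod_add_self2)
        also have "\<dots> = p - 1" using pW by (intro mod_less) linarith
        finally have 2: "(p + (W - 1)) mod W = p - 1" .
        have 3: "1 mod W = 1" using pos(5) by (rule mod_less)
        \<comment> \<open>The two encodings \<open>1\<close> and \<open>W - 1\<close> are distinct
          because \<open>2 < W\<close>.\<close>
        have 4: "v 2 = 1 \<longleftrightarrow> \<not> (v 2 = W - 1 \<and> \<delta> = p - 1)" "v 2 = 1 \<longrightarrow> \<delta> = 1"
          using d W2 by linarith+
        show ?thesis unfolding 1 3 2 using 4 by argo
      qed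
      have pm: "eval w (pow_mod (X 0) (X 18)) v' A' = v 0 ^ r mod p"
        by (subst eval_pow_mod) (use p' v' ij n_le in auto)
      have \<delta>: "\<delta> \<le> p" using d pos by auto
      have prod: "\<delta> * (v 0 ^ r mod p) \<le> R ^ 6"
      proof -
        have "v 0 ^ r mod p < p" using pos by simp
        then have "\<delta> * (v 0 ^ r mod p) \<le> R ^ 3 * R ^ 3" using \<delta> p_le by (intro mult_le_mono) linarith+
        then show ?thesis by (simp flip: power_add)
      qed
      have "A' 1 (?m + r) = A 1 (?m + r)" using I by (simp add: I_def window_def)
      then have rd: "eval w (Rd 1 ?ei) v' A' = A 1 (?m + r)" using p' m[OF r] by (simp only: eval.simps(4) ei) (simp add: params_def)
      have "A 1 (?m + r) + \<delta> * (v 0 ^ r mod p) \<le> R ^ 6 + R ^ 6"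
        using S[OF r] prod p_le power_increasing[of 3 6 R] pos by simp
      also have "\<dots> \<le> R ^ 6 * R" using R_ge mult_le_mono2[of 2 R "R ^ 6"] by (simp only: mult_2_right)
      also have "\<dots> = R ^ 7" by (simp add: power_numeral_reduce)
      finally have sum: "A 1 (?m + r) + \<delta> * (v 0 ^ r mod p) < W" by (rule word_bound) simp
      then have prodW: "\<delta> * (v 0 ^ r mod p) < W" by simp
      have "eval w ?ev v' A' = (A 1 (?m + r) + \<delta> * (v 0 ^ r mod p)) mod p"
        using sum prodW p' by (simp only: eval.simps(2,3) arith_val.simps rd e pm) (simp add: params_def)
      also have "\<dots> = ?f r" by (metis mod_add_right_eq mod_mult_right_eq)
      finally have ev: "eval w ?ev v' A' = ?f r" .
      have "(window ?m r ?f (A 1))(?m + r := ?f r) = window ?m (Suc r) ?f (A 1)"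
        by (auto simp: window_def fun_eq_iff)
      then show "0 < v' 3 \<and> v' 3 \<le> len \<and> v' 18 = r \<and> I (Suc r) (v'(18 := Suc r))
         (A'(1 := (A' 1)(eval w ?ei v' A' mod v' 3 := eval w ?ev v' A')))"
        unfolding ei ev using I v' p' m[OF r] pos by (simp add: I_def params_def)
    qed
  next
    show "\<not> uses_arr (X 11)" by simp
    show "2 * t < W" by (rule two_t_W)
  qed (auto simp: I_def window_def pv[unfolded params_def] fun_eq_iff)
  then show ?thesis by (rule triple_conseq) (auto simp: I_def)
qed

text \<open>Columns are decoded into disjoint blocks of array 2, so each search leaves the earlier
  results alone; and each leaves array 0 at zero, as the next one requires.\<close>

lemma update_columns:
  assumes wv: "words w v0 A0" and pv: "params v0" and zero: "\<And>i. A0 0 i = 0"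
  defines "S \<equiv> \<lambda>j r. A0 1 (j * (2 * t) + r)"
  shows "triple w len (\<lambda>v A. v = v0 \<and> A = A0) (For 12 (X 4) (search (X 8) syndrome_cost 2 (Op Op_Mul (X 12) (X 8))))
     (\<lambda>v A. params v \<and> (\<forall>r. r \<noteq> 2 \<longrightarrow> A r = A0 r) \<and>
        (\<forall>j<n. \<forall>c. (\<forall>l<t. c l < W) \<longrightarrow> mismatches (S j) (block_of (A 2) j) \<le> mismatches (S j) c))"
proof -
  define I where "I j v A \<longleftrightarrow> params v \<and> v 12 = j \<and> (\<forall>r. r \<noteq> 2 \<longrightarrow> A r = A0 r) \<and>
     (\<forall>j'<j. \<forall>c. (\<forall>l<t. c l < W) \<longrightarrow> mismatches (S j') (block_of (A 2) j') \<le> mismatches (S j') c)"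
    for j and v :: vars and A :: arrs
  have nW: "n < W" using n_le by (intro word_bound[of _ 1]) auto
  have "triple w len (\<lambda>v A. v = v0 \<and> A = A0) (For 12 (X 4) (search (X 8) syndrome_cost 2 (Op Op_Mul (X 12) (X 8)))) (I n)"
  proof (rule triple_For)
    fix j assume j: "j < n"
    show "triple w len (I j) (search (X 8) syndrome_cost 2 (Op Op_Mul (X 12) (X 8))) (\<lambda>v A. v 12 = j \<and> I (Suc j) (v(12 := Suc j)) A)"
      unfolding triple_def
    proof (intro allI impI)
      fix v A assume w: "words w v A" and I: "I j v A"
      have p: "params v" and v12: "v 12 = j" and A: "\<forall>r. r \<noteq> 2 \<longrightarrow> A r = A0 r" using I by (auto simp: I_def)
      have jt: "Suc j * t \<le> n * t" using j by (intro mult_le_mono1) simp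
      then have jtl: "j * t + t \<le> len" by simp
      have "j * t < W" using jtl len_W by linarith
      have "\<exists>v' A' b. big_step w len (search (X 8) syndrome_cost 2 (Op Op_Mul (X 12) (X 8))) (v, A) (v', A') \<and> words w v' A' \<and>
         (\<forall>x. x \<notin> scratch \<longrightarrow> v' x = v x) \<and> (\<forall>i<t. b i < W) \<and> A' = A(2 := window (j * t) t b (A 2)) \<and>
         (\<forall>c. (\<forall>i<t. c i < W) \<longrightarrow> eval w syndrome_cost v (A(0 := window 0 t b (A 0))) \<le> eval w syndrome_cost v (A(0 := window 0 t c (A 0))))"
      proof (rule search_correct[OF w])
        show "v 3 = len" "0 < len" using p pos by (auto simp: params_def)
        show "eval w (X 8) v A = t" using p by (simp add: params_def)
        show "eval w (Op Op_Mul (X 12) (X 8)) v A = j * t" using p v12 \<open>j * t < W\<close> by (simp add: params_def)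
        show "A 0 i = 0" for i using A zero by simp
        show "fv syndrome_cost \<inter> scratch = {}" by (simp add: syndrome_cost_def pow_mod_def)
        show "2 \<notin> arrays syndrome_cost" by (simp add: syndrome_cost_def pow_mod_def exp_defs)
      qed (use jtl in simp_all)
      then obtain v' A' b where r: "big_step w len (search (X 8) syndrome_cost 2 (Op Op_Mul (X 12) (X 8))) (v, A) (v', A')"
        "words w v' A'" "\<forall>x. x \<notin> scratch \<longrightarrow> v' x = v x" "\<forall>i<t. b i < W" "A' = A(2 := window (j * t) t b (A 2))"
        "\<And>c. (\<forall>i<t. c i < W) \<Longrightarrow> eval w syndrome_cost v (A(0 := window 0 t b (A 0))) \<le> eval w syndrome_cost v (A(0 := window 0 t c (A 0)))"
        by blast
      have F: "eval w syndrome_cost v (A(0 := window 0 t c (A 0))) = mismatches (S j) c" if "\<forall>i<t. c i < W" for c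
      proof -
        have "words w v (A(0 := window 0 t c (A 0)))" using w that by (auto simp: words_def window_def)
        from eval_syndrome_cost[OF this p v12 j]
        have "eval w syndrome_cost v (A(0 := window 0 t c (A 0))) = mismatches (\<lambda>r. A 1 (j * (2 * t) + r)) (window 0 t c (A 0))"
          by simp
        also have "\<dots> = mismatches (S j) (window 0 t c (A 0))" using A by (simp add: S_def)
        also have "\<dots> = mismatches (S j) c" by (rule mismatches_cong) (simp add: window_def)
        finally show ?thesis .
      qed
      have v'x: "v' x = v x" if "x < 13" for x
      proof -
        have "x \<notin> scratch" using that by auto
        with r(3) show ?thesis by blast
      qed
      have "params v'" "v' 12 = j" using p v12 by (simp_all add: params_def v'x)
      moreover have "A' r = A0 r" if "r \<noteq> 2" for r using A that r(5) by simp
      moreover have "mismatches (S j') (block_of (A' 2) j') \<le> mismatches (S j') c"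
        if j': "j' < Suc j" and c: "\<forall>l<t. c l < W" for j' c
      proof (cases "j' = j")
        case True
        have "mismatches (S j) (block_of (A' 2) j) = mismatches (S j) b"
          by (rule mismatches_cong) (simp add: r(5) block_of_def window_def)
        then show ?thesis using r(6)[OF c] True unfolding F[OF c] F[OF r(4)] by simp
      next
        case False
        then have "Suc j' * t \<le> j * t" using j' by (intro mult_le_mono1) simp
        then have "mismatches (S j') (block_of (A' 2) j') = mismatches (S j') (block_of (A 2) j')"
          by (intro mismatches_cong) (simp add: r(5) block_of_def window_def)
        then show ?thesis using I c False j' by (auto simp: I_def)
      qed
      ultimately have "v' 12 = j \<and> I (Suc j) (v'(12 := Suc j)) A'" by (simp add: I_def)
      with r(1,2) show "\<exists>v' A'. big_step w len (search (X 8) syndrome_cost 2 (Op Op_Mul (X 12) (X 8))) (v, A) (v', A') \<and> words w v' A' \<and>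
         v' 12 = j \<and> I (Suc j) (v'(12 := Suc j)) A'" by blast
    qed
  next
    fix v A assume "v = v0 \<and> A = A0"
    then show "I 0 (v(12 := 0)) A" by (simp add: I_def pv fun_upd_same del: fun_upd_apply)
  next
    fix i v A assume "I i v A" then show "v 12 = i \<and> eval w (X 4) v A = n" by (auto simp: I_def params_def)
  qed (use nW in simp_all)
  then show ?thesis by (rule triple_conseq) (auto simp: I_def)
qed

lemma update_correct:
  assumes wv: "words w v A" and pv: "params v" and ij: "v 0 < n" "v 1 < n" and zero: "\<And>i. A 0 i = 0"
    and S: "\<And>j r. j < n \<Longrightarrow> r < 2 * t \<Longrightarrow> A 1 (j * (2 * t) + r) < p"
    and d: "v 2 = 1 \<and> \<delta> = 1 \<or> v 2 = W - 1 \<and> \<delta> = p - 1"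
  shows "\<exists>v' A'. big_step w len update_com (v, A) (v', A') \<and> words w v' A' \<and> params v' \<and> (\<forall>i. A' 0 i = 0) \<and>
    (\<forall>j<n. \<forall>r<2*t. A' 1 (j * (2 * t) + r) =
       (if j = v 1 then (A 1 (j * (2 * t) + r) + \<delta> * v 0 ^ r) mod p else A 1 (j * (2 * t) + r))) \<and>
    (\<forall>j<n. \<forall>c. (\<forall>l<t. c l < W) \<longrightarrow>
       mismatches (\<lambda>r. A' 1 (j * (2 * t) + r)) (block_of (A' 2) j) \<le> mismatches (\<lambda>r. A' 1 (j * (2 * t) + r)) c) \<and>
    (\<forall>c. (\<forall>i<n * k. c i < W) \<longrightarrow>
       proj_cost n k (int q) (\<lambda>b j. int (gval (A' 2) b j)) (lval (A' 3)) \<le>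
       proj_cost n k (int q) (\<lambda>b j. int (gval (A' 2) b j)) (lval c))"
proof -
  let ?m = "v 1 * (2 * t)"
  let ?A1 = "A(1 := window ?m (2 * t) (\<lambda>r. (A 1 (?m + r) + \<delta> * v 0 ^ r) mod p) (A 1))"
  let ?c1 = "For 18 (X 11) (St 1 (Op Op_Add (Op Op_Mul (X 1) (X 11)) (X 18))
       (Op Op_Mod (Op Op_Add (Rd 1 (Op Op_Add (Op Op_Mul (X 1) (X 11)) (X 18)))
          (Op Op_Mul (IteE (EqE (X 2) (N 1)) (N 1) (Op Op_Sub (X 7) (N 1))) (pow_mod (X 0) (X 18)))) (X 7)))"
  let ?c2 = "For 12 (X 4) (search (X 8) syndrome_cost 2 (Op Op_Mul (X 12) (X 8)))"
  let ?c3 = "search (Op Op_Mul (X 4) (X 5)) proj_cost_exp 3 (N 0)"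
  obtain v1 where 1: "big_step w len ?c1 (v, A) (v1, ?A1)" "words w v1 ?A1" and v1: "\<exists>a. v1 = v(18 := a)"
    using update_syndromes[OF wv pv ij S[OF ij(2)] d] wv unfolding triple_def by blast
  have p1: "params v1" using v1 pv by auto
  have z1: "?A1 0 i = 0" for i using zero by simp
  obtain v2 A2 where 2: "big_step w len ?c2 (v1, ?A1) (v2, A2)" "words w v2 A2" and p2: "params v2"
    and A2: "\<forall>r. r \<noteq> 2 \<longrightarrow> A2 r = ?A1 r"
    and min2: "\<forall>j<n. \<forall>c. (\<forall>l<t. c l < W) \<longrightarrow> mismatches (\<lambda>r. ?A1 1 (j * (2 * t) + r)) (block_of (A2 2) j) \<le> mismatches (\<lambda>r. ?A1 1 (j * (2 * t) + r)) c"
    using update_columns[OF 1(2) p1 z1] 1(2) unfolding triple_def by blast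
  have nkW: "n * k < W" using nk_le_len len_W by (rule le_less_trans)
  have "\<exists>v' A' b. big_step w len ?c3 (v2, A2) (v', A') \<and> words w v' A' \<and>
     (\<forall>x. x \<notin> scratch \<longrightarrow> v' x = v2 x) \<and> (\<forall>i<n * k. b i < W) \<and> A' = A2(3 := window 0 (n * k) b (A2 3)) \<and>
     (\<forall>c. (\<forall>i<n * k. c i < W) \<longrightarrow> eval w proj_cost_exp v2 (A2(0 := window 0 (n * k) b (A2 0))) \<le> eval w proj_cost_exp v2 (A2(0 := window 0 (n * k) c (A2 0))))"
  proof (rule search_correct[OF 2(2)])
    show "v2 3 = len" "0 < len" using p2 pos by (auto simp: params_def)
    show "eval w (Op Op_Mul (X 4) (X 5)) v2 A2 = n * k" using p2 nkW by (simp add: params_def)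
    show "A2 0 i = 0" for i using A2 zero by simp
    show "fv proj_cost_exp \<inter> scratch = {}"
      by (simp add: proj_cost_exp_def square_exp_def defect_exp_def log_exp_def entry_exp_def residue_exp_def Let_def)
    show "3 \<notin> arrays proj_cost_exp"
      by (simp add: proj_cost_exp_def square_exp_def defect_exp_def log_exp_def entry_exp_def residue_exp_def Let_def exp_defs)
  qed (use nk_le_len in simp_all)
  then obtain v3 A3 b where 3: "big_step w len ?c3 (v2, A2) (v3, A3)" "words w v3 A3" and v3: "\<forall>x. x \<notin> scratch \<longrightarrow> v3 x = v2 x"
    and b: "\<forall>i<n * k. b i < W" and A3: "A3 = A2(3 := window 0 (n * k) b (A2 3))"
    and min3: "\<And>c. (\<forall>i<n * k. c i < W) \<Longrightarrow> eval w proj_cost_exp v2 (A2(0 := window 0 (n * k) b (A2 0))) \<le> eval w proj_cost_exp v2 (A2(0 := window 0 (n * k) c (A2 0)))"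
    by blast
  have run: "big_step w len update_com (v, A) (v3, A3)"
    unfolding update_com_def by (intro big_step_Sq[OF 1(1)] big_step_Sq[OF 2(1)] 3(1))
  have p3: "params v3" using p2 v3 by (simp add: params_def)
  let ?g = "\<lambda>b j. int (gval (A2 2) b j)"
  have F: "eval w proj_cost_exp v2 (A2(0 := window 0 (n * k) c (A2 0))) = nat (proj_cost n k (int q) ?g (lval c))"
    if "\<forall>i<n * k. c i < W" for c
  proof -
    have "words w v2 (A2(0 := window 0 (n * k) c (A2 0)))" using 2(2) that by (auto simp: words_def window_def)
    from eval_proj_cost[OF this p2]
    have "eval w proj_cost_exp v2 (A2(0 := window 0 (n * k) c (A2 0))) = nat (proj_cost n k (int q) ?g (lval (window 0 (n * k) c (A2 0))))"
      by simp
    also have "proj_cost n k (int q) ?g (lval (window 0 (n * k) c (A2 0))) = proj_cost n k (int q) ?g (lval c)"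
      by (intro proj_cost_cong lval_cong) (simp add: window_def block_index_less)
    finally show ?thesis .
  qed
  have L3: "proj_cost n k (int q) ?g (lval (A3 3)) = proj_cost n k (int q) ?g (lval b)"
    by (intro proj_cost_cong lval_cong) (simp add: A3 window_def block_index_less)
  \<comment> \<open>The machine compares natural numbers; nonnegativity of \<open>proj_cost\<close>
    transfers the comparison to the integers.\<close>
  have min: "proj_cost n k (int q) ?g (lval (A3 3)) \<le> proj_cost n k (int q) ?g (lval c)" if "\<forall>i<n * k. c i < W" for c
  proof -
    have "nat (proj_cost n k (int q) ?g (lval b)) \<le> nat (proj_cost n k (int q) ?g (lval c))"
      using min3[OF that] unfolding F[OF that] F[OF b] .
    then show ?thesis unfolding L3 using proj_cost_range(1)[of "A2 2" c] by (simp add: nat_le_eq_zle split: if_splits)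
  qed
  have A31: "A3 1 = ?A1 1" "A3 2 = A2 2" "A3 0 = A 0" using A3 A2 by auto
  have syn: "?A1 1 (j * (2 * t) + r) = (if j = v 1 then (A 1 (j * (2 * t) + r) + \<delta> * v 0 ^ r) mod p else A 1 (j * (2 * t) + r))"
    if "r < 2 * t" for j r
  proof (cases "j = v 1")
    case False
    have "\<not> (?m \<le> j * (2 * t) + r \<and> j * (2 * t) + r < ?m + 2 * t)"
    proof (cases "j < v 1")
      case True
      then have "Suc j * (2 * t) \<le> ?m" by (intro mult_le_mono1) simp
      then show ?thesis using that by simp
    next
      case F: False
      then have "Suc (v 1) * (2 * t) \<le> j * (2 * t)" using False by (intro mult_le_mono1) simp
      then show ?thesis by simp
    qed
    then have "window ?m (2 * t) f a (j * (2 * t) + r) = a (j * (2 * t) + r)" for f a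
      unfolding window_def by (rule if_not_P)
    then show ?thesis using False by simp
  qed (use that in \<open>simp add: window_def\<close>)
  show ?thesis
  proof (intro exI[of _ v3] exI[of _ A3] conjI run 3(2) p3)
    show "\<forall>i. A3 0 i = 0" unfolding A31 using zero by blast
    show "\<forall>j<n. \<forall>r<2*t. A3 1 (j * (2 * t) + r) =
       (if j = v 1 then (A 1 (j * (2 * t) + r) + \<delta> * v 0 ^ r) mod p else A 1 (j * (2 * t) + r))"
      unfolding A31 using syn by blast
    show "\<forall>j<n. \<forall>c. (\<forall>l<t. c l < W) \<longrightarrow>
       mismatches (\<lambda>r. A3 1 (j * (2 * t) + r)) (block_of (A3 2) j) \<le> mismatches (\<lambda>r. A3 1 (j * (2 * t) + r)) c"
      unfolding A31 by (rule min2)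
    show "\<forall>c. (\<forall>i<n * k. c i < W) \<longrightarrow>
       proj_cost n k (int q) (\<lambda>b j. int (gval (A3 2) b j)) (lval (A3 3)) \<le>
       proj_cost n k (int q) (\<lambda>b j. int (gval (A3 2) b j)) (lval c)"
      unfolding A31(2) using min by blast
  qed
qed

end

subsection \<open>Quality of the output\<close>

context sketch
begin

definition syndromes :: "(nat \<Rightarrow> int) \<Rightarrow> nat \<Rightarrow> nat" where
  "syndromes x r = nat ((\<Sum>i<n. x i * int i ^ r) mod int p)"

lemma syndromes_cong: "[int (syndromes x r) = (\<Sum>i<n. x i * int i ^ r)] (mod int p)"
  using pos(3) by (simp add: syndromes_def cong_def)

lemma syndromes_less: "syndromes x r < p"
  using pos(3) by (simp add: syndromes_def nat_less_iff)

text \<open>Only the \<open>t\<close> positions named by the words of the candidate can carry a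
  value, whether or not the candidate fits the syndromes.\<close>

lemma support_magnitude: "card {i. i < n \<and> magnitude c i \<noteq> 0} \<le> t"
proof -
  have "{i. i < n \<and> magnitude c i \<noteq> 0} \<subseteq> (\<lambda>l. pos_of (c l)) ` {..<t}"
  proof
    fix i assume i: "i \<in> {i. i < n \<and> magnitude c i \<noteq> 0}"
    have "residue c i \<noteq> 0"
    proof
      assume "residue c i = 0"
      then have "magnitude c i = 0" using pos(3) unfolding magnitude_def by simp
      with i show False by simp
    qed
    then have "(\<Sum>l<t. if pos_of (c l) = i then val_of (c l) else 0) \<noteq> 0"
      unfolding residue_def by (rule contrapos_nn) (simp only: mod_0)
    then have "\<exists>l\<in>{..<t}. (if pos_of (c l) = i then val_of (c l) else 0) \<noteq> 0"
      by (rule contrapos_np) (rule sum.neutral, blast)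
    then obtain l where "l < t" "pos_of (c l) = i" by (auto split: if_splits)
    then show "i \<in> (\<lambda>l. pos_of (c l)) ` {..<t}" by auto
  qed
  then have "card {i. i < n \<and> magnitude c i \<noteq> 0} \<le> card ((\<lambda>l. pos_of (c l)) ` {..<t})"
    by (intro card_mono) auto
  also have "\<dots> \<le> t" using card_image_le[of "{..<t}" "\<lambda>l. pos_of (c l)"] by simp
  finally show ?thesis .
qed

lemma syn_cong_residue: "[int (syn c r) = (\<Sum>i<n. int (residue c i) * int i ^ r)] (mod int p)"
proof -
  have "[int (syn c r) = (\<Sum>l<t. int (val_of (c l)) * int (pos_of (c l)) ^ r)] (mod int p)"
    by (simp add: syn_def cong_def zmod_int)
  also have "(\<Sum>l<t. int (val_of (c l)) * int (pos_of (c l)) ^ r) =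
      (\<Sum>l<t. \<Sum>i<n. if pos_of (c l) = i then int (val_of (c l)) * int i ^ r else 0)"
    by (simp add: pos_of_less)
  also have "\<dots> = (\<Sum>i<n. int (\<Sum>l<t. if pos_of (c l) = i then val_of (c l) else 0) * int i ^ r)"
    by (subst sum.swap) (simp add: sum_distrib_right if_distrib[of int] if_distrib[of "\<lambda>x. x * _"] cong: if_cong)
  also have "[\<dots> = (\<Sum>i<n. int (residue c i) * int i ^ r)] (mod int p)"
    by (intro cong_sum cong_mult cong_refl) (simp add: residue_def cong_def zmod_int)
  finally show ?thesis .
qed

text \<open>A nonzero entry at position \<open>e\<close> with residue \<open>z\<close> becomes the
  word \<open>e + n * z\<close>; the remaining words are 0, which decodes to the value 0 at position
  0 and adds nothing.\<close>

lemma exists_exact_candidate: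
  assumes "card {i. i < n \<and> x i \<noteq> (0::int)} \<le> t"
  shows "\<exists>c. (\<forall>l<t. c l < W) \<and> mismatches (syndromes x) c = 0"
proof -
  define I where "I = {i. i < n \<and> x i \<noteq> 0}"
  have fI: "finite I" by (simp add: I_def)
  obtain e where e: "bij_betw e {..<card I} I" using ex_bij_betw_nat_finite[OF fI] by (auto simp: atLeast0LessThan)
  define z where "z i = nat (x i mod int p)" for i
  have z: "z i < p" "[int (z i) = x i] (mod int p)" for i
    using pos(3) by (simp_all add: z_def nat_less_iff cong_def)
  define c where "c l = (if l < card I then e l + n * z (e l) else 0)" for l
  have eI: "e l < n" if "l < card I" for l using e that by (auto simp: bij_betw_def I_def)
  have cW: "c l < W" for l
  proof (cases "l < card I")
    case True
    have "c l < n * Suc (z (e l))" using eI[OF True] True by (simp add: c_def)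
    also have "\<dots> \<le> R * R ^ 3" using z(1)[of "e l"] n_le p_le by (intro mult_le_mono) auto
    also have "\<dots> = R ^ 4" by (simp add: power_numeral_reduce)
    also have "\<dots> < W" by (rule word_bound) auto
    finally show ?thesis .
  qed (use pos in \<open>simp add: c_def\<close>)
  have pv: "pos_of (c l) = e l" "val_of (c l) = z (e l)" if "l < card I" for l
    using eI[OF that] z(1)[of "e l"] that by (simp_all add: c_def pos_of_def val_of_def)
  have v0: "val_of (c l) = 0" if "\<not> l < card I" for l using that by (simp add: c_def val_of_def)
  have "syn c r = syndromes x r" for r
  proof -
    have "[int (syn c r) = (\<Sum>l<t. int (val_of (c l)) * int (pos_of (c l)) ^ r)] (mod int p)"
      by (simp add: syn_def cong_def zmod_int)
    also have "(\<Sum>l<t. int (val_of (c l)) * int (pos_of (c l)) ^ r) = (\<Sum>l<card I. int (z (e l)) * int (e l) ^ r)"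
      by (rule sum.mono_neutral_cong_right) (use assms pv v0 in \<open>auto simp: I_def\<close>)
    also have "\<dots> = (\<Sum>i\<in>I. int (z i) * int i ^ r)" by (rule sum.reindex_bij_betw[OF e])
    also have "[\<dots> = (\<Sum>i\<in>I. x i * int i ^ r)] (mod int p)" by (intro cong_sum cong_mult cong_refl z)
    also have "(\<Sum>i\<in>I. x i * int i ^ r) = (\<Sum>i<n. x i * int i ^ r)"
      by (rule sum.mono_neutral_left) (auto simp: I_def)
    finally have "[int (syn c r) = int (syndromes x r)] (mod int p)"
      using syndromes_cong[of x r] cong_sym cong_trans by blast
    moreover have "syn c r < p" using pos by (simp add: syn_def)
    ultimately show ?thesis using syndromes_less[of x r] by (simp add: cong_def flip: zmod_int)
  qed
  then have "mismatches (syndromes x) c = 0" by (simp add: mismatches_def)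
  with cW show ?thesis by blast
qed

text \<open>The least cost is 0, so the recovered residues and \<open>x\<close> have the same
  \<open>2 t\<close> power sums, while they can differ in at most \<open>2 t\<close> places; hence
  they agree modulo \<open>p\<close>. As \<open>2 * \<bar>x i\<bar> < p\<close>, the residue is
  \<open>x i\<close> or \<open>x i + p\<close>, and in both cases \<open>magnitude\<close> gives the
  absolute value.\<close>

lemma exact_recovery:
  assumes sparse: "card {i. i < n \<and> x i \<noteq> 0} \<le> t" and bound: "\<And>i. i < n \<Longrightarrow> \<bar>x i\<bar> < int R"
    and min: "\<And>c'. (\<forall>l<t. c' l < W) \<Longrightarrow> mismatches (syndromes x) c \<le> mismatches (syndromes x) c'"
    and i: "i < n"
  shows "int (magnitude c i) = \<bar>x i\<bar>"
proof -
  have "mismatches (syndromes x) c = 0" using exists_exact_candidate[OF sparse] min by fastforce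
  then have syn: "syn c r = syndromes x r" if "r < 2 * t" for r
    using that by (auto simp: mismatches_def split: if_splits)
  define v where "v i = int (residue c i) - x i" for i
  define I where "I = {i. i < n \<and> residue c i \<noteq> 0} \<union> {i. i < n \<and> x i \<noteq> 0}"
  have "{i. i < n \<and> residue c i \<noteq> 0} = {i. i < n \<and> magnitude c i \<noteq> 0}"
  proof -
    have "magnitude c i \<noteq> 0 \<longleftrightarrow> residue c i \<noteq> 0" for i
      using residue_less[of c i] pos(3) unfolding magnitude_def by (cases "residue c i = 0") simp_all
    then show ?thesis by simp
  qed
  then have "card I \<le> 2 * t" using sparse support_magnitude[of c] card_Un_le[of "{i. i < n \<and> residue c i \<noteq> 0}" "{i. i < n \<and> x i \<noteq> 0}"]
    by (simp add: I_def)
  moreover have "finite I" by (simp add: I_def)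
  moreover have "[(\<Sum>i\<in>I. v i * int i ^ r) = 0] (mod int p)" if "r < 2 * t" for r
  proof -
    have "(\<Sum>i\<in>I. v i * int i ^ r) = (\<Sum>i<n. v i * int i ^ r)"
      by (rule sum.mono_neutral_left) (auto simp: I_def v_def)
    also have "\<dots> = (\<Sum>i<n. int (residue c i) * int i ^ r) - (\<Sum>i<n. x i * int i ^ r)"
      by (simp add: v_def left_diff_distrib sum_subtractf)
    also have "[\<dots> = int (syn c r) - int (syndromes x r)] (mod int p)"
      by (intro cong_diff cong_sym[OF syn_cong_residue] cong_sym[OF syndromes_cong])
    finally show ?thesis using syn[OF that] by simp
  qed
  moreover have "j < p" if "j \<in> I" for j using that n_le p_gt by (auto simp: I_def)
  ultimately have "[v j = 0] (mod int p)" if "j \<in> I" for j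
    using power_sums_sparse_zero[of I "2 * t" p v j] p_prime that by blast
  then have "[v i = 0] (mod int p)" by (cases "i \<in> I") (use i in \<open>auto simp: I_def v_def\<close>)
  then have "int p dvd int (residue c i) - x i" by (simp add: v_def cong_0_iff)
  then obtain u where u: "int (residue c i) - x i = int p * u" by (rule dvdE)
  have b: "\<bar>x i\<bar> < int R" "int (residue c i) < int p" "2 * int R < int p"
    using bound[OF i] residue_less[of c i] p_gt by auto
  have "int p * u < int p * 2" using u b by linarith
  then have "u < 2" using pos by simp
  have "int p * (- 1) < int p * u" using u b by linarith
  then have "- 1 < u" using pos mult_less_cancel_left_pos[of "int p" "- 1" u] by simp
  with \<open>u < 2\<close> consider "u = 0" | "u = 1" by linarith
  then show ?thesis
  proof cases
    case 1
    then show ?thesis using u b by (simp add: magnitude_def)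
  next
    case 2
    then show ?thesis using u b by (simp add: magnitude_def)
  qed
qed

text \<open>\<open>column_error\<close> applies with \<open>B = w\<close>, since all magnitudes are
  below \<open>2 ^ w\<close>, and with relative error \<open>4 / R\<close>; the condition of
  \<open>log_int_rel_error\<close> holds because magnitudes are at most \<open>R ^ 3\<close> and
  \<open>Q = R ^ 6\<close>.\<close>

lemma sketch_error:
  fixes X :: "nat \<Rightarrow> nat \<Rightarrow> int"
  defines "M \<equiv> \<lambda>i j. ln (1 + \<bar>real_of_int (X i j)\<bar>)"
  assumes bound: "\<And>i j. i < n \<Longrightarrow> j < n \<Longrightarrow> \<bar>X i j\<bar> < int R"
    and min: "\<And>j c. j < n \<Longrightarrow> (\<forall>l<t. c l < W) \<Longrightarrow>
      mismatches (syndromes (\<lambda>i. X i j)) (block_of Z j) \<le> mismatches (syndromes (\<lambda>i. X i j)) c"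
  shows "(frob n n (\<lambda>i j. M i j - real (gval Z i j) / Q))\<^sup>2 \<le>
    16 / (real R)\<^sup>2 * (frob n n M)\<^sup>2 + 36 * (real w)\<^sup>2 / t * (\<Sum>j<n. (\<Sum>i<n. \<bar>M i j\<bar>)\<^sup>2)"
proof -
  have R0: "0 < real R" using pos by simp
  have lnW: "ln (1 + real y) \<le> real w" if "y < W" for y
  proof -
    have "real (1 + y) \<le> real W" using that by (simp only: of_nat_le_iff)
    then have "ln (1 + real y) \<le> ln (2 ^ w)" by (subst ln_le_cancel_iff) auto
    also have "\<dots> = w * ln 2" by (simp add: ln_realpow)
    also have "\<dots> \<le> real w * 1" using ln_2_less_1 by (intro mult_left_mono) auto
    finally show ?thesis by simp
  qed
  have col: "(\<Sum>i<n. (real (gval Z i j) / Q - M i j)\<^sup>2) \<le>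
      (4 / real R)\<^sup>2 * (\<Sum>i<n. (M i j)\<^sup>2) + 36 * (real w)\<^sup>2 / t * (\<Sum>i<n. \<bar>M i j\<bar>)\<^sup>2" if j: "j < n" for j
    unfolding M_def
  proof (rule column_error)
    show "1 \<le> real w" using w_pos by simp
    show "1 \<le> t" using pos by simp
    show "0 \<le> 4 / real R" "4 / real R \<le> 1" using R_ge by auto
    show "\<forall>i<n. int (magnitude (block_of Z j) i) = \<bar>X i j\<bar>" if "card {i. i < n \<and> X i j \<noteq> 0} \<le> t"
      using exact_recovery[OF that bound min] j by blast
    show "card {i. i < n \<and> magnitude (block_of Z j) i \<noteq> 0} \<le> t" by (rule support_magnitude)
  next
    fix i assume i: "i < n"
    have "nat \<bar>X i j\<bar> < R" using bound[OF i j] by linarith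
    also have "R < W" by (rule word_bound[of _ 1]) auto
    finally show "ln (1 + \<bar>real_of_int (X i j)\<bar>) \<le> real w" using lnW[of "nat \<bar>X i j\<bar>"] by simp
    let ?y = "magnitude (block_of Z j) i"
    have y: "?y \<le> R ^ 3" using magnitude_le p_le by (rule order_trans)
    then have "?y < W" by (rule word_bound) simp
    then show "ln (1 + real ?y) \<le> real w" by (rule lnW)
    have "R ^ 2 * ?y \<le> R ^ 2 * R ^ 3" using y by (rule mult_le_mono2)
    also have "\<dots> \<le> Q" using pos power_increasing[of 5 6 R] by (simp flip: power_add)
    finally have "\<bar>real (log_int R Q ?y) - real Q * ln (1 + real ?y)\<bar> \<le> 4 / R * (real Q * ln (1 + real ?y))"
      using pos by (intro log_int_rel_error) auto
    then have "\<bar>real (gval Z i j) - real Q * ln (1 + real ?y)\<bar> / real Q \<le> 4 / R * (real Q * ln (1 + real ?y)) / real Q"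
      unfolding gval_def by (intro divide_right_mono) auto
    also have "\<dots> = 4 / R * ln (1 + real ?y)" using R0 by simp
    also have "\<bar>real (gval Z i j) - real Q * ln (1 + real ?y)\<bar> / real Q = \<bar>(real (gval Z i j) - real Q * ln (1 + real ?y)) / real Q\<bar>"
      by (simp add: abs_divide)
    also have "(real (gval Z i j) - real Q * ln (1 + real ?y)) / real Q = real (gval Z i j) / Q - ln (1 + real ?y)"
      using R0 by (simp add: diff_divide_distrib)
    finally show "\<bar>real (gval Z i j) / Q - ln (1 + real ?y)\<bar> \<le> 4 / R * ln (1 + real ?y)" .
  qed
  have "(frob n n (\<lambda>i j. M i j - real (gval Z i j) / Q))\<^sup>2 = (\<Sum>j<n. \<Sum>i<n. (real (gval Z i j) / Q - M i j)\<^sup>2)"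
    unfolding frob_sq by (simp add: power2_commute)
  also have "\<dots> \<le> (\<Sum>j<n. (4 / real R)\<^sup>2 * (\<Sum>i<n. (M i j)\<^sup>2) + 36 * (real w)\<^sup>2 / t * (\<Sum>i<n. \<bar>M i j\<bar>)\<^sup>2)"
    by (intro sum_mono col) simp
  also have "\<dots> = 16 / (real R)\<^sup>2 * (frob n n M)\<^sup>2 + 36 * (real w)\<^sup>2 / t * (\<Sum>j<n. (\<Sum>i<n. \<bar>M i j\<bar>)\<^sup>2)"
    unfolding sum.distrib frob_sq sum_distrib_left[symmetric] by (simp add: power_divide)
  finally show ?thesis .
qed

text \<open>The additive error \<open>3 n ^ 3 / Q\<close> has no counterpart in the claim. It is
  charged to the norm of \<open>M\<close>, which is at least \<open>1 / 2\<close> unless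
  \<open>X\<close> vanishes, and that case is treated apart. The constants are
  \<open>64 * 16 + 16 = 1040\<close> and \<open>64 * 36 = 2304\<close>.\<close>

lemma output_error:
  fixes X :: "nat \<Rightarrow> nat \<Rightarrow> int"
  defines "M \<equiv> \<lambda>i j. ln (1 + \<bar>real_of_int (X i j)\<bar>)"
  assumes bound: "\<And>i j. i < n \<Longrightarrow> j < n \<Longrightarrow> \<bar>X i j\<bar> < int R"
    and min: "\<And>j c. j < n \<Longrightarrow> (\<forall>l<t. c l < W) \<Longrightarrow>
      mismatches (syndromes (\<lambda>i. X i j)) (block_of Z j) \<le> mismatches (syndromes (\<lambda>i. X i j)) c"
    and min': "\<And>c. (\<forall>i<n * k. c i < W) \<Longrightarrow>
       proj_cost n k (int q) (\<lambda>b j. int (gval Z b j)) (lval C) \<le> proj_cost n k (int q) (\<lambda>b j. int (gval Z b j)) (lval c)"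
    and B: "B \<in> carrier_mat n n" "vec_space.rank n B \<le> k"
  shows "(frob n n (defect n k (\<lambda>i a. lval C i a / q) M))\<^sup>2 \<le> 10 * (frob n n (\<lambda>i j. M i j - B $$ (i, j)))\<^sup>2 +
    1040 / (real R)\<^sup>2 * (frob n n M)\<^sup>2 + 2304 * (real w)\<^sup>2 / t * (\<Sum>j<n. (\<Sum>i<n. \<bar>M i j\<bar>)\<^sup>2)"
proof (cases "\<forall>i<n. \<forall>j<n. X i j = 0")
  case True
  then have "frob n n (defect n k (\<lambda>i a. lval C i a / q) M) = frob n n (\<lambda>i j. 0)"
    by (intro frob_cong) (simp add: defect_def M_def)
  also have "\<dots> = 0" by (simp add: frob_def L2_set_def)
  finally show ?thesis by (simp add: sum_nonneg)
next
  case False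
  then obtain i0 j0 where ij: "i0 < n" "j0 < n" "X i0 j0 \<noteq> 0" by blast
  define E where "E = frob n n (\<lambda>i j. M i j - real_of_int (int (gval Z i j)) / real Q)"
  define OPT where "OPT = frob n n (\<lambda>i j. M i j - B $$ (i, j))"
  define N12 where "N12 = (\<Sum>j<n. (\<Sum>i<n. \<bar>M i j\<bar>)\<^sup>2)"
  have R: "16 \<le> real R" "real n \<le> real R" using R_ge n_le by simp_all
  have n1: "1 \<le> real n" using pos by simp
  have "frob n n (defect n k (\<lambda>i a. real_of_int (lval C i a) / real_of_int (int q)) M) \<le> OPT + 4 * E
      + 2 * real n ^ 2 / real_of_int (int q) * frob n n M + 3 * real n ^ 3 / real Q"
    unfolding OPT_def E_def
  proof (rule minimiser_near_best[where c = "int (R ^ 9)"])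
    show "1 \<le> k" "k \<le> n" "0 < real Q" using k_pos k_le pos by simp_all
    show "\<bar>lval C i a\<bar> \<le> int q" for i a by (rule lval_abs)
    show "\<bar>int (gval Z i j)\<bar> \<le> int (R ^ 9)" for i j using gval_le by (simp only: abs_of_nat of_nat_le_iff)
    fix l' :: "nat \<Rightarrow> nat \<Rightarrow> int" assume l': "\<And>i a. i < n \<Longrightarrow> a < k \<Longrightarrow> \<bar>l' i a\<bar> \<le> int q"
    \<comment> \<open>A competitor bounded by \<open>q\<close> is shifted by \<open>q\<close> into
      the range of words; \<open>lval\<close> undoes the shift.\<close>
    define c where "c x = nat (l' (x div k) (x mod k) + int q)" for x
    have ranges: "x div k < n" "x mod k < k" if "x < n * k" for x
      using that k_pos by (auto simp: less_mult_imp_div_less)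
    have c: "int (c x) = l' (x div k) (x mod k) + int q" "c x < 2 * q + 1" if "x < n * k" for x
    proof -
      have "int (nat (z + int q')) = z + int q' \<and> nat (z + int q') < 2 * q' + 1" if "\<bar>z\<bar> \<le> int q'" for z q'
        using that by linarith
      from this[OF l'[OF ranges[OF that]]] show "int (c x) = l' (x div k) (x mod k) + int q" "c x < 2 * q + 1"
        unfolding c_def by blast+
    qed
    have "2 * q + 1 \<le> R ^ 12"
    proof -
      have "1 \<le> q" "3 * q \<le> R * q" using R_ge by (simp, intro mult_le_mono1, simp)
      moreover have "R * q = R ^ 12" using power_Suc[of R 11] by simp
      ultimately show ?thesis by linarith
    qed
    then have "2 * q + 1 < W" by (rule word_bound) simp
    then have "\<forall>x<n * k. c x < W" using c(2) less_trans by blast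
    note min'[OF this]
    also have "proj_cost n k (int q) (\<lambda>b j. int (gval Z b j)) (lval c) = proj_cost n k (int q) (\<lambda>b j. int (gval Z b j)) l'"
    proof (rule proj_cost_cong)
      fix i a assume ia: "i < n" "a < k"
      have "i * k + a < n * k" by (rule block_index_less[OF ia])
      from c[OF this] ia show "lval c i a = l' i a" by (simp add: lval_def)
    qed
    finally show "proj_cost n k (int q) (\<lambda>b j. int (gval Z b j)) (lval C) \<le> proj_cost n k (int q) (\<lambda>b j. int (gval Z b j)) l'" .
  next
    have "2 * real n * real R ^ 9 + 3 * real n ^ 3 \<le> 2 * real R * real R ^ 9 + 3 * real R ^ 3"
      using R by (intro add_mono mult_mono power_mono) auto
    also have "\<dots> \<le> 2 * real R ^ 10 + 3 * real R ^ 10"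
      using R power_increasing[of 3 10 "real R"] by (simp add: power_numeral_reduce)
    also have "\<dots> \<le> real R * real R ^ 10" using R by (simp add: mult_right_mono flip: distrib_right)
    also have "\<dots> = real R ^ 11" by (simp add: power_numeral_reduce)
    finally show "2 * real n * real_of_int (int (R ^ 9)) + 3 * real n ^ 3 \<le> real_of_int (int q)" by simp
  qed (use B in auto)
  also have "(\<lambda>i a. real_of_int (lval C i a) / real_of_int (int q)) = (\<lambda>i a. lval C i a / q)" by simp
  finally have D: "frob n n (defect n k (\<lambda>i a. lval C i a / q) M) \<le> OPT + 4 * E
      + 2 * real n ^ 2 / real_of_int (int q) * frob n n M + 3 * real n ^ 3 / real Q" .
  have M: "1 / 2 \<le> frob n n M"
  proof -
    have "nat \<bar>X i0 j0\<bar> \<ge> 1" using ij by linarith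
    from ln_nat_ge_half[OF this] have h: "1 / 2 \<le> M i0 j0" by (simp add: M_def)
    have "\<bar>M i0 j0\<bar> \<le> frob n n M"
      unfolding frob_def using member_le_L2_set[of "{..<n} \<times> {..<n}" "(i0, j0)" "\<lambda>p. M (fst p) (snd p)"] ij by (simp add: M_def)
    with h show ?thesis by linarith
  qed
  have 1: "2 * real n ^ 2 / real_of_int (int q) * frob n n M \<le> 1 / R * frob n n M"
  proof (rule mult_right_mono)
    have "2 * real n ^ 2 * real R \<le> real R * real R ^ 2 * real R" using R by (intro mult_mono power_mono) auto
    also have "\<dots> = real R ^ 4" by (simp add: power_numeral_reduce)
    also have "\<dots> \<le> real R ^ 11" using R by (intro power_increasing) auto
    finally show "2 * real n ^ 2 / real_of_int (int q) \<le> 1 / R" using R by (simp add: field_simps)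
  qed simp
  have 2: "3 * real n ^ 3 / real Q \<le> 1 / R * frob n n M"
  proof -
    have "3 * real n ^ 3 * (2 * real R) = 6 * real n ^ 3 * real R" by simp
    also have "\<dots> \<le> real R * real R ^ 3 * real R" using R by (intro mult_mono power_mono) auto
    also have "\<dots> = real R ^ 5" by (simp add: power_numeral_reduce)
    also have "\<dots> \<le> real R ^ 6" using R by (intro power_increasing) auto
    finally have "3 * real n ^ 3 / real Q \<le> 1 / R * (1 / 2)" using R by (simp add: field_simps)
    also have "\<dots> \<le> 1 / R * frob n n M" using M R by (intro mult_left_mono) auto
    finally show ?thesis .
  qed
  have sq: "(x + y)\<^sup>2 \<le> 2 * x\<^sup>2 + 2 * y\<^sup>2" for x y :: real
    using zero_le_power2[of "x - y"] unfolding power2_sum power2_diff by linarith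
  let ?m = "1 / R * frob n n M" let ?D = "frob n n (defect n k (\<lambda>i a. lval C i a / q) M)"
  \<comment> \<open>Both rounding terms are at most \<open>?m\<close>. Grouping them with
    \<open>4 * E\<close> before squaring keeps the coefficient of \<open>OPT\<^sup>2\<close> at
    2.\<close>
  have "?D \<le> OPT + (4 * E + 2 * ?m)" using D 1 2 by linarith
  then have "?D\<^sup>2 \<le> (OPT + (4 * E + 2 * ?m))\<^sup>2" by (rule power_mono) simp
  also have "\<dots> \<le> 2 * OPT\<^sup>2 + 2 * (4 * E + 2 * ?m)\<^sup>2"
    by (rule sq)
  also have "(4 * E + 2 * ?m)\<^sup>2 \<le> 2 * (4 * E)\<^sup>2 + 2 * (2 * ?m)\<^sup>2"
    by (rule sq)
  also have "2 * (4 * E)\<^sup>2 + 2 * (2 * ?m)\<^sup>2 = 32 * E\<^sup>2 + 8 / (real R)\<^sup>2 * (frob n n M)\<^sup>2"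
    by (simp add: power_mult_distrib power_divide)
  finally have "?D\<^sup>2 \<le> 2 * OPT\<^sup>2 + 64 * E\<^sup>2 + 16 / (real R)\<^sup>2 * (frob n n M)\<^sup>2" by simp
  moreover have "E\<^sup>2 \<le> 16 / (real R)\<^sup>2 * (frob n n M)\<^sup>2 + 36 * (real w)\<^sup>2 / t * N12"
    unfolding E_def N12_def M_def using sketch_error[OF bound min] by simp
  moreover have "0 \<le> OPT\<^sup>2" by simp
  moreover have "1040 / (real R)\<^sup>2 * (frob n n M)\<^sup>2 = 65 * (16 / (real R)\<^sup>2 * (frob n n M)\<^sup>2)"
    "2304 * (real w)\<^sup>2 / t * N12 = 64 * (36 * (real w)\<^sup>2 / t * N12)" by simp_all
  ultimately show ?thesis unfolding OPT_def[symmetric] N12_def[symmetric] by linarith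
qed

end

subsection \<open>Running compiled programs\<close>

lemma steps_halted: "length P \<le> pc \<Longrightarrow> steps w P t (pc, m, out) = return_pmf (pc, m, out)"
  by (induction t) (auto simp: bind_return_pmf)

lemma steps_run:
  assumes "steps w P t (0, m, []) = return_pmf (pc, m', out)" "length P \<le> pc" "t \<le> T"
  shows "run w T P m = return_spmf (m', out)"
proof -
  have "steps w P T (0, m, []) = return_pmf (pc, m', out)"
    using steps_add[of w P t "T - t" "(0, m, [])"] assms by (simp add: bind_return_pmf steps_halted)
  then show ?thesis using assms(2) by (simp add: run_def)
qed

text \<open>There are finitely many memories, and a halting deterministic run has some length, so a
  maximum exists. The budget of an update is existentially quantified, but it must be one number for
  all streams.\<close>

lemma uniform_time:
  assumes "finite Ms"
  shows "\<exists>T0. \<forall>T\<ge>T0. \<forall>m\<in>Ms. \<forall>m' out. reach w P (0, m, []) (length P, m', out) \<longrightarrow> run w T P m = return_spmf (m', out)"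
proof -
  have "\<exists>T0. \<forall>T\<ge>T0. \<forall>m' out. reach w P (0, m, []) (length P, m', out) \<longrightarrow> run w T P m = return_spmf (m', out)" for m
  proof (cases "\<exists>m' out. reach w P (0, m, []) (length P, m', out)")
    case True
    then obtain m1 out1 t1 where 1: "steps w P t1 (0, m, []) = return_pmf (length P, m1, out1)" by (auto simp: reach_def)
    show ?thesis
    proof (intro exI[of _ t1] allI impI)
      fix T m' out assume T: "t1 \<le> T" and "reach w P (0, m, []) (length P, m', out)"
      then obtain t2 where 2: "steps w P t2 (0, m, []) = return_pmf (length P, m', out)" by (auto simp: reach_def)
      have "return_spmf (m1, out1) = return_spmf (m', out)"
        using steps_run[OF 1 order_refl, of "max t1 t2"] steps_run[OF 2 order_refl, of "max t1 t2"] by simp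
      then show "run w T P m = return_spmf (m', out)" using steps_run[OF 1 order_refl T] by simp
    qed
  qed blast
  then obtain f where f: "\<And>m T m' out. f m \<le> T \<Longrightarrow> reach w P (0, m, []) (length P, m', out) \<Longrightarrow> run w T P m = return_spmf (m', out)"
    by metis
  have "f m \<le> Max (f ` Ms)" if "m \<in> Ms" for m using assms that by simp
  then show ?thesis by (intro exI[of _ "Max (f ` Ms)"] allI ballI impI f) (auto intro: order_trans)
qed

lemma compiled_reach:
  assumes "big_step w l c (v, A) (v', A')" "represents w l m v A" "wf_com c" "0 < w"
  shows "\<exists>m'. reach w (comp_com 0 c) (0, m, []) (length (comp_com 0 c), m', []) \<and> represents w l m' v' A'"
  using comp_com_correct[of w l c "(v, A)" "(v', A')" m "comp_com 0 c" 0 "[]"] assms by (simp add: code_at_def)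

lemma finite_memories: "finite {m :: mem. length m = S \<and> set m \<subseteq> {..<2 ^ w}}"
  by (rule finite_subset[OF _ finite_lists_length_eq[of "{..<2 ^ w}" S]]) auto

lemma represents_memory:
  "represents w l m v A \<Longrightarrow> m \<in> {m. length m = 130 + 4 * l \<and> set m \<subseteq> {..<2 ^ w}}"
  by (auto simp: represents_def in_set_conv_nth)

subsection \<open>The query\<close>

text \<open>Written by hand because its time is counted exactly: 8 instructions of preparation, 11
  per entry, 2 to leave the loop. Cell \<open>133 + 4 * i\<close> is index \<open>i\<close> of array
  3; cell 18 holds 0 for the unconditional jump back to 8, and 19 is the end of the program.\<close>

definition query_prog_code :: prog where
  "query_prog_code =
     [Const 12 0, Arith Op_Mul 13 4 5, Arith Op_Add 14 9 9, Const 15 1, Arith Op_Add 14 14 15, Const 16 4,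
      Const 17 133, Const 18 0,
      Arith Op_Less 19 12 13, JumpZ 19 19,
      Arith Op_Mul 20 12 16, Arith Op_Add 20 20 17, Load 20 20, Arith Op_Mod 20 20 14, Arith Op_Sub 20 20 9,
      Emit 20, Emit 9, Arith Op_Add 12 12 15, JumpZ 18 8]"

lemma steps_trans:
  "steps w P a c = return_pmf c' \<Longrightarrow> steps w P b c' = return_pmf c'' \<Longrightarrow> steps w P (a + b) c = return_pmf c''"
  by (simp add: steps_add bind_return_pmf)

lemma steps_one:
  assumes "pc < length P" "\<forall>a\<in>accessed m (P ! pc). a < length m"
    and "exec w (P ! pc) (pc, m, out) = return_pmf c"
  shows "steps w P 1 (pc, m, out) = return_pmf c"
  using assms by (simp add: bind_return_pmf)

context sketch
begin

text \<open>\<open>lval\<close> in two's complement: adding \<open>W - q\<close> subtracts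
  \<open>q\<close> modulo the word size.\<close>

definition numerator :: "nat \<Rightarrow> nat" where
  "numerator c = (c mod (2 * q + 1) + (W - q)) mod W"

lemma q_W: "2 * q + 1 < W"
proof -
  have "1 \<le> q" "3 * q \<le> R * q" using R_ge by (simp, intro mult_le_mono1, simp)
  moreover have "R * q = R ^ 12" using power_Suc[of R 11] by simp
  ultimately have "2 * q + 1 \<le> R ^ 12" by linarith
  then show ?thesis by (rule word_bound) simp
qed

definition query_state :: "nat \<Rightarrow> arrs \<Rightarrow> mem \<Rightarrow> bool" where
  "query_state i A m \<longleftrightarrow> (\<exists>v. represents w len m v A \<and> v 9 = q \<and> v 12 = i \<and> v 13 = n * k \<and> v 14 = 2 * q + 1 \<and>
     v 15 = 1 \<and> v 16 = 4 \<and> v 17 = 133 \<and> v 18 = 0)"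

definition emitted :: "arrs \<Rightarrow> nat \<Rightarrow> nat list" where
  "emitted A i = concat (map (\<lambda>x. [numerator (A 3 x), q]) [0..<i])"

lemma query_start:
  assumes "represents w len m v A" "params v"
  shows "\<exists>m'. steps w query_prog_code 8 (0, m, []) = return_pmf (8, m', []) \<and> query_state 0 A m'"
proof -
  let ?c = "[Const 12 0, Arith Op_Mul 13 4 5, Arith Op_Add 14 9 9, Const 15 1, Arith Op_Add 14 14 15, Const 16 4,
      Const 17 133, Const 18 0]"
  have l: "length m = 130 + 4 * len" "130 + 4 * len \<le> W" using assms(1) by (auto simp: represents_def)
  have l1: "1 \<le> len" using pos by simp
  have c: "133 < W" "4 < W" "n * k < W" using l l1 nk_le_len by linarith+
  have m: "m ! 4 = n" "m ! 5 = k" "m ! 9 = q" using assms by (auto simp: represents_def params_def)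
  have qW: "q + q < W" "Suc (q + q) < W" "2 * q < W" using q_W by linarith+
  have "block w ?c m = Some (m[12 := 0, 13 := n * k, 14 := 2 * q, 15 := 1, 14 := 2 * q + 1, 16 := 4, 17 := 133, 18 := 0])"
    using l c m qW pos(5) w_pos by (simp add: mult_2)
  moreover have "code_at query_prog_code 0 ?c" by (simp add: code_at_def query_prog_code_def nth_append All_less_Suc numeral_nat)
  ultimately have "steps w query_prog_code (length ?c) (0, m, []) =
      return_pmf (0 + length ?c, m[12 := 0, 13 := n * k, 14 := 2 * q, 15 := 1, 14 := 2 * q + 1, 16 := 4, 17 := 133, 18 := 0], [])"
    by (rule steps_block)
  moreover have "represents w len (m[12 := 0, 13 := n * k, 14 := 2 * q, 15 := 1, 14 := 2 * q + 1, 16 := 4, 17 := 133, 18 := 0])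
      (v(12 := 0, 13 := n * k, 14 := 2 * q, 15 := 1, 14 := 2 * q + 1, 16 := 4, 17 := 133, 18 := 0)) A"
    by (intro represents_var assms(1)) (use c qW pos in auto)
  then have "query_state 0 A (m[12 := 0, 13 := n * k, 14 := 2 * q, 15 := 1, 14 := 2 * q + 1, 16 := 4, 17 := 133, 18 := 0])"
    unfolding query_state_def by (intro exI, intro conjI) (assumption, use assms(2) in \<open>simp_all add: params_def\<close>)
  moreover have l8: "length ?c = 8" by simp
  ultimately show ?thesis unfolding l8 by (simp only: add_0) blast
qed

lemma query_iteration:
  assumes st: "query_state i A m" and i: "i < n * k"
  shows "\<exists>m'. steps w query_prog_code 11 (8, m, out) = return_pmf (8, m', out @ [numerator (A 3 i), q]) \<and> query_state (Suc i) A m'"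
proof -
  let ?P = query_prog_code
  obtain v where rep: "represents w len m v A" and v: "v 9 = q" "v 12 = i" "v 13 = n * k" "v 14 = 2 * q + 1"
     "v 15 = 1" "v 16 = 4" "v 17 = 133" "v 18 = 0" using st by (auto simp: query_state_def)
  have l: "length m = 130 + 4 * len" "130 + 4 * len \<le> W" using rep by (auto simp: represents_def)
  have il: "i < len" using i nk_le_len by (rule less_le_trans)
  have iW: "i * 4 + 133 < W" "i * 4 < W" "Suc i < W" using il l by linarith+
  have m: "m ! 9 = q" "m ! 12 = i" "m ! 13 = n * k" "m ! 14 = 2 * q + 1" "m ! 15 = 1" "m ! 16 = 4" "m ! 17 = 133" "m ! 18 = 0"
    using rep v by (auto simp: represents_def)
  have a: "m ! (i * 4 + 133) = A 3 i"
  proof -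
    have "\<forall>r<4. \<forall>i<len. m ! (130 + 4 * i + r) = A r i" using rep unfolding represents_def by blast
    from this[rule_format, of 3 i] have "m ! (130 + 4 * i + 3) = A 3 i" using il by simp
    then show ?thesis by (simp add: ac_simps)
  qed
  let ?m1 = "m[19 := 1]"
  let ?m2 = "m[19 := 1, 20 := numerator (A 3 i)]"
  let ?m3 = "m[19 := 1, 20 := numerator (A 3 i), 12 := Suc i]"
  have nW: "numerator (A 3 i) < W" using pos by (simp add: numerator_def)
  have s1: "steps w ?P 1 (8, m, out) = return_pmf (9, ?m1, out)"
    by (rule steps_one) (use l m i in \<open>simp_all add: query_prog_code_def\<close>)
  have s2: "steps w ?P 1 (9, ?m1, out) = return_pmf (10, ?m1, out)"
    by (rule steps_one) (use l in \<open>simp_all add: query_prog_code_def\<close>)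
  let ?c = "[Arith Op_Mul 20 12 16, Arith Op_Add 20 20 17, Load 20 20, Arith Op_Mod 20 20 14, Arith Op_Sub 20 20 9]"
  have s3: "steps w ?P (length ?c) (10, ?m1, out) = return_pmf (10 + length ?c, ?m2, out)"
  proof (rule steps_block)
    show "block w ?c ?m1 = Some ?m2" using l m a iW il by (simp add: numerator_def)
    show "code_at ?P 10 ?c" by (simp add: query_prog_code_def)
  qed
  have s4: "steps w ?P 1 (15, ?m2, out) = return_pmf (16, ?m2, out @ [numerator (A 3 i)])"
    by (rule steps_one) (use l in \<open>simp_all add: query_prog_code_def\<close>)
  have s5: "steps w ?P 1 (16, ?m2, out @ [numerator (A 3 i)]) = return_pmf (17, ?m2, out @ [numerator (A 3 i), q])"
    by (rule steps_one) (use l m in \<open>simp_all add: query_prog_code_def\<close>)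
  have s6: "steps w ?P 1 (17, ?m2, out @ [numerator (A 3 i), q]) = return_pmf (18, ?m3, out @ [numerator (A 3 i), q])"
    by (rule steps_one) (use l m iW in \<open>simp_all add: query_prog_code_def\<close>)
  have s7: "steps w ?P 1 (18, ?m3, out @ [numerator (A 3 i), q]) = return_pmf (8, ?m3, out @ [numerator (A 3 i), q])"
    by (rule steps_one) (use l m in \<open>simp_all add: query_prog_code_def\<close>)
  have s3': "steps w ?P 5 (10, ?m1, out) = return_pmf (15, ?m2, out)"
  proof -
    have l5: "length ?c = 5" by simp
    show ?thesis using s3[unfolded l5] by (simp del: steps.simps)
  qed
  have "steps w ?P (1 + (1 + (5 + (1 + (1 + (1 + 1)))))) (8, m, out) = return_pmf (8, ?m3, out @ [numerator (A 3 i), q])"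
    by (rule steps_trans[OF s1 steps_trans[OF s2 steps_trans[OF s3' steps_trans[OF s4 steps_trans[OF s5 steps_trans[OF s6 s7]]]]]])
  moreover have "represents w len ?m3 (v(19 := 1, 20 := numerator (A 3 i), 12 := Suc i)) A"
    by (intro represents_var rep) (use iW nW pos in auto)
  then have "query_state (Suc i) A ?m3" unfolding query_state_def by (intro exI, intro conjI) (assumption, use v in simp_all)
  ultimately show ?thesis by auto
qed

lemma query_correct:
  assumes "represents w len m v A" "params v" "11 * (n * k) + 10 \<le> T"
  shows "\<exists>m'. run w T query_prog_code m = return_spmf (m', emitted A (n * k))"
proof -
  have "\<exists>m'. steps w query_prog_code (8 + 11 * i) (0, m, []) = return_pmf (8, m', emitted A i) \<and> query_state i A m'"
    if "i \<le> n * k" for i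
    using that
  proof (induction i)
    case 0
    then show ?case using query_start[OF assms(1,2)] by (simp add: emitted_def)
  next
    case (Suc i)
    then obtain m1 where 1: "steps w query_prog_code (8 + 11 * i) (0, m, []) = return_pmf (8, m1, emitted A i)" "query_state i A m1"
      by auto
    obtain m2 where 2: "steps w query_prog_code 11 (8, m1, emitted A i) = return_pmf (8, m2, emitted A i @ [numerator (A 3 i), q])"
      "query_state (Suc i) A m2"
      using query_iteration[OF 1(2)] Suc.prems by auto
    have "steps w query_prog_code (8 + 11 * i + 11) (0, m, []) = return_pmf (8, m2, emitted A (Suc i))"
      using steps_trans[OF 1(1) 2(1)] by (simp add: emitted_def)
    with 2(2) show ?case by (intro exI[of _ m2]) (simp add: ac_simps)
  qed
  from this[OF order_refl] obtain m1 where 1: "steps w query_prog_code (8 + 11 * (n * k)) (0, m, []) = return_pmf (8, m1, emitted A (n * k))"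
    and st: "query_state (n * k) A m1" by blast
  have m: "length m1 \<ge> 130" "m1 ! 12 = n * k" "m1 ! 13 = n * k" using st by (auto simp: query_state_def represents_def)
  let ?out = "emitted A (n * k)"
  have s1: "steps w query_prog_code 1 (8, m1, ?out) = return_pmf (9, m1[19 := 0], ?out)"
    by (rule steps_one) (use m in \<open>simp_all add: query_prog_code_def\<close>)
  have s2: "steps w query_prog_code 1 (9, m1[19 := 0], ?out) = return_pmf (19, m1[19 := 0], ?out)"
    by (rule steps_one) (use m in \<open>simp_all add: query_prog_code_def\<close>)
  have "steps w query_prog_code (8 + 11 * (n * k) + (1 + 1)) (0, m, []) = return_pmf (19, m1[19 := 0], ?out)"
    by (rule steps_trans[OF 1 steps_trans[OF s1 s2]])
  from steps_run[OF this, of T] show ?thesis using assms(3) by (auto simp: query_prog_code_def)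
qed

lemma length_emitted: "length (emitted A i) = 2 * i"
  by (induction i) (simp_all add: emitted_def)

lemma emitted_nth: "x < i \<Longrightarrow> emitted A i ! (2 * x) = numerator (A 3 x) \<and> emitted A i ! (2 * x + 1) = q"
proof (induction i)
  case (Suc i)
  have s: "emitted A (Suc i) = emitted A i @ [numerator (A 3 i), q]" by (simp add: emitted_def)
  show ?case
  proof (cases "x = i")
    case True
    then show ?thesis by (simp add: s nth_append length_emitted)
  next
    case False
    then have "x < i" using Suc.prems by simp
    then show ?thesis using Suc.IH by (simp add: s nth_append length_emitted)
  qed
qed simp

text \<open>From \<open>2 * q + 1 < W\<close> the integer lies in the signed range of
  \<open>w\<close> bits, so sign extension from bit \<open>w - 1\<close> restores it.\<close>

lemma decode_numerator:
  "signed_take_bit (w - 1) (int (numerator c)) = int (c mod (2 * q + 1)) - int q"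
proof -
  let ?z = "int (c mod (2 * q + 1)) - int q"
  have Sw: "Suc (w - 1) = w" using w_pos by simp
  have q: "q < W" using q_W by linarith
  then have "int (numerator c) = (?z + 2 ^ w) mod 2 ^ w"
    by (simp add: numerator_def zmod_int of_nat_diff algebra_simps)
  then have "take_bit w (int (numerator c)) = take_bit w ?z" by (simp add: take_bit_eq_mod)
  then have "signed_take_bit (w - 1) (int (numerator c)) = signed_take_bit (w - 1) ?z"
    unfolding signed_take_bit_eq_iff_take_bit_eq Sw .
  also have "\<dots> = ?z"
  proof (rule signed_take_bit_int_eq_self)
    have "(2::int) ^ w = 2 * 2 ^ (w - 1)" using Sw power_Suc[of "2::int" "w - 1"] by simp
    moreover have "2 * int q + 1 < 2 ^ w" using q_W by (metis (mono_tags) of_nat_1 of_nat_add of_nat_less_iff of_nat_mult of_nat_numeral of_nat_power)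
    ultimately have "int q < 2 ^ (w - 1)" by linarith
    moreover have "\<bar>?z\<bar> \<le> int q" using lval_abs[of "\<lambda>_. c" 0 0] by (simp add: lval_def)
    ultimately show "- (2 ^ (w - 1)) \<le> ?z" "?z < 2 ^ (w - 1)" by linarith+
  qed
  finally show ?thesis .
qed

lemma decode_emitted:
  "decode_mat w n k (emitted A (n * k)) = mat n k (\<lambda>(i, a). lval (A 3) i a / q)"
  unfolding decode_mat_def
proof (rule cong_mat)
  fix i a assume ia: "i < n" "a < k"
  then have e: "emitted A (n * k) ! (2 * (i * k + a)) = numerator (A 3 (i * k + a))"
    "emitted A (n * k) ! (2 * (i * k + a) + 1) = q"
    using emitted_nth[OF block_index_less[OF ia], of A] by blast+
  show "(case (i, a) of (i, j) \<Rightarrow> real_of_int (signed_take_bit (w - 1) (int (emitted A (n * k) ! (2 * (i * k + j)))))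
      / real (emitted A (n * k) ! (2 * (i * k + j) + 1))) = (case (i, a) of (i, a) \<Rightarrow> lval (A 3) i a / q)"
    unfolding prod.case e decode_numerator lval_def ..
qed auto

end

subsection \<open>Processing a stream\<close>

fun increment :: "nat \<Rightarrow> nat \<Rightarrow> update \<Rightarrow> int" where
  "increment i j (i', j', d) = (if i = i' \<and> j = j' then d else 0)"

definition entry :: "update list \<Rightarrow> nat \<Rightarrow> nat \<Rightarrow> int" where
  "entry us i j = (\<Sum>u\<leftarrow>us. increment i j u)"

lemma entry_snoc: "entry (us @ [u]) i j = entry us i j + increment i j u"
  by (simp add: entry_def)

lemma entry_Nil [simp]: "entry [] i j = 0" by (simp add: entry_def)

lemma stream_mat_entry: "stream_mat n us = mat n n (\<lambda>(i, j). real_of_int (entry us i j))"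
proof (induction us rule: rev_induct)
  case (snoc u us)
  obtain a b d where u: "u = (a, b, d)" by (cases u) auto
  have "stream_mat n (us @ [u]) = apply_update u (stream_mat n us)" by (simp add: stream_mat_def)
  then show ?case unfolding snoc u by (intro eq_matI) (auto simp: entry_snoc)
qed (auto simp: stream_mat_def)

lemma entry_abs_le:
  assumes "\<forall>u\<in>set us. valid_update n u"
  shows "\<bar>entry us i j\<bar> \<le> int (length us)"
  using assms
proof (induction us rule: rev_induct)
  case (snoc u us)
  obtain a b d where u: "u = (a, b, d)" by (cases u) auto
  have "\<bar>increment i j u\<bar> \<le> 1" using snoc.prems by (auto simp: u)
  with snoc show ?case by (simp add: entry_snoc)
qed simp

lemma log_mat_stream: "log_mat (stream_mat n us) = mat n n (\<lambda>(i, j). ln (1 + \<bar>real_of_int (entry us i j)\<bar>))"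
  unfolding stream_mat_entry log_mat_def by (intro eq_matI) (auto simp: add.commute)

lemma fro_norm_fn: "A \<in> carrier_mat n m \<Longrightarrow> fro_norm A = frob n m (\<lambda>i j. A $$ (i, j))"
proof (rule power2_eq_imp_eq)
  assume A: "A \<in> carrier_mat n m"
  have "(fro_norm A)\<^sup>2 = (\<Sum>i<n. \<Sum>j<m. (A $$ (i, j))\<^sup>2)"
    using A by (simp add: fro_norm_def sum_nonneg)
  also have "\<dots> = (frob n m (\<lambda>i j. A $$ (i, j)))\<^sup>2" unfolding frob_sq by (rule sum.swap)
  finally show "(fro_norm A)\<^sup>2 = (frob n m (\<lambda>i j. A $$ (i, j)))\<^sup>2" .
qed (simp_all add: fro_norm_def sum_nonneg)

lemma fro_norm_defect:
  fixes L :: "nat \<Rightarrow> nat \<Rightarrow> real" and M :: "nat \<Rightarrow> nat \<Rightarrow> real" and n k :: nat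
  defines "Lm \<equiv> mat n k (\<lambda>(i, a). L i a)" and "Mm \<equiv> mat n n (\<lambda>(i, j). M i j)"
  shows "fro_norm (Lm * transpose_mat Lm * Mm - Mm) = frob n n (defect n k L M)"
proof -
  have carr: "Lm \<in> carrier_mat n k" "Mm \<in> carrier_mat n n" by (simp_all add: Lm_def Mm_def)
  then have eq: "Lm * transpose_mat Lm * Mm = Lm * (transpose_mat Lm * Mm)" by (intro assoc_mult_mat) auto
  have "(Lm * (transpose_mat Lm * Mm) - Mm) $$ (i, j) = defect n k L M i j" if "i < n" "j < n" for i j
    using that by (simp add: Lm_def Mm_def defect_def scalar_prod_def lessThan_atLeast0)
  then have "frob n n (\<lambda>i j. (Lm * (transpose_mat Lm * Mm) - Mm) $$ (i, j)) = frob n n (defect n k L M)"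
    by (intro frob_cong)
  moreover have "Lm * (transpose_mat Lm * Mm) - Mm \<in> carrier_mat n n" using carr by auto
  ultimately show ?thesis unfolding eq by (simp add: fro_norm_fn)
qed

context sketch
begin

text \<open>What one update hands to the next: syndromes and parameters only, since arrays 2 and 3
  are computed afresh each time.\<close>

definition inv_state :: "update list \<Rightarrow> mem \<Rightarrow> bool" where
  "inv_state us m \<longleftrightarrow> (\<exists>v A. represents w len m v A \<and> words w v A \<and> params v \<and> (\<forall>i. A 0 i = 0) \<and>
     (\<forall>j<n. \<forall>r<2*t. A 1 (j * (2 * t) + r) = syndromes (\<lambda>i. entry us i j) r))"

text \<open>What the query relies on. Before the first update no search has run and nothing is
  asserted about arrays 2 and 3; but then \<open>M\<close> is zero and every \<open>L\<close> has
  error 0.\<close>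

definition out_state :: "update list \<Rightarrow> mem \<Rightarrow> bool" where
  "out_state us m \<longleftrightarrow> (\<exists>v A. represents w len m v A \<and> params v \<and> (us \<noteq> [] \<longrightarrow>
     (\<forall>j<n. \<forall>c. (\<forall>l<t. c l < W) \<longrightarrow>
        mismatches (syndromes (\<lambda>i. entry us i j)) (block_of (A 2) j) \<le> mismatches (syndromes (\<lambda>i. entry us i j)) c) \<and>
     (\<forall>c. (\<forall>i<n * k. c i < W) \<longrightarrow>
       proj_cost n k (int q) (\<lambda>b j. int (gval (A 2) b j)) (lval (A 3)) \<le>
       proj_cost n k (int q) (\<lambda>b j. int (gval (A 2) b j)) (lval c))))"

lemma syndromes_update:
  assumes "a < n" "d = 1 \<and> \<delta> = 1 \<or> d = - 1 \<and> \<delta> = p - 1"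
  shows "syndromes (\<lambda>i. x i + (if i = a then d else 0)) r = (syndromes x r + \<delta> * a ^ r) mod p"
proof -
  have d: "[int \<delta> = d] (mod int p)" using assms(2) pos by (auto simp: cong_def of_nat_diff)
  have "[int (syndromes (\<lambda>i. x i + (if i = a then d else 0)) r) = (\<Sum>i<n. (x i + (if i = a then d else 0)) * int i ^ r)] (mod int p)"
    by (rule syndromes_cong)
  also have "(\<Sum>i<n. (x i + (if i = a then d else 0)) * int i ^ r) = (\<Sum>i<n. x i * int i ^ r) + d * int a ^ r"
    using assms(1) by (simp add: distrib_right sum.distrib if_distrib[of "\<lambda>y. y * _"] cong: if_cong)
  also have "[\<dots> = int (syndromes x r) + int \<delta> * int a ^ r] (mod int p)"
    by (intro cong_add cong_mult cong_refl cong_sym[OF d] cong_sym[OF syndromes_cong])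
  finally have "[int (syndromes (\<lambda>i. x i + (if i = a then d else 0)) r) = int (syndromes x r + \<delta> * a ^ r)] (mod int p)"
    by simp
  then have "[syndromes (\<lambda>i. x i + (if i = a then d else 0)) r = syndromes x r + \<delta> * a ^ r] (mod p)"
    by (simp only: cong_int_iff)
  then show ?thesis using syndromes_less by (simp add: cong_def)
qed

lemma update_step:
  assumes inv: "inv_state us m" and u: "valid_update n u"
  shows "\<exists>m'. reach w (comp_com 0 update_com) (0, load_update w u m, []) (length (comp_com 0 update_com), m', []) \<and>
    load_update w u m \<in> {m. length m = 130 + 4 * len \<and> set m \<subseteq> {..<2 ^ w}} \<and>
    inv_state (us @ [u]) m' \<and> out_state (us @ [u]) m'"
proof -
  obtain a b d where u_def: "u = (a, b, d)" by (cases u) auto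
  have ab: "a < n" "b < n" "d = 1 \<or> d = - 1" using u by (auto simp: u_def)
  obtain v A where rep: "represents w len m v A" and wv: "words w v A" and pv: "params v" and zero: "\<forall>i. A 0 i = 0"
    and syn: "\<forall>j<n. \<forall>r<2*t. A 1 (j * (2 * t) + r) = syndromes (\<lambda>i. entry us i j) r"
    using inv by (auto simp: inv_state_def)
  have nW: "n < W" using n_le by (intro word_bound[of _ 1]) auto
  define e where "e = nat (d mod 2 ^ w)"
  define \<delta> where "\<delta> = (if d = 1 then 1 else p - 1)"
  have eW: "e < W" by (simp add: e_def nat_less_iff)
  have W2: "(1::int) < 2 ^ w" using pos(5) by (metis of_nat_1 of_nat_less_iff of_nat_numeral of_nat_power)
  have e: "e = 1 \<and> \<delta> = 1 \<or> e = W - 1 \<and> \<delta> = p - 1"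
  proof (cases "d = 1")
    case True
    then show ?thesis using W2 w_pos by (simp add: e_def \<delta>_def)
  next
    case False
    then have "d = - 1" using ab by simp
    then have "d mod 2 ^ w = 2 ^ w - 1" using W2 by (simp add: zmod_minus1)
    then show ?thesis using False by (simp add: e_def \<delta>_def nat_diff_distrib nat_power_eq)
  qed
  let ?v = "v(0 := a, 1 := b, 2 := e)"
  have lm: "load_update w u m = m[0 := a, 1 := b, 2 := e]" using ab nW by (simp add: u_def e_def)
  have rep': "represents w len (load_update w u m) ?v A"
    unfolding lm by (intro represents_var rep) (use ab nW eW in auto)
  have wv': "words w ?v A" using wv ab nW eW by auto
  have pv': "params ?v" using pv by (simp add: params_def)
  have "\<exists>v' A'. big_step w len update_com (?v, A) (v', A') \<and> words w v' A' \<and> params v' \<and> (\<forall>i. A' 0 i = 0) \<and>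
    (\<forall>j<n. \<forall>r<2*t. A' 1 (j * (2 * t) + r) =
       (if j = ?v 1 then (A 1 (j * (2 * t) + r) + \<delta> * ?v 0 ^ r) mod p else A 1 (j * (2 * t) + r))) \<and>
    (\<forall>j<n. \<forall>c. (\<forall>l<t. c l < W) \<longrightarrow>
       mismatches (\<lambda>r. A' 1 (j * (2 * t) + r)) (block_of (A' 2) j) \<le> mismatches (\<lambda>r. A' 1 (j * (2 * t) + r)) c) \<and>
    (\<forall>c. (\<forall>i<n * k. c i < W) \<longrightarrow>
       proj_cost n k (int q) (\<lambda>b j. int (gval (A' 2) b j)) (lval (A' 3)) \<le>
       proj_cost n k (int q) (\<lambda>b j. int (gval (A' 2) b j)) (lval c))"
  proof (rule update_correct[OF wv' pv'])
    show "?v 0 < n" "?v 1 < n" using ab by auto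
    show "A 0 i = 0" for i using zero by simp
    show "A 1 (j * (2 * t) + r) < p" if "j < n" "r < 2 * t" for j r using syn syndromes_less that by simp
    show "?v 2 = 1 \<and> \<delta> = 1 \<or> ?v 2 = W - 1 \<and> \<delta> = p - 1" using e by simp
  qed
  then obtain v' A' where r: "big_step w len update_com (?v, A) (v', A')" "words w v' A'" "params v'" "\<forall>i. A' 0 i = 0"
    and S: "\<And>j r. j < n \<Longrightarrow> r < 2*t \<Longrightarrow> A' 1 (j * (2 * t) + r) =
       (if j = ?v 1 then (A 1 (j * (2 * t) + r) + \<delta> * ?v 0 ^ r) mod p else A 1 (j * (2 * t) + r))"
    and min1: "\<And>j c. j < n \<Longrightarrow> (\<forall>l<t. c l < W) \<Longrightarrow>
       mismatches (\<lambda>r. A' 1 (j * (2 * t) + r)) (block_of (A' 2) j) \<le> mismatches (\<lambda>r. A' 1 (j * (2 * t) + r)) c"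
    and min2: "\<And>c. (\<forall>i<n * k. c i < W) \<Longrightarrow>
       proj_cost n k (int q) (\<lambda>b j. int (gval (A' 2) b j)) (lval (A' 3)) \<le>
       proj_cost n k (int q) (\<lambda>b j. int (gval (A' 2) b j)) (lval c)" by blast
  have S': "A' 1 (j * (2 * t) + r) = syndromes (\<lambda>i. entry (us @ [u]) i j) r" if jr: "j < n" "r < 2 * t" for j r
  proof (cases "j = b")
    case True
    have "(\<lambda>i. entry (us @ [u]) i j) = (\<lambda>i. entry us i j + (if i = a then d else 0))"
      using True by (auto simp: entry_snoc u_def)
    moreover have "d = 1 \<and> \<delta> = 1 \<or> d = - 1 \<and> \<delta> = p - 1" using ab by (auto simp: \<delta>_def)
    ultimately have "syndromes (\<lambda>i. entry (us @ [u]) i j) r = (syndromes (\<lambda>i. entry us i j) r + \<delta> * a ^ r) mod p"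
      using syndromes_update[OF ab(1)] by simp
    then show ?thesis using S[OF jr] syn jr True by simp
  next
    case False
    then have "(\<lambda>i. entry (us @ [u]) i j) = (\<lambda>i. entry us i j)" by (auto simp: entry_snoc u_def)
    then show ?thesis using S[OF jr] syn jr False by simp
  qed
  have mm: "mismatches (\<lambda>r. A' 1 (j * (2 * t) + r)) c = mismatches (syndromes (\<lambda>i. entry (us @ [u]) i j)) c" if "j < n" for j c
    unfolding mismatches_def using S'[OF that] by (intro sum.cong refl) simp
  obtain m' where m': "reach w (comp_com 0 update_com) (0, load_update w u m, []) (length (comp_com 0 update_com), m', [])"
    "represents w len m' v' A'"
    using compiled_reach[OF r(1) rep' wf_update w_pos] by blast
  have "inv_state (us @ [u]) m'" unfolding inv_state_def using m'(2) r S' by blast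
  moreover have "out_state (us @ [u]) m'" unfolding out_state_def using m'(2) r(3) min1 min2 mm by metis
  ultimately show ?thesis using m'(1) represents_memory[OF rep'] by blast
qed

lemma output_quality:
  assumes out: "out_state us m" and valid: "\<forall>u\<in>set us. valid_update n u" and len_us: "length us < R"
    and T: "11 * (n * k) + 10 \<le> T"
  shows "\<exists>m' out. run w T query_prog_code m = return_spmf (m', out) \<and> length out = 2 * (n * k) \<and>
    (\<forall>B. best_rank_approx k (log_mat (stream_mat n us)) B \<longrightarrow>
      (let M = log_mat (stream_mat n us); L = decode_mat w n k out in
       (fro_norm (L * transpose_mat L * M - M))\<^sup>2 \<le> 10 * (fro_norm (M - B))\<^sup>2 +
         1040 / (real R)\<^sup>2 * (fro_norm M)\<^sup>2 + 2304 * (real w)\<^sup>2 / t * (norm12 M)\<^sup>2))"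
proof -
  obtain v A where rep: "represents w len m v A" and pv: "params v" and
    min: "us \<noteq> [] \<longrightarrow>
     (\<forall>j<n. \<forall>c. (\<forall>l<t. c l < W) \<longrightarrow>
        mismatches (syndromes (\<lambda>i. entry us i j)) (block_of (A 2) j) \<le> mismatches (syndromes (\<lambda>i. entry us i j)) c) \<and>
     (\<forall>c. (\<forall>i<n * k. c i < W) \<longrightarrow>
       proj_cost n k (int q) (\<lambda>b j. int (gval (A 2) b j)) (lval (A 3)) \<le>
       proj_cost n k (int q) (\<lambda>b j. int (gval (A 2) b j)) (lval c))"
    using out by (auto simp: out_state_def)
  obtain m' where run: "run w T query_prog_code m = return_spmf (m', emitted A (n * k))"
    using query_correct[OF rep pv T] by blast
  define M where "M = log_mat (stream_mat n us)"
  define f where "f i j = ln (1 + \<bar>real_of_int (entry us i j)\<bar>)" for i j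
  have M: "M = mat n n (\<lambda>(i, j). f i j)" by (simp add: M_def f_def log_mat_stream)
  have MC: "M \<in> carrier_mat n n" by (simp add: M)
  have fM: "fro_norm M = frob n n f" unfolding fro_norm_fn[OF MC] by (intro frob_cong) (simp add: M)
  have f12: "(norm12 M)\<^sup>2 = (\<Sum>j<n. (\<Sum>i<n. \<bar>f i j\<bar>)\<^sup>2)"
    by (simp add: norm12_def M sum_nonneg)
  have "(fro_norm (decode_mat w n k (emitted A (n * k)) * transpose_mat (decode_mat w n k (emitted A (n * k))) * M - M))\<^sup>2
      \<le> 10 * (fro_norm (M - B))\<^sup>2 + 1040 / (real R)\<^sup>2 * (fro_norm M)\<^sup>2 + 2304 * (real w)\<^sup>2 / t * (norm12 M)\<^sup>2"
    if B: "best_rank_approx k M B" for B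
  proof -
    have BC: "B \<in> carrier_mat n n" "vec_space.rank n B \<le> k" using B MC by (auto simp: best_rank_approx_def)
    have fB: "fro_norm (M - B) = frob n n (\<lambda>i j. f i j - B $$ (i, j))"
      using BC MC by (subst fro_norm_fn[of _ n n]) (auto simp: M intro!: frob_cong)
    have main: "(frob n n (defect n k (\<lambda>i a. lval (A 3) i a / q) f))\<^sup>2 \<le> 10 * (frob n n (\<lambda>i j. f i j - B $$ (i, j)))\<^sup>2 +
       1040 / (real R)\<^sup>2 * (frob n n f)\<^sup>2 + 2304 * (real w)\<^sup>2 / t * (\<Sum>j<n. (\<Sum>i<n. \<bar>f i j\<bar>)\<^sup>2)"
    proof (cases "us = []")
      case True
      then have f0: "f i j = 0" for i j by (simp add: f_def)
      have "(frob n n (defect n k (\<lambda>i a. lval (A 3) i a / q) f))\<^sup>2 = 0"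
        by (simp add: frob_sq defect_def f0)
      then show ?thesis by (simp add: sum_nonneg)
    next
      case False
      show ?thesis unfolding f_def
      proof (rule output_error)
        fix i j
        show "\<bar>entry us i j\<bar> < int R" using entry_abs_le[OF valid, of i j] len_us by linarith
      qed (use min False BC in auto)
    qed
    show ?thesis unfolding fB f12 fM unfolding decode_emitted M fro_norm_defect by (rule main)
  qed
  then show ?thesis using run unfolding M_def Let_def by (auto simp: length_emitted)
qed

end

context sketch_init
begin

lemma initial_state:
  assumes "2 ^ w \<ge> 130 + 4 * len" "E = nat \<lceil>1 / \<epsilon>\<rceil>"
  shows "\<exists>m'. reach w (comp_com 0 init_com) (0, load_params w n k \<epsilon> (replicate (130 + 4 * len) 0), []) (length (comp_com 0 init_com), m', []) \<and>
    load_params w n k \<epsilon> (replicate (130 + 4 * len) 0) \<in> {m. length m = 130 + 4 * len \<and> set m \<subseteq> {..<2 ^ w}} \<and>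
    inv_state [] m' \<and> out_state [] m'"
proof -
  let ?m = "load_params w n k \<epsilon> (replicate (130 + 4 * len) 0)"
  let ?v = "(\<lambda>_. 0)(0 := n, 1 := k, 2 := E) :: vars" let ?A = "\<lambda>_ _. 0 :: nat"
  have R: "R < W" by (rule word_bound[of _ 1]) auto
  then have b: "n < W" "k < W" "E < W" using n_le k_le E_le by linarith+
  have "represents w len (replicate (130 + 4 * len) 0) (\<lambda>_. 0) ?A"
    using assms(1) by (auto simp: represents_def)
  then have "represents w len ((replicate (130 + 4 * len) 0)[0 := n, 1 := k, 2 := E]) ?v ?A"
    by (intro represents_var) (use b in auto)
  moreover have "?m = (replicate (130 + 4 * len) 0)[0 := n, 1 := k, 2 := E]"
    using b by (simp add: load_params_def flip: assms(2))
  ultimately have rep: "represents w len ?m ?v ?A" by simp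
  have "words w (\<lambda>_. 0) ?A" using w_pos by (simp add: words_def)
  then have "words w ?v ?A" using b by auto
  from init_correct[OF this] obtain v' where v': "big_step w len init_com (?v, ?A) (v', ?A)" "words w v' ?A" "params v'"
    by (auto simp del: fun_upd_apply) (auto)
  obtain m' where m': "reach w (comp_com 0 init_com) (0, ?m, []) (length (comp_com 0 init_com), m', [])" "represents w len m' v' ?A"
    using compiled_reach[OF v'(1) rep wf_init w_pos] by blast
  have "inv_state [] m'" unfolding inv_state_def
    by (intro exI[of _ v'] exI[of _ ?A]) (use m'(2) v' in \<open>simp add: syndromes_def\<close>)
  moreover have "out_state [] m'" unfolding out_state_def using m'(2) v' by blast
  ultimately show ?thesis using m'(1) represents_memory[OF rep] by blast
qed

text \<open>The time bounds hold for all memories of the right shape, so \<open>Tu\<close> is chosen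
  before the stream.\<close>

lemma stream_run:
  assumes W: "130 + 4 * len \<le> 2 ^ w" and E: "E = nat \<lceil>1 / \<epsilon>\<rceil>"
  defines "alg \<equiv> Stream_Alg (comp_com 0 init_com) (comp_com 0 update_com) query_prog_code"
  shows "\<exists>Tu. \<forall>us. (\<forall>u\<in>set us. valid_update n u) \<longrightarrow>
    (\<exists>m. mem_after w (130 + 4 * len) Tu alg n k \<epsilon> us = return_spmf m \<and> out_state us m)"
proof -
  let ?Ms = "{m. length m = 130 + 4 * len \<and> set m \<subseteq> {..<2 ^ w}}"
  obtain T1 where T1: "\<forall>T\<ge>T1. \<forall>m\<in>?Ms. \<forall>m' out. reach w (comp_com 0 init_com) (0, m, []) (length (comp_com 0 init_com), m', out) \<longrightarrow>
      run w T (comp_com 0 init_com) m = return_spmf (m', out)" using uniform_time[OF finite_memories] by blast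
  obtain T2 where T2: "\<forall>T\<ge>T2. \<forall>m\<in>?Ms. \<forall>m' out. reach w (comp_com 0 update_com) (0, m, []) (length (comp_com 0 update_com), m', out) \<longrightarrow>
      run w T (comp_com 0 update_com) m = return_spmf (m', out)" using uniform_time[OF finite_memories] by blast
  define Tu where "Tu = max T1 T2"
  have "\<exists>m. mem_after w (130 + 4 * len) Tu alg n k \<epsilon> us = return_spmf m \<and> inv_state us m \<and> out_state us m"
    if "\<forall>u\<in>set us. valid_update n u" for us
    using that
  proof (induction us rule: rev_induct)
    case Nil
    obtain m' where m': "reach w (comp_com 0 init_com) (0, load_params w n k \<epsilon> (replicate (130 + 4 * len) 0), []) (length (comp_com 0 init_com), m', [])"
      "load_params w n k \<epsilon> (replicate (130 + 4 * len) 0) \<in> ?Ms" "inv_state [] m'" "out_state [] m'"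
      using initial_state[OF W E] by blast
    have "run w Tu (comp_com 0 init_com) (load_params w n k \<epsilon> (replicate (130 + 4 * len) 0)) = return_spmf (m', [])"
      using T1 m'(1,2) by (simp add: Tu_def)
    then show ?case using m'(3,4) by (auto simp: mem_after_def alg_def)
  next
    case (snoc u us)
    then obtain m where m: "mem_after w (130 + 4 * len) Tu alg n k \<epsilon> us = return_spmf m" "inv_state us m" by auto
    obtain m' where m': "reach w (comp_com 0 update_com) (0, load_update w u m, []) (length (comp_com 0 update_com), m', [])"
      "load_update w u m \<in> ?Ms" "inv_state (us @ [u]) m'" "out_state (us @ [u]) m'"
      using update_step[OF m(2)] snoc.prems by fastforce
    have "run w Tu (comp_com 0 update_com) (load_update w u m) = return_spmf (m', [])"
      using T2 m'(1,2) by (simp add: Tu_def)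
    moreover have "mem_after w (130 + 4 * len) Tu alg n k \<epsilon> (us @ [u]) =
       bind_spmf (mem_after w (130 + 4 * len) Tu alg n k \<epsilon> us) (\<lambda>m. map_spmf fst (run w Tu (comp_com 0 update_com) (load_update w u m)))"
      by (simp add: mem_after_def alg_def)
    ultimately show ?case using m(1) m'(3,4) by auto
  qed
  then show ?thesis by blast
qed

end

section \<open>Choice of the parameters\<close>

text \<open>\<open>word_size\<close> without its constant factor.\<close>

definition log_scale :: "nat \<Rightarrow> real \<Rightarrow> nat" where
  "log_scale n \<epsilon> = nat \<lceil>log 2 (1 + real n / \<epsilon>)\<rceil>"

lemma log_scale_facts:
  fixes n :: nat and \<epsilon> :: real
  assumes "1 \<le> n" "0 < \<epsilon>" "\<epsilon> < 1"
  shows "2 \<le> log_scale n \<epsilon>" "real (log_scale n \<epsilon>) \<le> 2 * log 2 (1 + real n / \<epsilon>)"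
    "1 \<le> log 2 (1 + real n / \<epsilon>)" "n \<le> 2 ^ log_scale n \<epsilon>" "nat \<lceil>1 / \<epsilon>\<rceil> \<le> 2 ^ log_scale n \<epsilon>"
    "1 / \<epsilon> \<le> 2 ^ log_scale n \<epsilon>"
proof -
  let ?B = "1 + real n / \<epsilon>" let ?L = "log_scale n \<epsilon>"
  have ne: "real n \<le> real n / \<epsilon>" "1 / \<epsilon> \<le> real n / \<epsilon>" "1 < 1 / \<epsilon>"
    using assms by (simp_all add: field_simps)
  then have B: "2 < ?B" by linarith
  have l1: "1 < log 2 ?B" using B by (subst less_log_iff) auto
  then show "1 \<le> log 2 ?B" by simp
  have L: "real ?L = real_of_int \<lceil>log 2 ?B\<rceil>" using l1 by (simp add: log_scale_def)
  then have "1 < real ?L" using l1 by linarith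
  then show "2 \<le> ?L" by simp
  show "real ?L \<le> 2 * log 2 ?B" using L l1 by linarith
  have "log 2 ?B \<le> real ?L" unfolding L by simp
  then have "?B \<le> 2 powr real ?L" using B by (subst (asm) log_le_iff) auto
  then have BL: "?B \<le> 2 ^ ?L" by (simp add: powr_realpow)
  moreover have "real (2 ^ ?L) = 2 ^ ?L" by simp
  ultimately have "real n \<le> real (2 ^ ?L)" using ne by linarith
  then show "n \<le> 2 ^ ?L" by (simp only: of_nat_le_iff)
  show "1 / \<epsilon> \<le> 2 ^ ?L" using BL ne by linarith
  have "real_of_int \<lceil>1 / \<epsilon>\<rceil> \<le> ?B" using ne by linarith
  moreover have "real_of_int (2 ^ ?L) = 2 ^ ?L" by simp
  ultimately have "real_of_int \<lceil>1 / \<epsilon>\<rceil> \<le> real_of_int (2 ^ ?L)" using BL by linarith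
  then have "\<lceil>1 / \<epsilon>\<rceil> \<le> 2 ^ ?L" by (simp only: of_int_le_iff)
  then show "nat \<lceil>1 / \<epsilon>\<rceil> \<le> 2 ^ ?L" by (simp add: nat_le_iff)
qed

lemma eighty_times_le: "10 \<le> x \<Longrightarrow> 80 * x \<le> (2::nat) ^ x"
  by (induction x rule: dec_induct) auto

definition sketch_alg :: stream_alg where
  "sketch_alg = Stream_Alg (comp_com 0 init_com) (comp_com 0 update_com) query_prog_code"

text \<open>The factor \<open>2 * a + 10\<close> makes \<open>R\<close> exceed the length of the
  stream, hence every entry of the matrix, and is large enough for \<open>w \<le> R\<close>; the
  factor 80 gives \<open>R ^ 80 = 2 ^ w\<close>. With \<open>R = 2 ^ x\<close>, a prime above
  \<open>2 R = 2 ^ (x + 1)\<close> exists up to \<open>2 ^ (2 * x + 3)\<close>, which is at most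
  \<open>R ^ 3\<close>.\<close>

lemma sketch_parameters:
  fixes a n k :: nat and \<epsilon> :: real
  assumes k: "1 \<le> k" "k \<le> n" and \<epsilon>: "0 < \<epsilon>" "\<epsilon> < 1"
  defines "w \<equiv> word_size (80 * (2 * a + 10)) n \<epsilon>" and "E \<equiv> nat \<lceil>1 / \<epsilon>\<rceil>"
    and "R \<equiv> (2::nat) ^ ((2 * a + 10) * log_scale n \<epsilon>)"
  defines "t \<equiv> k * (E * E) * (w * (w * w))"
  shows "w = 80 * ((2 * a + 10) * log_scale n \<epsilon>)"
    and "\<exists>p. sketch_init w n k E R p t" and "a * n ^ a < R" and "1 / \<epsilon> \<le> real R"
proof -
  let ?L = "log_scale n \<epsilon>" let ?x = "(2 * a + 10) * ?L"
  note F = log_scale_facts[of n \<epsilon>]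
  have n: "1 \<le> n" using k by simp
  have L: "2 \<le> ?L" "n \<le> 2 ^ ?L" "E \<le> 2 ^ ?L" "1 / \<epsilon> \<le> 2 ^ ?L" using F[OF n \<epsilon>] by (simp_all add: E_def)
  show w: "w = 80 * ?x" by (simp add: w_def word_size_def log_scale_def)
  have "10 * 2 \<le> (2 * a + 10) * ?L" using L by (intro mult_le_mono) auto
  then have x: "20 \<le> ?x" by simp
  have "1 * ?L \<le> ?x" by (rule mult_le_mono1) simp
  then have LR: "2 ^ ?L \<le> R" unfolding R_def by (intro power_increasing) auto
  then have nR: "n \<le> R" and ER: "E \<le> R" using L by linarith+
  have wR: "w \<le> R" unfolding w R_def using x by (intro eighty_times_le) simp
  have "real (2 ^ ?L) \<le> real R" using LR by (simp only: of_nat_le_iff)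
  moreover have "real (2 ^ ?L) = 2 ^ ?L" by simp
  ultimately show "1 / \<epsilon> \<le> real R" using L(4) by linarith
  show "a * n ^ a < R"
  proof -
    have "a * n ^ a \<le> 2 ^ a * (2 ^ ?L) ^ a" using L less_exp[of a] by (intro mult_le_mono power_mono) auto
    also have "\<dots> = 2 ^ (a + ?L * a)" by (simp add: power_add power_mult)
    also have "\<dots> < R" unfolding R_def
    proof (rule power_strict_increasing)
      have "a * 1 \<le> a * ?L" using L by (intro mult_le_mono2) simp
      moreover have "?x = a * ?L + ?L * a + 10 * ?L" by (simp add: algebra_simps)
      ultimately show "a + ?L * a < ?x" using L by linarith
    qed simp
    finally show ?thesis .
  qed
  have R16: "16 \<le> R"
  proof -
    have "(2::nat) ^ 4 \<le> R" unfolding R_def using x by (intro power_increasing) auto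
    then show ?thesis by simp
  qed
  have "0 < 1 / \<epsilon>" using \<epsilon> by simp
  then have "0 < \<lceil>1 / \<epsilon>\<rceil>" by (simp only: zero_less_ceiling)
  then have E1: "1 \<le> E" unfolding E_def by linarith
  have w1: "1 \<le> w" using w x by linarith
  obtain p0 :: nat where p0: "prime p0" "2 ^ (?x + 1) < p0" "p0 \<le> 2 ^ (2 * (?x + 1) + 1)"
    using exists_prime_between[of "?x + 1"] x by auto
  define p where "p = (LEAST y. prime y \<and> 2 * R < y)"
  have R2: "2 ^ (?x + 1) = 2 * R" by (simp add: R_def)
  have p: "prime p \<and> 2 * R < p" unfolding p_def by (rule LeastI[of _ p0]) (use p0 R2 in simp)
  have "p \<le> p0" unfolding p_def by (rule Least_le) (use p0 R2 in simp)
  also have "\<dots> \<le> 2 ^ (2 * (?x + 1) + 1)" by (rule p0)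
  also have "\<dots> \<le> 2 ^ (?x * 3)"   proof (rule power_increasing)
    have "2 * (y + 1) + 1 \<le> y * 3" if "20 \<le> y" for y :: nat using that by simp
    from this[OF x] show "2 * (?x + 1) + 1 \<le> ?x * 3" .
  qed simp
  also have "\<dots> = R ^ 3" unfolding R_def by (rule power_mult)
  finally have p3: "p \<le> R ^ 3" .
  show "\<exists>p. sketch_init w n k E R p t"
  proof (intro exI[of _ p], unfold_locales)
    show "R ^ 80 = 2 ^ w" unfolding R_def w power_mult[symmetric] by (simp add: mult.commute)
    show "t \<le> R ^ 6"
    proof -
      have "t \<le> R * (R * R) * (R * (R * R))" unfolding t_def using k nR ER wR by (intro mult_le_mono) linarith+
      then show ?thesis by (simp add: power_numeral_reduce)
    qed
    show "k \<le> t"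
    proof -
      have "k * (1 * 1) * (1 * (1 * 1)) \<le> t" unfolding t_def by (intro mult_le_mono E1 w1 order_refl)
      then show ?thesis by simp
    qed
    show "R = 2 ^ (w div 80)" by (simp add: R_def w)
    show "\<not> prime y" if "2 * R < y" "y < p" for y using not_less_Least[of y "\<lambda>y. prime y \<and> 2 * R < y"] that by (auto simp: p_def)
  qed (use w1 R16 nR k p p3 ER wR in \<open>auto simp: t_def\<close>)
qed

section \<open>Growth of the number of rows\<close>

lemma k_ln_k_facts:
  fixes k :: nat
  assumes "3 \<le> k"
  shows "1 \<le> ln (real k)" "1 \<le> real k * ln (real k)"
proof -
  have "exp 1 \<le> real k" using exp_le assms by linarith
  then show 1: "1 \<le> ln (real k)" using assms by (subst ln_ge_iff) auto
  have "1 * 1 \<le> real k * ln (real k)" using 1 assms by (intro mult_mono) auto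
  then show "1 \<le> real k * ln (real k)" by simp
qed

text \<open>For \<open>k \<ge> 3\<close> the product \<open>k ln k\<close> is at least 1, so
  rounding up and adding 1 costs at most a factor 3.\<close>

lemma sketch_rows_bigtheta: "(\<lambda>k. real (nat \<lceil>real k * ln (real k)\<rceil> + 1)) \<in> \<Theta>(\<lambda>k. real k * ln (real k))"
proof (rule bigthetaI')
  show "\<forall>\<^sub>F k in sequentially. 1 * norm (real k * ln (real k)) \<le> norm (real (nat \<lceil>real k * ln (real k)\<rceil> + 1)) \<and>
    norm (real (nat \<lceil>real k * ln (real k)\<rceil> + 1)) \<le> 3 * norm (real k * ln (real k))"
    using eventually_ge_at_top[of "3::nat"]
  proof eventually_elim
    case (elim k)
    have "1 \<le> real k * ln (real k)" by (rule k_ln_k_facts[OF elim])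
    then have n: "norm (real k * ln (real k)) = real k * ln (real k)"
      "real (nat \<lceil>real k * ln (real k)\<rceil>) = real_of_int \<lceil>real k * ln (real k)\<rceil>" by simp_all
    show ?case unfolding n real_norm_def using \<open>1 \<le> real k * ln (real k)\<close> n(2) by (auto simp: abs_if) linarith+
  qed
qed auto

lemma const_bigo: "(\<lambda>k. real 1) \<in> O(\<lambda>k. real k * (ln (real k))\<^sup>2)"
proof (rule bigoI)
  show "\<forall>\<^sub>F k in sequentially. norm (real 1) \<le> 1 * norm (real k * (ln (real k))\<^sup>2)"
    using eventually_ge_at_top[of "3::nat"]
  proof eventually_elim
    case (elim k)
    have "1 * 1 ^ 2 \<le> real k * (ln (real k))\<^sup>2" using k_ln_k_facts[OF elim] elim by (intro mult_mono power_mono) auto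
    then show ?case by simp
  qed
qed

text \<open>Origin of the constants: 138 from \<open>130 + 8 n t \<le> 138 n t\<close>; 4 from
  \<open>E \<le> 2 / \<epsilon>\<close>, squared; the fourth power from \<open>w ^ 4\<close>, three
  factors in \<open>t\<close> and one for the bits of a word; 21 from
  \<open>11 n k + 10 \<le> 21 n k\<close>. The output distribution is a point mass, so the
  probability bound holds as soon as its single output satisfies the error bound.\<close>

lemma sketch_main:
  fixes a n k :: nat and \<epsilon> :: real
  assumes k: "1 \<le> k" "k \<le> n" and \<epsilon>: "0 < \<epsilon>" "\<epsilon> < 1"
  defines "w \<equiv> word_size (80 * (2 * a + 10)) n \<epsilon>"
  shows "\<exists>(S :: nat) (Tu :: nat) (Tq :: nat).
     real (S * w) \<le> real (138 * 4 * (160 * (2 * a + 10)) ^ 4) * (real n * real k / \<epsilon>\<^sup>2) * (log 2 (1 + real n / \<epsilon>)) ^ (138 * 4 * (160 * (2 * a + 10)) ^ 4) \<and>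
     real Tq \<le> real n * real k * (real 21 * (1 + ln (real n) + 1 / \<epsilon>) ^ 21) \<and>
     (\<forall>us :: update list.
        (\<forall>u \<in> set us. valid_update n u) \<longrightarrow> length us \<le> a * n ^ a \<longrightarrow>
        (let M = log_mat (stream_mat n us);
             D = output_dist w S Tu Tq sketch_alg n k \<epsilon> us in
         lossless_spmf D \<and> (\<forall>out \<in> set_spmf D. length out = 2 * (n * k)) \<and>
         (\<forall>B. best_rank_approx k M B \<longrightarrow>
            measure (measure_spmf D)
              {out. let L = decode_mat w n k out in
                 (fro_norm (L * transpose_mat L * M - M))\<^sup>2
                   \<le> 10 * (fro_norm (M - B))\<^sup>2 + 1040 * (\<epsilon> * real 1) * (fro_norm M)\<^sup>2
                     + 6912 * (\<epsilon>\<^sup>2 / real (nat \<lceil>real k * ln (real k)\<rceil> + 1)) * (norm12 M)\<^sup>2}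
              \<ge> 9 / 10)))"
proof -
  define E where "E = nat \<lceil>1 / \<epsilon>\<rceil>"
  define R where "R = (2::nat) ^ ((2 * a + 10) * log_scale n \<epsilon>)"
  define t where "t = k * (E * E) * (w * (w * w))"
  let ?s = "real (nat \<lceil>real k * ln (real k)\<rceil> + 1)" let ?lam = "log 2 (1 + real n / \<epsilon>)"
  have n1: "1 \<le> n" using k by simp
  note P = sketch_parameters[OF k \<epsilon>, of a, folded w_def E_def R_def t_def]
  obtain p where "sketch_init w n k E R p t" using P(2) by (auto simp: t_def)
  then interpret sketch_init w n k E R p t .
  note F = log_scale_facts[OF n1 \<epsilon>]
  let ?S = "130 + 4 * (n * (2 * t))" let ?Tq = "11 * (n * k) + 10"
  have SR: "?S \<le> 2 ^ w"
  proof -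
    have "n * t \<le> R * R ^ 6" using n_le t_le by (rule mult_le_mono)
    also have "\<dots> = R ^ 7" by (simp add: power_numeral_reduce)
    finally have "?S \<le> 130 + 8 * R ^ 7" by simp
    also have "130 \<le> R ^ 7 * 8"
    proof -
      have "(16::nat) ^ 7 \<le> R ^ 7" using R_ge by (rule power_mono) simp
      then show ?thesis by simp
    qed
    also have "R ^ 7 * 8 + 8 * R ^ 7 = R ^ 7 * 16" by simp
    also have "\<dots> \<le> R ^ 7 * R" using R_ge by (rule mult_le_mono2)
    also have "\<dots> = R ^ 8" by (simp add: power_numeral_reduce)
    finally show ?thesis using word_bound[of ?S 8] by simp
  qed
  obtain Tu where Tu: "\<And>us. (\<forall>u\<in>set us. valid_update n u) \<Longrightarrow>
      \<exists>m. mem_after w ?S Tu sketch_alg n k \<epsilon> us = return_spmf m \<and> out_state us m"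
    using stream_run[OF SR E_def] unfolding sketch_alg_def by blast
  have E_real: "1 / \<epsilon> \<le> real E" "real E \<le> 2 / \<epsilon>"
  proof -
    have "1 \<le> 1 / \<epsilon>" "real E = real_of_int \<lceil>1 / \<epsilon>\<rceil>" using \<epsilon> by (simp_all add: E_def)
    then show "1 / \<epsilon> \<le> real E" "real E \<le> 2 / \<epsilon>" by linarith+
  qed
  have lam1: "1 \<le> ?lam" by (rule F)
  have wlam: "real w \<le> 160 * real (2 * a + 10) * ?lam"
  proof -
    have "real w = 80 * real (2 * a + 10) * real (log_scale n \<epsilon>)" unfolding P(1) by simp
    also have "\<dots> \<le> 80 * real (2 * a + 10) * (2 * ?lam)" using F(2) by (intro mult_left_mono) auto
    finally show ?thesis by (simp add: algebra_simps)
  qed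
  have space: "real (?S * w) \<le> real (138 * 4 * (160 * (2 * a + 10)) ^ 4) * (real n * real k / \<epsilon>\<^sup>2) * ?lam ^ (138 * 4 * (160 * (2 * a + 10)) ^ 4)"
  proof -
    have "?S * w \<le> 138 * (n * t) * w" using pos by (intro mult_le_mono1) (simp add: Suc_le_eq)
    also have "\<dots> = 138 * (n * k) * (E * E) * w ^ 4" by (simp add: t_def power_numeral_reduce ac_simps)
    finally have "real (?S * w) \<le> real (138 * (n * k) * (E * E) * w ^ 4)" by (simp only: of_nat_le_iff)
    also have "\<dots> = 138 * (real n * real k) * (real E * real E) * real w ^ 4" by simp
    also have "\<dots> \<le> 138 * (real n * real k) * ((2 / \<epsilon>) * (2 / \<epsilon>)) * (160 * real (2 * a + 10) * ?lam) ^ 4"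
      using E_real wlam \<epsilon> by (intro mult_mono power_mono mult_left_mono) auto
    also have "\<dots> = real (138 * 4 * (160 * (2 * a + 10)) ^ 4) * (real n * real k / \<epsilon>\<^sup>2) * ?lam ^ 4"
      by (simp add: power_mult_distrib power2_eq_square del: power_mult_numeral)
    also have "\<dots> \<le> real (138 * 4 * (160 * (2 * a + 10)) ^ 4) * (real n * real k / \<epsilon>\<^sup>2) * ?lam ^ (138 * 4 * (160 * (2 * a + 10)) ^ 4)"
    proof (intro mult_left_mono power_increasing lam1)
      have "138 * 4 * 1 \<le> 138 * 4 * (160 * (2 * a + 10)) ^ 4" by (intro mult_le_mono2 one_le_power) simp
      then show "4 \<le> 138 * 4 * (160 * (2 * a + 10)) ^ 4" by linarith
    qed simp
    finally show ?thesis .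
  qed
  have time: "real ?Tq \<le> real n * real k * (real 21 * (1 + ln (real n) + 1 / \<epsilon>) ^ 21)"
  proof -
    have "1 \<le> n * k" using k by (simp add: Suc_le_eq)
    then have "?Tq \<le> n * k * 21" by simp
    then have "real ?Tq \<le> real (n * k * 21)" by (simp only: of_nat_le_iff)
    also have "\<dots> = real n * real k * (real 21 * 1)" by simp
    also have "\<dots> \<le> real n * real k * (real 21 * (1 + ln (real n) + 1 / \<epsilon>) ^ 21)"
      using n1 \<epsilon> by (intro mult_left_mono one_le_power) auto
    finally show ?thesis .
  qed
  \<comment> \<open>Here the third factor \<open>w\<close> of \<open>t\<close> is spent:
    \<open>ln k \<le> w\<close>, while rounding up and the added 1 are covered by the factor
    3.\<close>
  have s: "?s \<le> 3 * (real k * real w)"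
  proof -
    have "ln (real k) \<le> real w"
    proof -
      have "real k \<le> real (2 ^ w)" using k n_le word_bound[of R 1] by (simp only: of_nat_le_iff) simp
      then have "ln (real k) \<le> ln (2 ^ w)" using k by (subst ln_le_cancel_iff) auto
      also have "\<dots> = real w * ln 2" by (simp add: ln_realpow)
      also have "\<dots> \<le> real w * 1" using ln_2_less_1 by (intro mult_left_mono) auto
      finally show ?thesis by simp
    qed
    then have "real k * ln (real k) \<le> real k * real w" by (intro mult_left_mono) auto
    moreover have "1 * 1 \<le> real k * real w" using k w_pos by (intro mult_mono) auto
    moreover have "0 \<le> real k * ln (real k)" using k by simp
    ultimately show ?thesis by (simp add: le_nat_iff) linarith
  qed
  \<comment> \<open>Since \<open>1 / R \<le> \<epsilon>\<close>, the rounding errors are even of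
    order \<open>\<epsilon>\<^sup>2\<close>.\<close>
  have c1: "1040 / (real R)\<^sup>2 \<le> 1040 * (\<epsilon> * real 1)"
  proof -
    have "1 / real R \<le> \<epsilon>" using P(4) \<epsilon> pos by (simp add: field_simps)
    then have "(1 / real R)\<^sup>2 \<le> \<epsilon>\<^sup>2" by (rule power_mono) simp
    also have "\<dots> \<le> \<epsilon>" using \<epsilon> by (simp add: power2_eq_square)
    finally show ?thesis by (simp add: power_divide)
  qed
  \<comment> \<open>By the choice of \<open>t\<close> the quotient \<open>w\<^sup>2 / t\<close> is
    \<open>1 / (k E\<^sup>2 w)\<close>; now \<open>1 / E \<le> \<epsilon>\<close> and
    \<open>s \<le> 3 k w\<close>, whence \<open>6912 = 3 * 2304\<close>.\<close>
  have c2: "2304 * (real w)\<^sup>2 / real t \<le> 6912 * (\<epsilon>\<^sup>2 / ?s)"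
  proof -
    have w0: "0 < real w" and k0: "0 < real k" using w_pos k by simp_all
    have E0: "0 < real E" using E_real \<epsilon> by (meson less_le_trans zero_less_divide_1_iff)
    have "2304 * (real w)\<^sup>2 / real t = 2304 * ((1 / real E)\<^sup>2 / (real k * real w))"
      using w0 k0 E0 by (simp add: t_def power2_eq_square field_simps)
    also have "\<dots> \<le> 2304 * (\<epsilon>\<^sup>2 / (real k * real w))"
    proof (intro mult_left_mono divide_right_mono power_mono)
      show "1 / real E \<le> \<epsilon>" using E_real E0 \<epsilon> by (simp add: field_simps)
    qed (use k0 w0 E0 in auto)
    also have "\<dots> \<le> 2304 * (\<epsilon>\<^sup>2 / (?s / 3))"
    proof (intro mult_left_mono divide_left_mono)
      have "0 < ?s" by (simp only: of_nat_0_less_iff)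
      then have "0 < ?s / 3" by (rule divide_pos_pos) simp
      then show "0 < real k * real w * (?s / 3)" by (intro mult_pos_pos k0 w0)
      have "x / 3 \<le> y" if "x \<le> 3 * y" for x y :: real using that by simp
      from this[OF s] show "?s / 3 \<le> real k * real w" .
    qed simp_all
    also have "\<dots> = 6912 * (\<epsilon>\<^sup>2 / ?s)" by simp
    finally show ?thesis .
  qed
  show ?thesis
  proof (rule exI[of _ ?S], rule exI[of _ Tu], rule exI[of _ ?Tq], intro conjI allI impI space time)
    fix us :: "update list"
    let ?M = "log_mat (stream_mat n us)"
    assume us: "\<forall>u\<in>set us. valid_update n u" "length us \<le> a * n ^ a"
    obtain m where m: "mem_after w ?S Tu sketch_alg n k \<epsilon> us = return_spmf m" "out_state us m" using Tu[OF us(1)] by blast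
    have "length us < R" using us(2) P(3) by simp
    from output_quality[OF m(2) us(1) this order_refl] obtain m' out where
      r: "run w ?Tq query_prog_code m = return_spmf (m', out)" "length out = 2 * (n * k)"
      and q: "\<And>B. best_rank_approx k (log_mat (stream_mat n us)) B \<Longrightarrow>
        (let M = log_mat (stream_mat n us); L = decode_mat w n k out in
         (fro_norm (L * transpose_mat L * M - M))\<^sup>2 \<le> 10 * (fro_norm (M - B))\<^sup>2 +
           1040 / (real R)\<^sup>2 * (fro_norm M)\<^sup>2 + 2304 * (real w)\<^sup>2 / t * (norm12 M)\<^sup>2)"
      by blast
    have D: "output_dist w ?S Tu ?Tq sketch_alg n k \<epsilon> us = return_spmf out"
      using m(1) r(1) by (simp add: output_dist_def sketch_alg_def)
    have c: "1040 / (real R)\<^sup>2 * (fro_norm ?M)\<^sup>2 \<le> 1040 * (\<epsilon> * real 1) * (fro_norm ?M)\<^sup>2"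
      "2304 * (real w)\<^sup>2 / t * (norm12 ?M)\<^sup>2 \<le> 6912 * (\<epsilon>\<^sup>2 / ?s) * (norm12 ?M)\<^sup>2"
      by (rule mult_right_mono[OF c1], simp, rule mult_right_mono[OF c2], simp)
    have point: "9 / 10 \<le> measure (measure_spmf (return_spmf out)) Y" if "out \<in> Y" for Y
      using that by (simp add: measure_spmf_return_spmf measure_return)
    show "let M = ?M; D = output_dist w ?S Tu ?Tq sketch_alg n k \<epsilon> us in
         lossless_spmf D \<and> (\<forall>out \<in> set_spmf D. length out = 2 * (n * k)) \<and>
         (\<forall>B. best_rank_approx k M B \<longrightarrow>
            measure (measure_spmf D)
              {out. let L = decode_mat w n k out in
                 (fro_norm (L * transpose_mat L * M - M))\<^sup>2
                   \<le> 10 * (fro_norm (M - B))\<^sup>2 + 1040 * (\<epsilon> * real 1) * (fro_norm M)\<^sup>2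
                     + 6912 * (\<epsilon>\<^sup>2 / ?s) * (norm12 M)\<^sup>2}
              \<ge> 9 / 10)"
      unfolding Let_def D
    proof (intro conjI allI impI point CollectI)
      fix B assume "best_rank_approx k ?M B"
      from q[OF this] show "(fro_norm (decode_mat w n k out * transpose_mat (decode_mat w n k out) * ?M - ?M))\<^sup>2
          \<le> 10 * (fro_norm (?M - B))\<^sup>2 + 1040 * (\<epsilon> * real 1) * (fro_norm ?M)\<^sup>2 + 6912 * (\<epsilon>\<^sup>2 / ?s) * (norm12 ?M)\<^sup>2"
        using c unfolding Let_def by linarith
    qed (use r(2) in simp_all)
  qed
qed

theorem theoremC10:
  "\<exists>(s :: nat \<Rightarrow> nat) (d\<^sub>1 :: nat \<Rightarrow> nat) (d\<^sub>2 :: nat \<Rightarrow> real \<Rightarrow> nat) (C\<^sub>1 :: real) (C\<^sub>2 :: real) (C\<^sub>3 :: real).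
     (\<forall>k\<ge>1. s k > 0) \<and> (\<lambda>k. real (s k)) \<in> \<Theta>(\<lambda>k. real k * ln (real k)) \<and>
     (\<lambda>k. real (d\<^sub>1 k)) \<in> O(\<lambda>k. real k * (ln (real k))\<^sup>2) \<and>
     (\<forall>k\<ge>1. \<forall>\<epsilon>\<in>{0<..<1}. real (d\<^sub>2 k \<epsilon>) \<le> C\<^sub>3 * (real k / \<epsilon>)) \<and>
     (\<forall>a :: nat. \<exists>(alg :: stream_alg) (cw :: nat) (cs :: nat) (ct :: nat).
        \<forall>(n :: nat) (k :: nat) (\<epsilon> :: real). 1 \<le> k \<longrightarrow> k \<le> n \<longrightarrow> 0 < \<epsilon> \<longrightarrow> \<epsilon> < 1 \<longrightarrow>
          (let w = word_size cw n \<epsilon> in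
           \<exists>(S :: nat) (Tu :: nat) (Tq :: nat).
             real (S * w) \<le> real cs * (real n * real k / \<epsilon>\<^sup>2) * (log 2 (1 + real n / \<epsilon>)) ^ cs \<and>
             real Tq \<le> real n * real k * (real ct * (1 + ln (real n) + 1 / \<epsilon>) ^ ct) \<and>
             (\<forall>us :: update list.
                (\<forall>u \<in> set us. valid_update n u) \<longrightarrow> length us \<le> a * n ^ a \<longrightarrow>
                (let M = log_mat (stream_mat n us);
                     D = output_dist w S Tu Tq alg n k \<epsilon> us in
                 lossless_spmf D \<and> (\<forall>out \<in> set_spmf D. length out = 2 * (n * k)) \<and>
                 (\<forall>M\<^sub>k. best_rank_approx k M M\<^sub>k \<longrightarrow>
                    measure (measure_spmf D)
                      {out. let L = decode_mat w n k out in
                         (fro_norm (L * transpose_mat L * M - M))\<^sup>2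
                           \<le> 10 * (fro_norm (M - M\<^sub>k))\<^sup>2
                             + C\<^sub>1 * (\<epsilon> * real (d\<^sub>1 k)) * (fro_norm M)\<^sup>2
                             + C\<^sub>2 * (\<epsilon>\<^sup>2 / real (s k)) * (norm12 M)\<^sup>2}
                      \<ge> 9 / 10)))))"
  \<comment> \<open>The added 1 keeps \<open>s k\<close> positive at \<open>k = 1\<close>, where the
    logarithm vanishes.\<close>
  apply (rule exI[of _ "\<lambda>k. nat \<lceil>real k * ln (real k)\<rceil> + 1"], rule exI[of _ "\<lambda>_. 1"], rule exI[of _ "\<lambda>_ _. 0"])
  apply (rule exI[of _ 1040], rule exI[of _ 6912], rule exI[of _ 0], intro conjI)
      apply simp
     apply (rule sketch_rows_bigtheta)
    apply (rule const_bigo)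
   apply simp
  apply (rule allI)
  \<comment> \<open>The program is the same for all \<open>a\<close>; the degree of the stream
    length enters only through the word length and the constant of the space bound.\<close>
  subgoal for a
    unfolding Let_def
    by (rule exI[of _ sketch_alg], rule exI[of _ "80 * (2 * a + 10)"],
        rule exI[of _ "138 * 4 * (160 * (2 * a + 10)) ^ 4"], rule exI[of _ 21], intro allI impI)
      (rule sketch_main[unfolded Let_def])
  done

end
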